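(* Let $A=C^1[0,1]$. The topologies $\tau$ and $\tau_r$ coincide on $Id(A)$. Hence $\tau_r$ is a compact, Hausdorff topology on $Id(A)$.
   Context: $A=C^1[0,1]$ is the Banach algebra of continuously differentiable complex-valued functions on $[0,1]$ with norm $\Vert f\Vert=\Vert f\Vert_\infty+\Vert f'\Vert_\infty$, where $\Vert\cdot\Vert_\infty$ is the supremum norm. $Id(A)$ is the set of all closed two-sided ideals of $A$, and for $a\in A$, $I\in Id(A)$, $\Vert a+I\Vert$ denotes the quotient norm of $a+I$ in $A/I$. Topology $\tau_r$: the topology $\tau_u$ is the weakest topology on $Id(A)$ for which all the functions $I\mapsto\Vert a+I\Vert$ ($a\in A$) are upper semi-continuous. A net $(I_\alpha)$ in $Id(A)$ has the normality property with respect to $I\in Id(A)$ if, for every $a\in A$, $a\notin I$ implies $\liminf_\alpha\Vert a+I_\alpha\Vert>0$. The topology $\tau_n$ on $Id(A)$ is the topology whose closed sets are exactly the subsets $N\subseteq Id(A)$ such that whenever $(I_\alpha)$ is a net in $N$ having the normality property with respect to some $I\in Id(A)$, then $I\in N$. The topology $\tau_r$ is the topology on $Id(A)$ generated by $\tau_u$ and $\tau_n$ (their join). Topology $\tau$: for $(x,y)\in[0,1]^2$ and $f\in A$ put $\phi_{x,y}(f)=\frac{f(x)-f(y)}{x-y}$ if $x\neq y$ and $\phi_{x,x}(f)=f'(x)$. For a compact metric space $Y$, let $H(Y)$ be the set of closed subsets of $Y$ (including the empty set) with the Fell topology, i.e. the topology with subbasic open sets $\{F: F\cap C=\emptyset\}$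 ($C\subseteq Y$ compact) and $\{F: F\cap U\neq\emptyset\}$ ($U\subseteq Y$ open); this is compact and Hausdorff. Let $K$ be the set of pairs $(C,D)\in H([0,1])\times H([0,1]^2)$ such that (i) $D\subseteq C\times C$ and (ii) $D$ contains all points $(x,y)\in C\times C$ with $x\neq y$. Give $K$ the restriction of the product of the Fell topologies. The map $$(C,D)\mapsto I(C,D)=\{f\in A: f(x)=0\ (x\in C),\ \phi_{x,y}(f)=0\ ((x,y)\in D)\}$$ is a bijection from $K$ onto $Id(A)$ (by the well-known description of the closed ideals of $C^1[0,1]$), and $\tau$ denotes the topology on $Id(A)$ obtained by transporting the topology of $K$ via this bijection. *)

theory Defs
  imports "HOL-Analysis.Analysis"
begin

section \<open>The Banach algebra \<open>C\<^sup>1[0,1]\<close>\<close>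

text \<open>
  The derivatives at the endpoints are one-sided. A function on \<open>[0,1]\<close> is represented by its
  extension by 0 to the real line, so that equality in the type is equality on \<open>[0,1]\<close>.
\<close>

typedef c1 = "{f :: real \<Rightarrow> complex.
    (\<exists>f'. continuous_on {0..1} f' \<and>
          (\<forall>x\<in>{0..1}. (f has_vector_derivative f' x) (at x within {0..1}))) \<and>
    (\<forall>x. x \<notin> {0..1} \<longrightarrow> f x = 0)}"
  morphisms c1_fun Abs_c1
  by (rule exI[of _ "\<lambda>_. 0"]) (auto intro!: exI[of _ "\<lambda>_. 0"])

definition c1_deriv :: "c1 \<Rightarrow> real \<Rightarrow> complex" where
  "c1_deriv f x = vector_derivative (c1_fun f) (at x within {0..1})"

definition mk_c1 :: "(real \<Rightarrow> complex) \<Rightarrow> c1" where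
  "mk_c1 f = Abs_c1 (\<lambda>x. if x \<in> {0..1} then f x else 0)"

lemma c1_fun_outside: "x \<notin> {0..1} \<Longrightarrow> c1_fun f x = 0"
  using c1_fun[of f] by auto

lemma c1_vector_derivative_eq:
  assumes "(f has_vector_derivative d) (at x within {0..1})" "x \<in> {0..1::real}"
  shows "vector_derivative f (at x within {0..1}) = d"
  using vector_derivative_within_cbox[of 0 1 x f d] assms by simp

lemma c1_has_deriv:
  assumes "x \<in> {0..1}"
  shows "(c1_fun f has_vector_derivative c1_deriv f x) (at x within {0..1})"
proof -
  obtain f' where "\<forall>x\<in>{0..1}. (c1_fun f has_vector_derivative f' x) (at x within {0..1})"
    using c1_fun[of f] by auto
  then show ?thesis
    using assms c1_vector_derivative_eq unfolding c1_deriv_def by metis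
qed

lemma c1_deriv_unique:
  assumes "(c1_fun f has_vector_derivative d) (at x within {0..1})" "x \<in> {0..1}"
  shows "c1_deriv f x = d"
  using c1_vector_derivative_eq[OF assms] by (simp add: c1_deriv_def)

lemma continuous_on_c1_deriv: "continuous_on {0..1} (c1_deriv f)"
proof -
  obtain f' where f': "continuous_on {0..1} f'"
    "\<forall>x\<in>{0..1}. (c1_fun f has_vector_derivative f' x) (at x within {0..1})"
    using c1_fun[of f] by auto
  then have "c1_deriv f x = f' x" if "x \<in> {0..1}" for x
    using c1_deriv_unique that by blast
  then show ?thesis
    using continuous_on_eq[OF f'(1), of "c1_deriv f"] by simp
qed

lemma continuous_on_c1_fun: "continuous_on {0..1} (c1_fun f)"
  by (rule continuous_on_vector_derivative) (rule c1_has_deriv)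

lemma c1_eqI:
  assumes "\<And>x. x \<in> {0..1} \<Longrightarrow> c1_fun f x = c1_fun g x"
  shows "f = g"
proof -
  have "c1_fun f = c1_fun g"
    using assms c1_fun_outside by (metis ext)
  then show ?thesis by (simp add: c1_fun_inject)
qed

lemma
  assumes d: "\<And>x. x \<in> {0..1} \<Longrightarrow> (f has_vector_derivative f' x) (at x within {0..1})"
    and c: "continuous_on {0..1} f'"
  shows c1_fun_mk_c1: "c1_fun (mk_c1 f) = (\<lambda>x. if x \<in> {0..1} then f x else 0)" (is ?A)
    and c1_deriv_mk_c1: "x \<in> {0..1} \<Longrightarrow> c1_deriv (mk_c1 f) x = f' x"
proof -
  have d': "((\<lambda>x. if x \<in> {0..1} then f x else 0) has_vector_derivative f' x) (at x within {0..1})"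
    if "x \<in> {0..1}" for x
    by (rule has_vector_derivative_transform[OF that _ d[OF that]]) auto
  show A: ?A
    unfolding mk_c1_def
    by (rule Abs_c1_inverse) (use c d' in \<open>auto intro!: exI[of _ f']\<close>)
  show "c1_deriv (mk_c1 f) x = f' x" if "x \<in> {0..1}"
    using d'[OF that] that A by (auto intro!: c1_deriv_unique)
qed

instantiation c1 :: comm_ring_1
begin
definition "0 = mk_c1 (\<lambda>x. 0)"
definition "1 = mk_c1 (\<lambda>x. 1)"
definition "f + g = mk_c1 (\<lambda>x. c1_fun f x + c1_fun g x)"
definition "f - g = mk_c1 (\<lambda>x. c1_fun f x - c1_fun g x)"
definition "- f = mk_c1 (\<lambda>x. - c1_fun f x)"
definition "f * g = mk_c1 (\<lambda>x. c1_fun f x * c1_fun g x)"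

lemma
  shows c1_fun_zero: "x \<in> {0..1} \<Longrightarrow> c1_fun 0 x = 0"
    and c1_deriv_zero: "x \<in> {0..1} \<Longrightarrow> c1_deriv 0 x = 0"
  unfolding zero_c1_def
  by (simp_all add: c1_fun_mk_c1[where f'="\<lambda>x. 0"] c1_deriv_mk_c1[where f'="\<lambda>x. 0"])

lemma
  shows c1_fun_one: "x \<in> {0..1} \<Longrightarrow> c1_fun 1 x = 1"
    and c1_deriv_one: "x \<in> {0..1} \<Longrightarrow> c1_deriv 1 x = 0"
  unfolding one_c1_def
  by (simp_all add: c1_fun_mk_c1[where f'="\<lambda>x. 0"] c1_deriv_mk_c1[where f'="\<lambda>x. 0"])

lemma
  shows c1_fun_add: "x \<in> {0..1} \<Longrightarrow> c1_fun (f + g) x = c1_fun f x + c1_fun g x"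
    and c1_deriv_add: "x \<in> {0..1} \<Longrightarrow> c1_deriv (f + g) x = c1_deriv f x + c1_deriv g x"
proof -
  have a: "((\<lambda>x. c1_fun f x + c1_fun g x) has_vector_derivative c1_deriv f x + c1_deriv g x)
      (at x within {0..1})" if "x \<in> {0..1}" for x
    using that by (intro has_vector_derivative_add c1_has_deriv)
  have b: "continuous_on {0..1} (\<lambda>x. c1_deriv f x + c1_deriv g x)"
    by (intro continuous_on_add continuous_on_c1_deriv)
  show "x \<in> {0..1} \<Longrightarrow> c1_fun (f + g) x = c1_fun f x + c1_fun g x"
    unfolding plus_c1_def by (subst c1_fun_mk_c1[OF _ b], erule a, simp)
  show "x \<in> {0..1} \<Longrightarrow> c1_deriv (f + g) x = c1_deriv f x + c1_deriv g x"
    unfolding plus_c1_def by (rule c1_deriv_mk_c1[OF _ b], erule a)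
qed

lemma
  shows c1_fun_diff: "x \<in> {0..1} \<Longrightarrow> c1_fun (f - g) x = c1_fun f x - c1_fun g x"
    and c1_deriv_diff: "x \<in> {0..1} \<Longrightarrow> c1_deriv (f - g) x = c1_deriv f x - c1_deriv g x"
proof -
  have a: "((\<lambda>x. c1_fun f x - c1_fun g x) has_vector_derivative c1_deriv f x - c1_deriv g x)
      (at x within {0..1})" if "x \<in> {0..1}" for x
    using that by (intro has_vector_derivative_diff c1_has_deriv)
  have b: "continuous_on {0..1} (\<lambda>x. c1_deriv f x - c1_deriv g x)"
    by (intro continuous_on_diff continuous_on_c1_deriv)
  show "x \<in> {0..1} \<Longrightarrow> c1_fun (f - g) x = c1_fun f x - c1_fun g x"
    unfolding minus_c1_def by (subst c1_fun_mk_c1[OF _ b], erule a, simp)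
  show "x \<in> {0..1} \<Longrightarrow> c1_deriv (f - g) x = c1_deriv f x - c1_deriv g x"
    unfolding minus_c1_def by (rule c1_deriv_mk_c1[OF _ b], erule a)
qed

lemma
  shows c1_fun_uminus: "x \<in> {0..1} \<Longrightarrow> c1_fun (- f) x = - c1_fun f x"
    and c1_deriv_uminus: "x \<in> {0..1} \<Longrightarrow> c1_deriv (- f) x = - c1_deriv f x"
proof -
  have a: "((\<lambda>x. - c1_fun f x) has_vector_derivative - c1_deriv f x) (at x within {0..1})"
    if "x \<in> {0..1}" for x
    using that by (intro has_vector_derivative_minus c1_has_deriv)
  have b: "continuous_on {0..1} (\<lambda>x. - c1_deriv f x)"
    by (intro continuous_on_minus continuous_on_c1_deriv)
  show "x \<in> {0..1} \<Longrightarrow> c1_fun (- f) x = - c1_fun f x"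
    unfolding uminus_c1_def by (subst c1_fun_mk_c1[OF _ b], erule a, simp)
  show "x \<in> {0..1} \<Longrightarrow> c1_deriv (- f) x = - c1_deriv f x"
    unfolding uminus_c1_def by (rule c1_deriv_mk_c1[OF _ b], erule a)
qed

lemma
  shows c1_fun_mult: "x \<in> {0..1} \<Longrightarrow> c1_fun (f * g) x = c1_fun f x * c1_fun g x"
    and c1_deriv_mult: "x \<in> {0..1} \<Longrightarrow>
          c1_deriv (f * g) x = c1_fun f x * c1_deriv g x + c1_deriv f x * c1_fun g x"
proof -
  have a: "((\<lambda>x. c1_fun f x * c1_fun g x) has_vector_derivative
      c1_fun f x * c1_deriv g x + c1_deriv f x * c1_fun g x) (at x within {0..1})"
    if "x \<in> {0..1}" for x
    using that by (intro has_vector_derivative_mult c1_has_deriv)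
  have b: "continuous_on {0..1} (\<lambda>x. c1_fun f x * c1_deriv g x + c1_deriv f x * c1_fun g x)"
    by (intro continuous_on_add continuous_on_mult continuous_on_c1_deriv continuous_on_c1_fun)
  show "x \<in> {0..1} \<Longrightarrow> c1_fun (f * g) x = c1_fun f x * c1_fun g x"
    unfolding times_c1_def by (subst c1_fun_mk_c1[OF _ b], erule a, simp)
  show "x \<in> {0..1} \<Longrightarrow>
      c1_deriv (f * g) x = c1_fun f x * c1_deriv g x + c1_deriv f x * c1_fun g x"
    unfolding times_c1_def by (rule c1_deriv_mk_c1[OF _ b], erule a)
qed

instance
proof
  show "(0::c1) \<noteq> 1"
  proof
    assume "(0::c1) = 1"
    then have "c1_fun 0 0 = c1_fun 1 0" by simp
    then show False by (simp add: c1_fun_zero c1_fun_one)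
  qed
qed (rule c1_eqI; simp add: c1_fun_zero c1_fun_one c1_fun_add c1_fun_diff c1_fun_uminus
      c1_fun_mult algebra_simps)+
end

instantiation c1 :: real_normed_vector
begin
definition "scaleR r f = mk_c1 (\<lambda>x. r *\<^sub>R c1_fun f x)"
definition "norm f = (SUP x\<in>{0..1}. cmod (c1_fun f x)) + (SUP x\<in>{0..1}. cmod (c1_deriv f x))"
definition "dist (f::c1) g = norm (f - g)"
definition "sgn (f::c1) = inverse (norm f) *\<^sub>R f"
definition uniformity_c1 :: "(c1 \<times> c1) filter" where
  "uniformity_c1 = (INF e\<in>{0<..}. principal {(f, g). dist f g < e})"
definition open_c1 :: "c1 set \<Rightarrow> bool" where
  "open_c1 U = (\<forall>f\<in>U. \<forall>\<^sub>F (f', g) in uniformity. f' = f \<longrightarrow> g \<in> U)"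

lemma
  shows c1_fun_scaleR: "x \<in> {0..1} \<Longrightarrow> c1_fun (r *\<^sub>R f) x = r *\<^sub>R c1_fun f x"
    and c1_deriv_scaleR: "x \<in> {0..1} \<Longrightarrow> c1_deriv (r *\<^sub>R f) x = r *\<^sub>R c1_deriv f x"
proof -
  have a: "((\<lambda>x. r *\<^sub>R c1_fun f x) has_vector_derivative r *\<^sub>R c1_deriv f x) (at x within {0..1})"
    if "x \<in> {0..1}" for x
    using that
    by (intro bounded_linear.has_vector_derivative[OF bounded_linear_scaleR_right] c1_has_deriv)
  have b: "continuous_on {0..1} (\<lambda>x. r *\<^sub>R c1_deriv f x)"
    by (intro continuous_on_scaleR continuous_on_const continuous_on_c1_deriv)
  show "x \<in> {0..1} \<Longrightarrow> c1_fun (r *\<^sub>R f) x = r *\<^sub>R c1_fun f x"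
    unfolding scaleR_c1_def by (subst c1_fun_mk_c1[OF _ b], erule a, simp)
  show "x \<in> {0..1} \<Longrightarrow> c1_deriv (r *\<^sub>R f) x = r *\<^sub>R c1_deriv f x"
    unfolding scaleR_c1_def by (rule c1_deriv_mk_c1[OF _ b], erule a)
qed

lemma c1_bdd_above:
  "bdd_above ((\<lambda>x. cmod (c1_fun f x)) ` {0..1})"
  "bdd_above ((\<lambda>x. cmod (c1_deriv f x)) ` {0..1})"
  by (intro bounded_imp_bdd_above compact_imp_bounded compact_continuous_image
      continuous_on_norm continuous_on_c1_fun continuous_on_c1_deriv compact_Icc)+

lemma c1_sup_upper:
  assumes "x \<in> {0..1}"
  shows "cmod (c1_fun f x) \<le> (SUP x\<in>{0..1}. cmod (c1_fun f x))"
    and "cmod (c1_deriv f x) \<le> (SUP x\<in>{0..1}. cmod (c1_deriv f x))"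
  using assms c1_bdd_above by (auto intro!: cSUP_upper)

lemma c1_sup_nonneg:
  "0 \<le> (SUP x\<in>{0..1}. cmod (c1_fun f x))" "0 \<le> (SUP x\<in>{0..1}. cmod (c1_deriv f x))"
  by (rule order_trans[OF norm_ge_zero c1_sup_upper(1)[of 0]], simp)
    (rule order_trans[OF norm_ge_zero c1_sup_upper(2)[of 0]], simp)

lemma c1_norm_leI:
  assumes "\<And>x. x \<in> {0..1} \<Longrightarrow> cmod (c1_fun f x) \<le> a"
    and "\<And>x. x \<in> {0..1} \<Longrightarrow> cmod (c1_deriv f x) \<le> b"
  shows "norm f \<le> a + b"
  unfolding norm_c1_def using assms by (intro add_mono cSUP_least) auto

lemma c1_fun_le_norm: "x \<in> {0..1} \<Longrightarrow> cmod (c1_fun f x) \<le> norm f"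
  using c1_sup_upper[of x f] c1_sup_nonneg[of f] by (simp add: norm_c1_def)

lemma c1_deriv_le_norm: "x \<in> {0..1} \<Longrightarrow> cmod (c1_deriv f x) \<le> norm f"
  using c1_sup_upper[of x f] c1_sup_nonneg[of f] by (simp add: norm_c1_def)

instance
proof
  fix f g :: c1 and r s :: real
  show "r *\<^sub>R (f + g) = r *\<^sub>R f + r *\<^sub>R g" "(r + s) *\<^sub>R f = r *\<^sub>R f + s *\<^sub>R f"
    "r *\<^sub>R s *\<^sub>R f = (r * s) *\<^sub>R f" "1 *\<^sub>R f = f"
    by (rule c1_eqI; simp add: c1_fun_scaleR c1_fun_add algebra_simps)+
  show "norm f = 0 \<longleftrightarrow> f = 0"
  proof
    assume "norm f = 0"
    then have "c1_fun f x = 0" if "x \<in> {0..1}" for x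
      using c1_fun_le_norm[OF that, of f] by simp
    then show "f = 0" by (intro c1_eqI) (simp add: c1_fun_zero)
  next
    assume "f = 0"
    then have "norm f \<le> 0 + 0"
      by (intro c1_norm_leI) (simp_all add: c1_fun_zero c1_deriv_zero)
    moreover have "0 \<le> norm f" using c1_sup_nonneg[of f] by (simp add: norm_c1_def)
    ultimately show "norm f = 0" by simp
  qed
  show "norm (f + g) \<le> norm f + norm g"
  proof -
    have "norm (f + g) \<le>
        ((SUP x\<in>{0..1}. cmod (c1_fun f x)) + (SUP x\<in>{0..1}. cmod (c1_fun g x))) +
        ((SUP x\<in>{0..1}. cmod (c1_deriv f x)) + (SUP x\<in>{0..1}. cmod (c1_deriv g x)))"
      by (intro c1_norm_leI)
        (auto simp: c1_fun_add c1_deriv_add intro!: norm_triangle_le add_mono c1_sup_upper)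
    then show ?thesis by (simp add: norm_c1_def)
  qed
  have le: "norm (r *\<^sub>R f) \<le> \<bar>r\<bar> * norm f" for r :: real and f :: c1
  proof -
    have "norm (r *\<^sub>R f) \<le> \<bar>r\<bar> * (SUP x\<in>{0..1}. cmod (c1_fun f x)) +
        \<bar>r\<bar> * (SUP x\<in>{0..1}. cmod (c1_deriv f x))"
      by (intro c1_norm_leI)
        (auto simp: c1_fun_scaleR c1_deriv_scaleR intro!: mult_left_mono c1_sup_upper)
    then show ?thesis by (simp add: norm_c1_def distrib_left)
  qed
  show "norm (r *\<^sub>R f) = \<bar>r\<bar> * norm f"
  proof (cases "r = 0")
    case True
    have "0 \<le> norm (r *\<^sub>R f)" using c1_sup_nonneg[of "r *\<^sub>R f"] by (simp add: norm_c1_def)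
    with True le[of r f] show ?thesis by simp
  next
    case False
    have "f = inverse r *\<^sub>R (r *\<^sub>R f)"
      by (rule c1_eqI) (simp add: c1_fun_scaleR False)
    then have "norm f \<le> \<bar>inverse r\<bar> * norm (r *\<^sub>R f)"
      using le by metis
    then have "\<bar>r\<bar> * norm f \<le> norm (r *\<^sub>R f)"
      using False by (simp add: field_simps abs_if split: if_splits)
    with le[of r f] show ?thesis by simp
  qed
qed (rule dist_c1_def sgn_c1_def uniformity_c1_def open_c1_def)+
end

instance c1 :: real_normed_algebra_1
proof
  fix f g :: c1 and r :: real
  show "r *\<^sub>R f * g = r *\<^sub>R (f * g)" "f * r *\<^sub>R g = r *\<^sub>R (f * g)"
    by (rule c1_eqI; simp add: c1_fun_scaleR c1_fun_mult)+
  show "norm (f * g) \<le> norm f * norm g"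
  proof -
    define F F' G G' where defs: "F = (SUP x\<in>{0..1}. cmod (c1_fun f x))"
      "F' = (SUP x\<in>{0..1}. cmod (c1_deriv f x))" "G = (SUP x\<in>{0..1}. cmod (c1_fun g x))"
      "G' = (SUP x\<in>{0..1}. cmod (c1_deriv g x))"
    have nn: "0 \<le> F" "0 \<le> F'" "0 \<le> G" "0 \<le> G'" unfolding defs by (rule c1_sup_nonneg)+
    have up: "cmod (c1_fun f x) \<le> F" "cmod (c1_deriv f x) \<le> F'" "cmod (c1_fun g x) \<le> G"
      "cmod (c1_deriv g x) \<le> G'" if "x \<in> {0..1}" for x
      unfolding defs using that by (auto intro!: c1_sup_upper)
    have "norm (f * g) \<le> F * G + (F * G' + F' * G)"
    proof (rule c1_norm_leI)
      fix x :: real assume x: "x \<in> {0..1}"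
      show "cmod (c1_fun (f * g) x) \<le> F * G"
        using up[OF x] nn by (auto simp: c1_fun_mult[OF x] norm_mult intro!: mult_mono)
      show "cmod (c1_deriv (f * g) x) \<le> F * G' + F' * G"
        unfolding c1_deriv_mult[OF x] using up[OF x] nn
        by (intro norm_triangle_le add_mono) (auto simp: norm_mult intro!: mult_mono)
    qed
    also have "\<dots> \<le> (F + F') * (G + G')"
      using nn by (simp add: algebra_simps)
    finally show ?thesis by (simp add: norm_c1_def defs)
  qed
  have "(SUP x\<in>{0..1}. cmod (c1_fun 1 x)) = (SUP x\<in>{0..1::real}. 1)"
    by (intro SUP_cong) (simp_all add: c1_fun_one)
  moreover have "(SUP x\<in>{0..1}. cmod (c1_deriv 1 x)) = (SUP x\<in>{0..1::real}. 0)"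
    by (intro SUP_cong) (simp_all add: c1_deriv_one)
  ultimately show "norm (1::c1) = 1"
    by (simp add: norm_c1_def)
qed

instance c1 :: banach
proof
  fix X :: "nat \<Rightarrow> c1"
  assume "Cauchy X"
  then have cau: "\<exists>M. \<forall>m\<ge>M. \<forall>n\<ge>M. norm (X m - X n) < e" if "e > 0" for e
    using that by (auto simp: Cauchy_def dist_norm)
  have ucau: "\<exists>L. uniform_limit {0..1} (\<lambda>n. h (X n)) L sequentially"
    if h: "\<And>f g x. x \<in> {0..1} \<Longrightarrow> cmod (h f x - h g x) \<le> norm (f - g)"
    for h :: "c1 \<Rightarrow> real \<Rightarrow> complex"
  proof -
    have "uniformly_Cauchy_on {0..1} (\<lambda>n. h (X n))"
      unfolding uniformly_Cauchy_on_def dist_norm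
      using cau h by (meson le_less_trans)
    then show ?thesis
      using Cauchy_uniformly_convergent unfolding uniformly_convergent_on_def by blast
  qed
  obtain F where F: "uniform_limit {0..1} (\<lambda>n. c1_fun (X n)) F sequentially"
    using ucau[of c1_fun] c1_fun_le_norm[of _ "_ - _"] by (auto simp: c1_fun_diff)
  obtain G where G: "uniform_limit {0..1} (\<lambda>n. c1_deriv (X n)) G sequentially"
    using ucau[of c1_deriv] c1_deriv_le_norm[of _ "_ - _"] by (auto simp: c1_deriv_diff)
  have contG: "continuous_on {0..1} G"
    by (rule uniform_limit_theorem[OF _ G]) (auto simp: continuous_on_c1_deriv)
  have ptF: "(\<lambda>n. c1_fun (X n) x) \<longlonglongrightarrow> F x" if "x \<in> {0..1}" for x
    using tendsto_uniform_limitI[OF F that] .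
  have "\<exists>g. \<forall>x\<in>{0..1}. (\<lambda>n. c1_fun (X n) x) \<longlonglongrightarrow> g x \<and>
      (g has_derivative (\<lambda>h. h *\<^sub>R G x)) (at x within {0..1})"
  proof (rule has_derivative_sequence[where f'="\<lambda>n x h. h *\<^sub>R c1_deriv (X n) x"])
    show "(c1_fun (X n) has_derivative (\<lambda>h. h *\<^sub>R c1_deriv (X n) x)) (at x within {0..1})"
      if "x \<in> {0..1}" for n x
      using c1_has_deriv[OF that] by (simp add: has_vector_derivative_def)
    show "\<forall>\<^sub>F n in sequentially. \<forall>x\<in>{0..1}. \<forall>h.
        cmod (h *\<^sub>R c1_deriv (X n) x - h *\<^sub>R G x) \<le> e * norm h" if "e > 0" for e
      using uniform_limitD[OF G that]
    proof eventually_elim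
      case (elim n)
      show ?case
      proof (intro ballI allI)
        fix x h :: real assume "x \<in> {0..1}"
        with elim have "\<bar>h\<bar> * cmod (c1_deriv (X n) x - G x) \<le> \<bar>h\<bar> * e"
          by (intro mult_left_mono) (auto simp: dist_norm less_imp_le)
        then show "cmod (h *\<^sub>R c1_deriv (X n) x - h *\<^sub>R G x) \<le> e * norm h"
          by (simp add: mult.commute flip: scaleR_diff_right)
      qed
    qed
    show "(\<lambda>n. c1_fun (X n) 0) \<longlonglongrightarrow> F 0" by (rule ptF) simp
  qed auto
  then obtain g where g: "\<And>x. x \<in> {0..1} \<Longrightarrow> (\<lambda>n. c1_fun (X n) x) \<longlonglongrightarrow> g x"
    "\<And>x. x \<in> {0..1} \<Longrightarrow> (g has_vector_derivative G x) (at x within {0..1})"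
    unfolding has_vector_derivative_def by blast
  have gF: "g x = F x" if "x \<in> {0..1}" for x
    using LIMSEQ_unique g(1) ptF that by blast
  have L: "c1_fun (mk_c1 g) x = F x" "c1_deriv (mk_c1 g) x = G x" if "x \<in> {0..1}" for x
  proof -
    have "c1_fun (mk_c1 g) = (\<lambda>x. if x \<in> {0..1} then g x else 0)"
      by (rule c1_fun_mk_c1[OF _ contG], erule g(2))
    then show "c1_fun (mk_c1 g) x = F x" using that gF by simp
    show "c1_deriv (mk_c1 g) x = G x"
      by (rule c1_deriv_mk_c1[OF _ contG that], erule g(2))
  qed
  have "X \<longlonglongrightarrow> mk_c1 g"
  proof (rule tendstoI)
    fix e :: real assume "e > 0"
    then have "e / 3 > 0" by simp
    from uniform_limitD[OF F this] uniform_limitD[OF G this]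
    show "\<forall>\<^sub>F n in sequentially. dist (X n) (mk_c1 g) < e"
    proof eventually_elim
      case (elim n)
      have "norm (X n - mk_c1 g) \<le> e / 3 + e / 3"
        by (rule c1_norm_leI)
          (use elim L in \<open>auto simp: c1_fun_diff c1_deriv_diff dist_norm less_imp_le\<close>)
      then show ?case using \<open>e > 0\<close> by (simp add: dist_norm)
    qed
  qed
  then show "convergent X" by (auto simp: convergent_def)
qed


section \<open>Closed ideals and the topologies \<open>\<tau>\<^sub>u\<close>, \<open>\<tau>\<^sub>n\<close>, \<open>\<tau>\<^sub>r\<close>\<close>

text \<open>
  The whole algebra is included. For \<open>C\<^sup>1[0,1]\<close> it does not matter that only real scalars
  are mentioned: multiplication by a complex scalar is multiplication by a constant function.
\<close>

definition closed_ideals :: "'a::real_normed_algebra_1 set set" where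
  "closed_ideals = {I. subspace I \<and> closed I \<and> (\<forall>a\<in>I. \<forall>x. x * a \<in> I \<and> a * x \<in> I)}"

definition quotient_norm :: "'a::real_normed_vector \<Rightarrow> 'a set \<Rightarrow> real" where
  "quotient_norm a I = (INF b\<in>I. norm (a + b))"

definition usc_map :: "'b topology \<Rightarrow> ('b \<Rightarrow> real) \<Rightarrow> bool" where
  "usc_map T f \<longleftrightarrow> (\<forall>r. openin T {x \<in> topspace T. f x < r})"

definition tau_u :: "'a::real_normed_algebra_1 set topology" where
  "tau_u = topology_generated_by {{I \<in> closed_ideals. quotient_norm a I < r} | a r. True}"

text \<open>
  Nets are functions on a set \<open>D\<close> directed by a preorder \<open>le\<close>; \<open>net_tails\<close> is the filter
  generated by the tails of \<open>D\<close>.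
\<close>

definition directed_preorder :: "'i set \<Rightarrow> ('i \<Rightarrow> 'i \<Rightarrow> bool) \<Rightarrow> bool" where
  "directed_preorder D le \<longleftrightarrow> D \<noteq> {} \<and> (\<forall>i\<in>D. le i i) \<and>
     (\<forall>i\<in>D. \<forall>j\<in>D. \<forall>k\<in>D. le i j \<longrightarrow> le j k \<longrightarrow> le i k) \<and>
     (\<forall>i\<in>D. \<forall>j\<in>D. \<exists>k\<in>D. le i k \<and> le j k)"

definition net_tails :: "'i set \<Rightarrow> ('i \<Rightarrow> 'i \<Rightarrow> bool) \<Rightarrow> 'i filter" where
  "net_tails D le = (INF i\<in>D. principal {j \<in> D. le i j})"

definition normality_property ::
  "'i set \<Rightarrow> ('i \<Rightarrow> 'i \<Rightarrow> bool) \<Rightarrow> ('i \<Rightarrow> 'a::real_normed_vector set) \<Rightarrow> 'a set \<Rightarrow> bool" where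
  "normality_property D le X I \<longleftrightarrow>
     (\<forall>a. a \<notin> I \<longrightarrow> 0 < Liminf (net_tails D le) (\<lambda>i. ereal (quotient_norm a (X i))))"

text \<open>
  A formula of HOL cannot quantify over index types. The index type chosen here is large enough:
  by \<open>tau_n_closed_net\<close> below, the condition then holds for nets over an arbitrary index type.
\<close>

definition tau_n_closed :: "'a::real_normed_algebra_1 set set \<Rightarrow> bool" where
  "tau_n_closed N \<longleftrightarrow> N \<subseteq> closed_ideals \<and>
     (\<forall>(D :: ('a set \<times> 'a set set) set) le X. \<forall>I\<in>closed_ideals.
        directed_preorder D le \<longrightarrow> X \<in> D \<rightarrow> N \<longrightarrow> normality_property D le X I \<longrightarrow> I \<in> N)"

definition tau_n :: "'a::real_normed_algebra_1 set topology" where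
  "tau_n = topology (\<lambda>U. U \<subseteq> closed_ideals \<and> tau_n_closed (closed_ideals - U))"

definition tau_r :: "'a::real_normed_algebra_1 set topology" where
  "tau_r = topology_generated_by ({U. openin tau_u U} \<union> {U. openin tau_n U})"


subsection \<open>The definitions are adequate\<close>

lemma quotient_norm_le:
  assumes "I \<in> closed_ideals"
  shows "quotient_norm a I \<le> norm a"
proof -
  have "0 \<in> I" using assms by (auto simp: closed_ideals_def subspace_0)
  then have "quotient_norm a I \<le> norm (a + 0)"
    unfolding quotient_norm_def by (intro cINF_lower) (auto intro!: bdd_belowI[of _ 0])
  then show ?thesis by simp
qed

lemma topspace_tau_u [simp]: "topspace tau_u = closed_ideals"
proof -
  have "I \<in> {J \<in> closed_ideals. quotient_norm 0 J < 1}" if "I \<in> closed_ideals" for I :: "'a set"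
    using that quotient_norm_le[OF that, of 0] by auto
  then show ?thesis unfolding tau_u_def topology_generated_by_topspace by blast
qed

lemma usc_map_tau_u: "usc_map tau_u (quotient_norm a)"
proof -
  have "openin tau_u {I \<in> closed_ideals. quotient_norm a I < r}" for r
    unfolding tau_u_def by (intro topology_generated_by_Basis) blast
  then show ?thesis by (simp add: usc_map_def)
qed

lemma tau_u_weakest:
  assumes "topspace T = closed_ideals" "\<And>a. usc_map T (quotient_norm a)" "openin tau_u U"
  shows "openin T U"
proof -
  have "generate_topology_on {{I \<in> closed_ideals. quotient_norm a I < r} | a r. True} U"
    using assms(3) unfolding tau_u_def by (rule openin_topology_generated_by)
  then show ?thesis
  proof induction
    case (Basis s)
    then show ?case using assms(1,2) by (auto simp: usc_map_def)
  qed auto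
qed

lemma eventually_net_tails:
  assumes dir: "directed_preorder D le"
  shows "eventually P (net_tails D le) \<longleftrightarrow> (\<exists>i\<in>D. \<forall>j\<in>D. le i j \<longrightarrow> P j)"
proof -
  have ne: "D \<noteq> {}"
    and tr: "\<And>i j k. i \<in> D \<Longrightarrow> j \<in> D \<Longrightarrow> k \<in> D \<Longrightarrow> le i j \<Longrightarrow> le j k \<Longrightarrow> le i k"
    and ub: "\<And>i j. i \<in> D \<Longrightarrow> j \<in> D \<Longrightarrow> \<exists>k\<in>D. le i k \<and> le j k"
    using dir unfolding directed_preorder_def by (metis+)
  have "eventually P (net_tails D le) \<longleftrightarrow>
      (\<exists>i\<in>D. eventually P (principal {j \<in> D. le i j}))"
    unfolding net_tails_def
  proof (rule eventually_INF_base[OF ne])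
    fix i j assume ij: "i \<in> D" "j \<in> D"
    with ub obtain k where k: "k \<in> D" "le i k" "le j k" by metis
    have "{l \<in> D. le k l} \<subseteq> {l \<in> D. le i l} \<inter> {l \<in> D. le j l}"
      using tr[OF ij(1) k(1) _ k(2)] tr[OF ij(2) k(1) _ k(3)] by auto
    then show "\<exists>k\<in>D. principal {l \<in> D. le k l} \<le>
        inf (principal {l \<in> D. le i l}) (principal {l \<in> D. le j l})"
      using k(1) by (intro bexI[of _ k]) simp_all
  qed
  then show ?thesis by (simp add: eventually_principal Ball_def imp_conjL)
qed

lemma Liminf_ereal_pos_iff:
  "0 < Liminf F (\<lambda>i. ereal (f i)) \<longleftrightarrow> (\<exists>e>0. eventually (\<lambda>i. e < f i) F)"
proof
  assume "0 < Liminf F (\<lambda>i. ereal (f i))"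
  then obtain y where y: "0 < ereal y" "ereal y < Liminf F (\<lambda>i. ereal (f i))"
    using ereal_dense2 by blast
  then have "eventually (\<lambda>i. ereal y < ereal (f i)) F"
    by (intro less_LiminfD)
  then show "\<exists>e>0. eventually (\<lambda>i. e < f i) F"
    using y(1) by (intro exI[of _ y]) simp
next
  assume "\<exists>e>0. eventually (\<lambda>i. e < f i) F"
  then obtain e where e: "e > 0" "eventually (\<lambda>i. e < f i) F" by blast
  then have "ereal e \<le> Liminf F (\<lambda>i. ereal (f i))"
    by (intro Liminf_bounded) (auto elim: eventually_mono)
  with e(1) show "0 < Liminf F (\<lambda>i. ereal (f i))"
    by (meson ereal_less(2) less_le_trans)
qed

lemma tau_n_closed_filter:
  fixes N :: "'a::real_normed_algebra_1 set set"
  assumes N: "tau_n_closed N" and I: "I \<in> closed_ideals"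
    and F: "F \<noteq> bot" "eventually (\<lambda>J. J \<in> N) F"
    and lim: "\<And>a. a \<notin> I \<Longrightarrow> \<exists>e>0. eventually (\<lambda>J. e < quotient_norm a J) F"
  shows "I \<in> N"
proof -
  define D where "D = {(J, S). J \<in> S \<and> S \<subseteq> N \<and> eventually (\<lambda>J. J \<in> S) F}"
  define le where "le = (\<lambda>(p :: 'a set \<times> 'a set set) (q :: 'a set \<times> 'a set set). snd q \<subseteq> snd p)"
  have ex: "\<exists>J. (J, S) \<in> D" if "S \<subseteq> N" "eventually (\<lambda>J. J \<in> S) F" for S
    using that eventually_happens'[OF F(1) that(2)] by (auto simp: D_def)
  have dir: "directed_preorder D le"
    unfolding directed_preorder_def
  proof (intro conjI ballI)
    show "D \<noteq> {}" using ex[of N] F(2) by auto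
    fix p q assume pq: "p \<in> D" "q \<in> D"
    have "\<exists>J. (J, snd p \<inter> snd q) \<in> D"
      using pq by (intro ex) (auto simp: D_def eventually_conj_iff)
    then show "\<exists>k\<in>D. le p k \<and> le q k" unfolding le_def by (metis inf_le1 inf_le2 snd_conv)
  qed (auto simp: le_def)
  have "normality_property D le fst I"
    unfolding normality_property_def Liminf_ereal_pos_iff
  proof (intro allI impI)
    fix a assume "a \<notin> I"
    from lim[OF this] obtain e where e: "e > 0" "eventually (\<lambda>J. e < quotient_norm a J) F" by blast
    define S where "S = {J \<in> N. e < quotient_norm a J}"
    have "eventually (\<lambda>J. J \<in> S) F" using e(2) F(2) by eventually_elim (simp add: S_def)
    then obtain J where "(J, S) \<in> D" using ex[of S] by (auto simp: S_def)
    moreover have "e < quotient_norm a (fst q)" if "q \<in> D" "le (J, S) q" for q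
      using that by (auto simp: D_def le_def S_def)
    ultimately show "\<exists>e>0. eventually (\<lambda>q. e < quotient_norm a (fst q)) (net_tails D le)"
      using e(1) unfolding eventually_net_tails[OF dir] by blast
  qed
  moreover have "fst \<in> D \<rightarrow> N" by (auto simp: D_def)
  ultimately show ?thesis
    using N[unfolded tau_n_closed_def, THEN conjunct2, THEN spec[of _ D], THEN spec[of _ le],
        THEN spec[of _ fst], THEN bspec[OF _ I]] dir by simp
qed

lemma tau_n_closed_net:
  fixes N :: "'a::real_normed_algebra_1 set set" and D :: "'i set"
  assumes "tau_n_closed N" "I \<in> closed_ideals" "directed_preorder D le" "X \<in> D \<rightarrow> N"
    and nor: "normality_property D le X I"
  shows "I \<in> N"
proof (rule tau_n_closed_filter[OF assms(1,2), where F = "filtermap X (net_tails D le)"])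
  have ne: "D \<noteq> {}" and refl: "\<And>i. i \<in> D \<Longrightarrow> le i i"
    using assms(3) by (auto simp: directed_preorder_def)
  have "net_tails D le \<noteq> bot"
    unfolding trivial_limit_def eventually_net_tails[OF assms(3)] using refl by blast
  then show "filtermap X (net_tails D le) \<noteq> bot" by (simp add: filtermap_bot_iff)
  show "eventually (\<lambda>J. J \<in> N) (filtermap X (net_tails D le))"
    unfolding eventually_filtermap eventually_net_tails[OF assms(3)]
    using ne Pi_mem[OF assms(4)] by (meson ex_in_conv)
  show "\<exists>e>0. eventually (\<lambda>J. e < quotient_norm a J) (filtermap X (net_tails D le))"
    if "a \<notin> I" for a
    using nor that unfolding normality_property_def Liminf_ereal_pos_iff eventually_filtermap
    by simp
qed

lemma tau_n_closed_iff_filter: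
  fixes N :: "'a::real_normed_algebra_1 set set"
  shows "tau_n_closed N \<longleftrightarrow> N \<subseteq> closed_ideals \<and>
    (\<forall>F. \<forall>I\<in>closed_ideals. F \<noteq> bot \<longrightarrow> eventually (\<lambda>J. J \<in> N) F \<longrightarrow>
      (\<forall>a. a \<notin> I \<longrightarrow> (\<exists>e>0. eventually (\<lambda>J. e < quotient_norm a J) F)) \<longrightarrow> I \<in> N)"
  (is "?L \<longleftrightarrow> ?R")
proof
  assume L: ?L
  show ?R
  proof (intro conjI allI ballI impI)
    show "N \<subseteq> closed_ideals" using L by (simp add: tau_n_closed_def)
    fix F I
    assume "I \<in> closed_ideals" "F \<noteq> bot" "eventually (\<lambda>J. J \<in> N) F"
      "\<forall>a. a \<notin> I \<longrightarrow> (\<exists>e>0. eventually (\<lambda>J. e < quotient_norm a J) F)"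
    then show "I \<in> N" by (intro tau_n_closed_filter[OF L]) auto
  qed
next
  assume R: ?R
  show ?L
    unfolding tau_n_closed_def
  proof (intro conjI allI ballI impI)
    fix D :: "('a set \<times> 'a set set) set" and le X I
    assume I: "I \<in> closed_ideals" and dir: "directed_preorder D le" and X: "X \<in> D \<rightarrow> N"
      and nor: "normality_property D le X I"
    have "D \<noteq> {}" and "\<And>i. i \<in> D \<Longrightarrow> le i i"
      using dir by (auto simp: directed_preorder_def)
    then have "net_tails D le \<noteq> bot"
      unfolding trivial_limit_def eventually_net_tails[OF dir] by blast
    then have "filtermap X (net_tails D le) \<noteq> bot" by (simp add: filtermap_bot_iff)
    moreover have "eventually (\<lambda>J. J \<in> N) (filtermap X (net_tails D le))"
      unfolding eventually_filtermap eventually_net_tails[OF dir]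
      using \<open>D \<noteq> {}\<close> Pi_mem[OF X] by (meson ex_in_conv)
    moreover have "\<forall>a. a \<notin> I \<longrightarrow>
        (\<exists>e>0. eventually (\<lambda>J. e < quotient_norm a J) (filtermap X (net_tails D le)))"
      using nor unfolding normality_property_def Liminf_ereal_pos_iff eventually_filtermap .
    ultimately show "I \<in> N" using R[THEN conjunct2, rule_format, OF I] by blast
  qed (use R in blast)
qed

lemma tau_n_closed_Un:
  assumes "tau_n_closed M" "tau_n_closed N"
  shows "tau_n_closed (M \<union> N)"
  unfolding tau_n_closed_iff_filter
proof (intro conjI allI ballI impI)
  show "M \<union> N \<subseteq> closed_ideals" using assms by (auto simp: tau_n_closed_def)
  fix F I
  assume I: "I \<in> closed_ideals" and F: "F \<noteq> bot" "eventually (\<lambda>J. J \<in> M \<union> N) F"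
    and lim: "\<forall>a. a \<notin> I \<longrightarrow> (\<exists>e>0. eventually (\<lambda>J. e < quotient_norm a J) F)"
  have *: "I \<in> P" if P: "tau_n_closed P" and ne: "inf F (principal P) \<noteq> bot" for P
  proof (rule tau_n_closed_filter[OF P I ne])
    show "eventually (\<lambda>J. J \<in> P) (inf F (principal P))"
      by (simp add: eventually_inf_principal)
    show "\<exists>e>0. eventually (\<lambda>J. e < quotient_norm a J) (inf F (principal P))" if "a \<notin> I" for a
      using lim that filter_leD[OF inf_le1] by blast
  qed
  show "I \<in> M \<union> N"
  proof (rule ccontr)
    assume "I \<notin> M \<union> N"
    then have "inf F (principal M) = bot" "inf F (principal N) = bot"
      using * assms by blast+
    then have "eventually (\<lambda>J. J \<notin> M) F" "eventually (\<lambda>J. J \<notin> N) F"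
      by (simp_all add: trivial_limit_def eventually_inf_principal)
    with F(2) have "eventually (\<lambda>_. False) F" by eventually_elim auto
    with F(1) show False by (simp add: trivial_limit_def)
  qed
qed

lemma tau_n_closed_Inter:
  assumes "\<K> \<noteq> {}" "\<And>N. N \<in> \<K> \<Longrightarrow> tau_n_closed N"
  shows "tau_n_closed (\<Inter>\<K>)"
  unfolding tau_n_closed_def
proof (intro conjI allI ballI impI InterI)
  show "\<Inter>\<K> \<subseteq> closed_ideals" using assms unfolding tau_n_closed_def by blast
  fix D :: "('a set \<times> 'a set set) set" and le X I N
  assume I: "I \<in> closed_ideals" and dir: "directed_preorder D le" and X: "X \<in> D \<rightarrow> \<Inter>\<K>"
    and nor: "normality_property D le X I" and N: "N \<in> \<K>"
  have "X \<in> D \<rightarrow> N"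
    using Pi_mem[OF X] N by (intro Pi_I) simp
  then show "I \<in> N"
    using tau_n_closed_net[OF assms(2)[OF N] I dir _ nor] by simp
qed

lemma istopology_tau_n:
  "istopology (\<lambda>U. U \<subseteq> closed_ideals \<and> tau_n_closed (closed_ideals - U))"
  unfolding istopology_def
proof (intro conjI allI impI)
  fix S T :: "'a set set"
  assume "S \<subseteq> closed_ideals \<and> tau_n_closed (closed_ideals - S)"
    and "T \<subseteq> closed_ideals \<and> tau_n_closed (closed_ideals - T)"
  then show "S \<inter> T \<subseteq> closed_ideals" "tau_n_closed (closed_ideals - S \<inter> T)"
    by (auto simp: Diff_Int tau_n_closed_Un)
next
  fix \<K> :: "'a set set set"
  assume K: "\<forall>U\<in>\<K>. U \<subseteq> closed_ideals \<and> tau_n_closed (closed_ideals - U)"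
  then show "\<Union>\<K> \<subseteq> closed_ideals" by blast
  have all: "tau_n_closed (closed_ideals :: 'a set set)"
    by (simp add: tau_n_closed_def)
  show "tau_n_closed (closed_ideals - \<Union>\<K>)"
  proof (cases "\<K> = {}")
    case False
    have "closed_ideals - \<Union>\<K> = \<Inter> ((\<lambda>U. closed_ideals - U) ` \<K>)"
      using False by auto
    moreover have "tau_n_closed (\<Inter> ((\<lambda>U. closed_ideals - U) ` \<K>))"
      using False K by (intro tau_n_closed_Inter) auto
    ultimately show ?thesis by simp
  qed (simp add: all)
qed

lemma openin_tau_n: "openin tau_n U \<longleftrightarrow> U \<subseteq> closed_ideals \<and> tau_n_closed (closed_ideals - U)"
  unfolding tau_n_def by (simp add: topology_inverse'[OF istopology_tau_n])

lemma topspace_tau_n [simp]: "topspace tau_n = closed_ideals"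
proof (rule equalityI)
  have "tau_n_closed ({} :: 'a set set)"
    unfolding tau_n_closed_def
  proof (intro conjI allI ballI impI)
    fix D :: "('a set \<times> 'a set set) set" and le and X :: "_ \<Rightarrow> 'a set" and I :: "'a set"
    assume dir: "directed_preorder D le" and X: "X \<in> D \<rightarrow> {}"
    obtain i where "i \<in> D" using dir by (auto simp: directed_preorder_def)
    from Pi_mem[OF X this] show "I \<in> {}" by simp
  qed simp
  then have "openin tau_n (closed_ideals :: 'a set set)"
    by (simp add: openin_tau_n)
  then show "(closed_ideals :: 'a set set) \<subseteq> topspace tau_n" by (rule openin_subset)
  show "topspace tau_n \<subseteq> (closed_ideals :: 'a set set)"
    using openin_topspace[of "tau_n :: 'a set topology"] unfolding openin_tau_n by (rule conjunct1)
qed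

lemma closedin_tau_n: "closedin tau_n N \<longleftrightarrow> tau_n_closed N"
proof -
  have "N \<subseteq> closed_ideals" if "tau_n_closed N"
    using that by (simp add: tau_n_closed_def)
  then show ?thesis
    unfolding closedin_def openin_tau_n topspace_tau_n
    by (cases "N \<subseteq> closed_ideals") (simp_all add: double_diff, blast)
qed

lemma topspace_tau_r [simp]: "topspace tau_r = closed_ideals"
  unfolding tau_r_def topology_generated_by_topspace
proof (rule equalityI)
  show "\<Union> ({U. openin tau_u U} \<union> {U. openin tau_n U}) \<subseteq> (closed_ideals :: 'a set set)"
    using openin_subset[of tau_u] openin_subset[of tau_n] by (intro Union_least) auto
  have "openin tau_u (closed_ideals :: 'a set set)"
    using openin_topspace[of tau_u] by simp
  then show "(closed_ideals :: 'a set set) \<subseteq> \<Union> ({U. openin tau_u U} \<union> {U. openin tau_n U})"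
    by (intro Union_upper) simp
qed


section \<open>The topology \<open>\<tau>\<close>\<close>

definition fell_topology :: "'b topology \<Rightarrow> 'b set topology" where
  "fell_topology Y = topology_generated_by
     ({{F. closedin Y F \<and> F \<inter> C = {}} | C. compactin Y C} \<union>
      {{F. closedin Y F \<and> F \<inter> U \<noteq> {}} | U. openin Y U})"

lemma topspace_fell_topology [simp]: "topspace (fell_topology Y) = {F. closedin Y F}"
  unfolding fell_topology_def topology_generated_by_topspace
proof (rule equalityI)
  show "{F. closedin Y F} \<subseteq> \<Union> ({{F. closedin Y F \<and> F \<inter> C = {}} | C. compactin Y C} \<union>
      {{F. closedin Y F \<and> F \<inter> U \<noteq> {}} | U. openin Y U})"
    by (intro Union_upper UnI1 CollectI exI[of _ "{}"]) simp
qed auto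

definition c1_slope :: "real \<times> real \<Rightarrow> c1 \<Rightarrow> complex" where
  "c1_slope = (\<lambda>(x, y) f.
     if x \<noteq> y then (c1_fun f x - c1_fun f y) / of_real (x - y) else c1_deriv f x)"

definition KK :: "(real set \<times> (real \<times> real) set) set" where
  "KK = {(C, D). closedin (top_of_set {0..1}) C \<and> closedin (top_of_set ({0..1} \<times> {0..1})) D \<and>
           D \<subseteq> C \<times> C \<and> (\<forall>x\<in>C. \<forall>y\<in>C. x \<noteq> y \<longrightarrow> (x, y) \<in> D)}"

definition KK_topology :: "(real set \<times> (real \<times> real) set) topology" where
  "KK_topology = subtopology
     (prod_topology (fell_topology (top_of_set {0..1})) (fell_topology (top_of_set ({0..1} \<times> {0..1}))))
     KK"

definition ideal_of :: "real set \<times> (real \<times> real) set \<Rightarrow> c1 set" where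
  "ideal_of = (\<lambda>(C, D). {f. (\<forall>x\<in>C. c1_fun f x = 0) \<and> (\<forall>p\<in>D. c1_slope p f = 0)})"

text \<open>
  The map \<open>ideal_of\<close> is a bijection from \<open>KK\<close> onto the closed ideals (a classical theorem, not proved
  here), and \<open>tau\<close> is the topology making it a homeomorphism; see \<open>homeomorphic_map_ideal_of\<close>.
\<close>

definition tau :: "c1 set topology" where
  "tau = pullback_topology closed_ideals (inv_into KK ideal_of) KK_topology"

lemma topspace_KK_topology [simp]: "topspace KK_topology = KK"
  unfolding KK_topology_def topspace_subtopology topspace_prod_topology topspace_fell_topology
  by (auto simp only: KK_def)

lemma homeomorphic_map_ideal_of:
  assumes "bij_betw ideal_of KK closed_ideals"
  shows "homeomorphic_map KK_topology tau ideal_of"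
proof -
  have inj: "inj_on ideal_of KK" and im: "ideal_of ` KK = closed_ideals"
    using assms by (auto simp: bij_betw_def)
  have img: "inv_into KK ideal_of -` U \<inter> closed_ideals = ideal_of ` U" if "U \<subseteq> KK" for U
  proof (intro equalityI subsetI)
    fix I assume I: "I \<in> inv_into KK ideal_of -` U \<inter> closed_ideals"
    then have "ideal_of (inv_into KK ideal_of I) = I" by (simp add: im f_inv_into_f)
    with I show "I \<in> ideal_of ` U" by (metis IntD1 imageI vimageE)
  next
    fix I assume "I \<in> ideal_of ` U"
    then show "I \<in> inv_into KK ideal_of -` U \<inter> closed_ideals"
      using that im inv_into_f_f[OF inj] by auto
  qed
  have sub: "U \<subseteq> KK" if "openin KK_topology U" for U
    using openin_subset[OF that] by simp
  have op: "openin tau V \<longleftrightarrow> (\<exists>U. openin KK_topology U \<and> V = ideal_of ` U)" for V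
  proof -
    have "openin KK_topology U \<and> V = inv_into KK ideal_of -` U \<inter> closed_ideals \<longleftrightarrow>
        openin KK_topology U \<and> V = ideal_of ` U" for U
      using img[OF sub[of U]] by (cases "openin KK_topology U") simp_all
    then show ?thesis unfolding tau_def openin_pullback_topology by simp
  qed
  have top: "topspace tau = closed_ideals"
    unfolding tau_def topspace_pullback_topology using img[of KK] im by simp
  show ?thesis
  proof (rule bijective_open_imp_homeomorphic_map)
    show "continuous_map KK_topology tau ideal_of"
      unfolding continuous_map_def topspace_KK_topology top
    proof (intro conjI allI impI)
      show "ideal_of \<in> KK \<rightarrow> closed_ideals" using im by blast
      fix V assume "openin tau V"
      then obtain U where U: "openin KK_topology U" "V = ideal_of ` U" using op by blast
      have "{p \<in> KK. ideal_of p \<in> V} = U"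
        using sub[OF U(1)] inj unfolding U(2) by (auto dest: inj_onD)
      then show "openin KK_topology {p \<in> KK. ideal_of p \<in> V}" using U(1) by simp
    qed
    show "open_map KK_topology tau ideal_of"
      unfolding open_map_def using op by blast
  qed (simp_all add: im top inj)
qed

end

theory Submission
  imports Defs
begin

text \<open>
  Closed ideals correspond to pairs \<open>(C, D)\<close>: the set of common zeros, and the set of common zeros
  of the difference quotients. By \<open>ideal_of_iff\<close>, only the diagonal part of \<open>D\<close> adds to \<open>C\<close>
  a condition, namely that the derivative vanishes at certain points. Everything rests on one
  local criterion (\<open>local_membership\<close>): an element \<open>f\<close> belongs to a closed ideal \<open>I\<close> if near every
  point where \<open>f\<close> or \<open>f'\<close> is nonzero some localization of \<open>f\<close> belongs to \<open>I\<close>. Points where both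
  vanish are harmless, since \<open>f\<close> can be cut off near them at small cost in the norm of \<open>C\<^sup>1\<close>
  (\<open>truncation_near_flat_zeros\<close>).

  The criterion gives the description of the closed ideals (\<open>bij_betw_ideal_of\<close>), hence \<open>\<tau>\<close> is
  homeomorphic to the parameter space \<open>KK\<close>. That space is compact and Hausdorff, being closed in a
  product of two Fell topologies on compact metric spaces.

  It remains to compare the topologies, one inclusion at a time. Let parameters converge to
  \<open>(C, D)\<close>. A function outside the limit ideal has a nonzero value or difference quotient
  somewhere on \<open>C\<close> or \<open>D\<close>, and this bounds its quotient norms from below (\<open>normality_at_limit\<close>).
  For a function \<open>b\<close> inside the limit ideal the quotient norms tend to zero
  (\<open>quotient_norm_vanishes_at_limit\<close>): the functions with this property form a closed ideal, so the
  local criterion applies once more, and the only points to inspect are those outside \<open>C\<close> and the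
  isolated points of \<open>C\<close> without derivative condition. Hence \<open>\<tau>\<close> is finer than \<open>\<tau>\<^sub>n\<close> and \<open>\<tau>\<^sub>u\<close>.

  Conversely, the subbasic open sets of \<open>\<tau>\<close> are open in \<open>\<tau>\<^sub>r\<close>. The sets given by missing a compact set are
  \<open>\<tau>\<^sub>u\<close>-open: finitely many elements of the ideal witness that there is no common zero, and having small
  quotient norms of these elements is an open condition. The sets given by hitting an open set
  are \<open>\<tau>\<^sub>n\<close>-open: a suitable function supported near the point that is hit lies outside the ideal,
  so its quotient norms stay away from zero along a net with the normality property. For diagonal
  points of \<open>D\<close> this needs \<open>quotient_norm_near_simple_zero\<close>.
\<close>

section \<open>Special elements of \<open>C\<^sup>1[0,1]\<close>\<close>

definition c1_const :: "complex \<Rightarrow> c1" where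
  "c1_const c = mk_c1 (\<lambda>_. c)"

definition c1_id :: c1 where
  "c1_id = mk_c1 of_real"

definition c1_cnj :: "c1 \<Rightarrow> c1" where
  "c1_cnj f = mk_c1 (\<lambda>x. cnj (c1_fun f x))"

lemma
  assumes "x \<in> {0..1}"
  shows c1_fun_const: "c1_fun (c1_const c) x = c"
    and c1_deriv_const: "c1_deriv (c1_const c) x = 0"
  using assms unfolding c1_const_def
  by (simp_all add: c1_fun_mk_c1[where f'="\<lambda>x. 0"] c1_deriv_mk_c1[where f'="\<lambda>x. 0"])

lemma
  assumes "x \<in> {0..1}"
  shows c1_fun_id: "c1_fun c1_id x = of_real x"
    and c1_deriv_id: "c1_deriv c1_id x = 1"
proof -
  have d: "((of_real :: real \<Rightarrow> complex) has_vector_derivative 1) (at t within {0..1})" for t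
    using has_vector_derivative_of_real[OF DERIV_ident[of "at t within {0..1}"]] by simp
  show "c1_fun c1_id x = of_real x" "c1_deriv c1_id x = 1"
    unfolding c1_id_def
    using assms by (simp_all add: c1_fun_mk_c1[where f'="\<lambda>x. 1"] c1_deriv_mk_c1[where f'="\<lambda>x. 1"] d)
qed

lemma c1_fun_cnj:
  assumes "x \<in> {0..1}"
  shows "c1_fun (c1_cnj f) x = cnj (c1_fun f x)"
proof -
  have d: "((\<lambda>x. cnj (c1_fun f x)) has_vector_derivative cnj (c1_deriv f t)) (at t within {0..1})"
    if "t \<in> {0..1}" for t
    by (rule bounded_linear.has_vector_derivative[OF bounded_linear_cnj c1_has_deriv[OF that]])
  have "continuous_on {0..1} (\<lambda>x. cnj (c1_deriv f x))"
    by (intro continuous_intros continuous_on_c1_deriv)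
  from c1_fun_mk_c1[OF d this] assms show ?thesis by (simp add: c1_cnj_def)
qed

lemmas c1_pointwise = c1_fun_zero c1_deriv_zero c1_fun_one c1_deriv_one c1_fun_add c1_deriv_add
  c1_fun_diff c1_deriv_diff c1_fun_uminus c1_deriv_uminus c1_fun_mult c1_deriv_mult
  c1_fun_scaleR c1_deriv_scaleR c1_fun_const c1_deriv_const c1_fun_id c1_deriv_id c1_fun_cnj

lemma c1_fun_sum: "x \<in> {0..1} \<Longrightarrow> c1_fun (sum f S) x = (\<Sum>i\<in>S. c1_fun (f i) x)"
  by (induction S rule: infinite_finite_induct) (auto simp: c1_pointwise)

lemma c1_invertible:
  assumes "\<And>x. x \<in> {0..1} \<Longrightarrow> c1_fun f x \<noteq> 0"
  obtains g where "f * g = 1"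
proof -
  define g where "g = mk_c1 (\<lambda>x. inverse (c1_fun f x))"
  have d: "((\<lambda>x. inverse (c1_fun f x)) has_vector_derivative
        - (inverse (c1_fun f x) * c1_deriv f x * inverse (c1_fun f x))) (at x within {0..1})"
    if "x \<in> {0..1}" for x
    using Deriv.has_derivative_inverse[OF assms[OF that] c1_has_deriv[OF that, unfolded has_vector_derivative_def]]
    by (simp add: has_vector_derivative_def scaleR_conv_of_real algebra_simps)
  have "continuous_on {0..1} (\<lambda>x. - (inverse (c1_fun f x) * c1_deriv f x * inverse (c1_fun f x)))"
    using assms by (intro continuous_intros continuous_on_c1_deriv continuous_on_c1_fun) auto
  from c1_fun_mk_c1[OF d this]
  have "f * g = 1"
    using assms by (intro c1_eqI) (simp add: g_def c1_pointwise)
  then show thesis by (rule that)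
qed

lemma c1_deriv_local_zero:
  assumes "x \<in> {0..1}" "e > 0" "\<And>t. t \<in> {0..1} \<Longrightarrow> \<bar>t - x\<bar> < e \<Longrightarrow> c1_fun f t = 0"
  shows "c1_deriv f x = 0"
proof (rule c1_deriv_unique[OF _ assms(1)])
  show "(c1_fun f has_vector_derivative 0) (at x within {0..1})"
    by (rule has_vector_derivative_transform_within[OF has_vector_derivative_const[of 0] assms(2,1)])
      (use assms(3) in \<open>auto simp: dist_real_def\<close>)
qed

text \<open>
  The mean value inequality, applied to \<open>f - c t\<close>. With \<open>c = 0\<close> it controls \<open>f\<close> near a point
  where \<open>f\<close> and \<open>f'\<close> vanish; with \<open>c = f'(x)\<close> it gives the continuity of difference quotients on
  the diagonal.
\<close>
lemma c1_increment:
  assumes "a \<in> {0..1}" "b \<in> {0..1}"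
    and "\<And>t. t \<in> closed_segment a b \<Longrightarrow> cmod (c1_deriv f t - c) \<le> B"
  shows "cmod (c1_fun f b - c1_fun f a - of_real (b - a) * c) \<le> \<bar>b - a\<bar> * B"
proof -
  let ?S = "closed_segment a b"
  let ?g = "f - c1_const c * c1_id"
  have sub: "?S \<subseteq> {0..1}"
    using assms(1,2) by (auto simp: closed_segment_eq_real_ivl)
  have "norm (c1_fun ?g b - c1_fun ?g a) \<le> B * norm (b - a)"
  proof (rule differentiable_bound[of ?S _ "\<lambda>t h. h *\<^sub>R c1_deriv ?g t"])
    fix t assume t: "t \<in> ?S"
    show "(c1_fun ?g has_derivative (\<lambda>h. h *\<^sub>R c1_deriv ?g t)) (at t within ?S)"
      using has_vector_derivative_within_subset[OF c1_has_deriv sub] t sub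
      unfolding has_vector_derivative_def by blast
    have "cmod (c1_deriv ?g t) \<le> B"
      using assms(3)[OF t] t sub by (simp add: c1_pointwise subset_iff)
    then show "onorm (\<lambda>h. h *\<^sub>R c1_deriv ?g t) \<le> B"
      by (simp add: onorm_scaleR_left[OF bounded_linear_ident] onorm_id)
  qed auto
  moreover have "c1_fun ?g b - c1_fun ?g a = c1_fun f b - c1_fun f a - of_real (b - a) * c"
    using assms(1,2) by (simp add: c1_pointwise algebra_simps)
  ultimately show ?thesis by (simp add: mult.commute)
qed

text \<open>
  The function \<open>t \<mapsto> infdist t E\<close> is only Lipschitz, but the mean of a continuous function over the window
  \<open>[t, t + d]\<close> is \<open>C\<^sup>1\<close>, and its derivative is a difference of two values divided by \<open>d\<close>. Averaging
  \<open>infdist t E / d - 2\<close>, truncated to \<open>[0,1]\<close>, therefore gives a cutoff that changes only at distances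
  between \<open>d\<close> and \<open>4 d\<close> from \<open>E\<close> and whose derivative is at most \<open>1 / d\<close>.
\<close>
lemma smooth_cutoff:
  assumes "E \<noteq> {}" "d > 0"
  obtains \<theta> where
    "\<And>t. t \<in> {0..1} \<Longrightarrow> infdist t E \<le> d \<Longrightarrow> c1_fun \<theta> t = 0"
    "\<And>t. t \<in> {0..1} \<Longrightarrow> 4 * d \<le> infdist t E \<Longrightarrow> c1_fun \<theta> t = 1"
    "\<And>t. t \<in> {0..1} \<Longrightarrow> cmod (1 - c1_fun \<theta> t) \<le> 1"
    "\<And>t. t \<in> {0..1} \<Longrightarrow> cmod (c1_deriv \<theta> t) \<le> 1 / d"
    "\<And>t. t \<in> {0..1} \<Longrightarrow> 4 * d \<le> infdist t E \<Longrightarrow> c1_deriv \<theta> t = 0"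
proof -
  define \<psi> where "\<psi> t = min 1 (max 0 (infdist t E / d - 2))" for t :: real
  \<comment> \<open>The base point lies left of 0, so that \<open>P\<close> has a two-sided derivative on all of \<open>[0, 1 + d]\<close>.\<close>
  define P where "P t = integral {-1..t} \<psi>" for t :: real
  define q where "q t = (P (t + d) - P t) / d" for t
  have cont: "continuous_on S \<psi>" for S
    unfolding \<psi>_def using \<open>d > 0\<close> by (intro continuous_intros) auto
  have P: "(P has_real_derivative \<psi> t) (at t)" if "-1 < t" "t < 2 + d" for t
  proof -
    have "at t within {-1..2+d} = at t"
      using that by (intro at_within_interior) auto
    then show ?thesis
      using integral_has_real_derivative[OF cont, of t "-1" "2 + d"] that by (simp add: P_def[abs_def])
  qed
  \<comment> \<open>A mean of \<open>\<psi>\<close> over the window is a value of \<open>\<psi>\<close> in the window, at a distance of less than \<open>d\<close>.\<close>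
  have q_mean: "\<exists>s. t < s \<and> s < t + d \<and> q t = \<psi> s" if "t \<in> {0..1}" for t
  proof -
    have "\<exists>s. t < s \<and> s < t + d \<and> P (t + d) - P t = (t + d - t) * \<psi> s"
      using \<open>d > 0\<close> that by (intro MVT2 P) auto
    then show ?thesis using \<open>d > 0\<close> by (auto simp: q_def)
  qed
  have dq: "(q has_real_derivative (\<psi> (t + d) - \<psi> t) / d) (at t within {0..1})" if "t \<in> {0..1}" for t
  proof -
    have "((\<lambda>t. P (t + d)) has_real_derivative \<psi> (t + d)) (at t)"
      using P[of "t + d"] that \<open>d > 0\<close> by (simp add: DERIV_shift)
    then have "(q has_real_derivative (\<psi> (t + d) - \<psi> t) / d) (at t)"
      unfolding q_def using that \<open>d > 0\<close> by (intro DERIV_cdivide DERIV_diff P) auto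
    then show ?thesis by (rule has_field_derivative_at_within)
  qed
  define \<theta> where "\<theta> = mk_c1 (\<lambda>t. of_real (q t))"
  have d\<theta>: "((\<lambda>t. complex_of_real (q t)) has_vector_derivative of_real ((\<psi> (t + d) - \<psi> t) / d))
      (at t within {0..1})" if "t \<in> {0..1}" for t
    using dq[OF that] by (intro has_vector_derivative_of_real) (simp add: has_real_derivative_iff_has_vector_derivative)
  have c\<theta>: "continuous_on {0..1} (\<lambda>t. complex_of_real ((\<psi> (t + d) - \<psi> t) / d))"
    using \<open>d > 0\<close> by (intro continuous_intros continuous_on_compose2[OF cont[of UNIV]] cont) auto
  have q_fun: "c1_fun \<theta> t = of_real (q t)" if "t \<in> {0..1}" for t
    unfolding \<theta>_def using c1_fun_mk_c1[OF d\<theta> c\<theta>] that by simp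
  have der: "c1_deriv \<theta> t = of_real ((\<psi> (t + d) - \<psi> t) / d)" if "t \<in> {0..1}" for t
    unfolding \<theta>_def using c1_deriv_mk_c1[OF d\<theta> c\<theta> that] .
  have \<psi>01: "0 \<le> \<psi> t" "\<psi> t \<le> 1" for t by (auto simp: \<psi>_def)
  show thesis
  proof (rule that)
    fix t :: real assume t: "t \<in> {0..1}"
    obtain s where s: "t < s" "s < t + d" "q t = \<psi> s" using q_mean[OF t] by blast
    have dist: "infdist s E \<le> infdist t E + d" "infdist t E \<le> infdist s E + d"
      using infdist_triangle[of s E t] infdist_triangle[of t E s] s by (auto simp: dist_real_def)
    show "c1_fun \<theta> t = 0" if "infdist t E \<le> d"
      using that dist \<open>d > 0\<close> by (simp add: q_fun[OF t] s \<psi>_def field_simps max_def)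
    show "c1_fun \<theta> t = 1" if "4 * d \<le> infdist t E"
    proof -
      have "3 \<le> infdist s E / d" using that dist \<open>d > 0\<close> by (simp add: field_simps)
      then have "\<psi> s = 1" by (simp add: \<psi>_def)
      then show ?thesis by (simp add: q_fun[OF t] s)
    qed
    have "cmod (1 - c1_fun \<theta> t) = \<bar>1 - q t\<bar>"
      unfolding q_fun[OF t] by (metis norm_of_real of_real_1 of_real_diff)
    then show "cmod (1 - c1_fun \<theta> t) \<le> 1"
      using \<psi>01[of s] s by simp
    have "\<bar>\<psi> (t + d) - \<psi> t\<bar> \<le> 1" using \<psi>01[of t] \<psi>01[of "t + d"] by auto
    then show "cmod (c1_deriv \<theta> t) \<le> 1 / d"
      unfolding der[OF t] norm_of_real using \<open>d > 0\<close> by (simp add: abs_divide divide_right_mono)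
    show "c1_deriv \<theta> t = 0" if "4 * d \<le> infdist t E"
    proof -
      have "infdist t E \<le> infdist (t + d) E + d"
        using infdist_triangle[of t E "t + d"] \<open>d > 0\<close> by (simp add: dist_real_def)
      then have "3 \<le> infdist t E / d" "3 \<le> infdist (t + d) E / d"
        using that \<open>d > 0\<close> by (simp_all add: field_simps)
      then have "\<psi> t = 1" "\<psi> (t + d) = 1" by (simp_all add: \<psi>_def)
      then show ?thesis by (simp add: der[OF t])
    qed
  qed
qed

text \<open>
  The support is strictly smaller than the ball of radius \<open>r\<close>; this leaves the room that
  \<open>locally_supported_membership\<close> uses to see that derivatives vanish outside that ball.
\<close>
lemma bump:
  fixes x r :: real
  assumes "r > 0"
  obtains k where
    "\<And>t. t \<in> {0..1} \<Longrightarrow> \<bar>t - x\<bar> \<le> r / 8 \<Longrightarrow> c1_fun k t = 1"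
    "\<And>t. t \<in> {0..1} \<Longrightarrow> r / 2 \<le> \<bar>t - x\<bar> \<Longrightarrow> c1_fun k t = 0"
proof -
  obtain \<theta> where \<theta>: "\<And>t. t \<in> {0..1} \<Longrightarrow> infdist t {x} \<le> r / 8 \<Longrightarrow> c1_fun \<theta> t = 0"
    "\<And>t. t \<in> {0..1} \<Longrightarrow> 4 * (r / 8) \<le> infdist t {x} \<Longrightarrow> c1_fun \<theta> t = 1"
  proof (rule smooth_cutoff)
    show "{x} \<noteq> {}" "r / 8 > 0" using assms by auto
  qed blast
  show thesis
    using \<theta> by (intro that[of "1 - \<theta>"]) (auto simp: c1_pointwise dist_real_def)
qed

text \<open>
  One-dimensional form of Whitney's approximation argument. Within distance \<open>4 d\<close> of a point where
  \<open>f\<close> and \<open>f'\<close> vanish, \<open>f'\<close> is at most some \<open>\<epsilon>\<close>, hence \<open>f\<close> is at most \<open>4 d \<epsilon>\<close>. This compensates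
  the size \<open>1 / d\<close> of the derivative of the cutoff in the product rule, so that the cutoff changes
  \<open>f\<close> by \<open>O(\<epsilon>)\<close> in the norm of \<open>C\<^sup>1\<close>, whatever the shape of the set of flat zeros.
\<close>
lemma truncation_near_flat_zeros:
  fixes f :: c1
  assumes "e > 0"
  defines "E \<equiv> {t \<in> {0..1}. c1_fun f t = 0 \<and> c1_deriv f t = 0}"
  obtains \<theta> d where "d > 0" "norm (\<theta> * f - f) < e"
    "\<And>s t. s \<in> E \<Longrightarrow> t \<in> {0..1} \<Longrightarrow> \<bar>t - s\<bar> \<le> d \<Longrightarrow> c1_fun \<theta> t = 0"
proof (cases "E = {}")
  case True
  show thesis by (rule that[of 1 1]) (use True assms in auto)
next
  case False
  have "uniformly_continuous_on {0..1} (c1_deriv f)"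
    by (intro compact_uniformly_continuous continuous_on_c1_deriv) auto
  then obtain d0 where d0: "d0 > 0"
    "\<And>s t. s \<in> {0..1} \<Longrightarrow> t \<in> {0..1} \<Longrightarrow> \<bar>s - t\<bar> < d0 \<Longrightarrow> cmod (c1_deriv f s - c1_deriv f t) < e / 12"
    unfolding uniformly_continuous_on_def dist_norm real_norm_def
    using \<open>e > 0\<close> by (metis divide_pos_pos zero_less_numeral abs_minus_commute)
  \<comment> \<open>The bound \<open>4 d \<le> 1\<close> makes \<open>4 d (e / 12) \<le> e / 12\<close>; the terms below then add up to \<open>6 (e / 12)\<close>.\<close>
  define d where "d = min (d0 / 5) (1 / 4)"
  have d: "0 < d" "4 * d < d0" "4 * d \<le> 1" using d0(1) by (auto simp: d_def)
  have clE: "closed E"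
  proof -
    have "closed {t \<in> {0..1}. c1_fun f t = 0}" "closed {t \<in> {0..1}. c1_deriv f t = 0}"
      by (intro continuous_closed_preimage_constant continuous_on_c1_fun continuous_on_c1_deriv closed_atLeastAtMost)+
    from closed_Int[OF this] show ?thesis
      unfolding E_def by (rule back_subst[of closed]) auto
  qed
  obtain \<theta> where \<theta>: "\<And>t. t \<in> {0..1} \<Longrightarrow> infdist t E \<le> d \<Longrightarrow> c1_fun \<theta> t = 0"
    "\<And>t. t \<in> {0..1} \<Longrightarrow> 4 * d \<le> infdist t E \<Longrightarrow> c1_fun \<theta> t = 1"
    "\<And>t. t \<in> {0..1} \<Longrightarrow> cmod (1 - c1_fun \<theta> t) \<le> 1"
    "\<And>t. t \<in> {0..1} \<Longrightarrow> cmod (c1_deriv \<theta> t) \<le> 1 / d"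
    "\<And>t. t \<in> {0..1} \<Longrightarrow> 4 * d \<le> infdist t E \<Longrightarrow> c1_deriv \<theta> t = 0"
    using smooth_cutoff[OF False d(1)] by blast
  show thesis
  proof (rule that[OF d(1)])
    fix s t assume st: "s \<in> E" "t \<in> {0..1}" "\<bar>t - s\<bar> \<le> d"
    then have "infdist t E \<le> d"
      using infdist_le[of s E t] by (simp add: dist_real_def)
    with \<theta>(1) st show "c1_fun \<theta> t = 0" by blast
  next
    have small: "cmod (c1_fun f t) \<le> 4 * d * (e / 12) \<and> cmod (c1_deriv f t) \<le> e / 12"
      if t: "t \<in> {0..1}" "infdist t E < 4 * d" for t
    proof -
      obtain s where s: "s \<in> E" "infdist t E = dist t s"
        using infdist_attains_inf[OF clE False] by metis
      have s01: "s \<in> {0..1}" "c1_fun f s = 0" "c1_deriv f s = 0" using s(1) by (auto simp: E_def)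
      have ts: "\<bar>t - s\<bar> < 4 * d" using t s(2) by (simp add: dist_real_def)
      have near: "cmod (c1_deriv f u) \<le> e / 12" if "u \<in> closed_segment s t" for u
      proof -
        have "u \<in> {0..1}" "\<bar>u - s\<bar> < d0"
          using that ts d s01(1) t(1) by (auto simp: closed_segment_eq_real_ivl split: if_splits)
        then show ?thesis using d0(2)[of u s] s01 by simp
      qed
      have "cmod (c1_fun f t) \<le> \<bar>t - s\<bar> * (e / 12)"
        using c1_increment[OF s01(1) t(1), of f 0 "e / 12"] near s01 by simp
      also have "\<dots> \<le> 4 * d * (e / 12)"
        using ts \<open>e > 0\<close> by (intro mult_right_mono) auto
      finally show ?thesis using near[of t] by simp
    qed
    have "norm (\<theta> * f - f) \<le> e / 12 + 5 * (e / 12)"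
    proof (rule c1_norm_leI)
      fix t :: real assume t: "t \<in> {0..1}"
      have eq: "c1_fun (\<theta> * f - f) t = - ((1 - c1_fun \<theta> t) * c1_fun f t)"
        "c1_deriv (\<theta> * f - f) t = c1_deriv \<theta> t * c1_fun f t - (1 - c1_fun \<theta> t) * c1_deriv f t"
        using t by (simp_all add: c1_pointwise algebra_simps)
      show "cmod (c1_fun (\<theta> * f - f) t) \<le> e / 12"
      proof (cases "infdist t E < 4 * d")
        case True
        have "cmod (1 - c1_fun \<theta> t) * cmod (c1_fun f t) \<le> 1 * (4 * d * (e / 12))"
          using small[OF t True] \<theta>(3)[OF t] by (intro mult_mono) auto
        also have "\<dots> \<le> 1 * (e / 12)" using d \<open>e > 0\<close> by (intro mult_mono) auto
        finally show ?thesis by (simp add: eq norm_mult)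
      next
        case False
        then show ?thesis using \<theta>(2)[OF t] \<open>e > 0\<close> by (simp add: eq)
      qed
      show "cmod (c1_deriv (\<theta> * f - f) t) \<le> 5 * (e / 12)"
      proof (cases "infdist t E < 4 * d")
        case True
        have "cmod (c1_deriv \<theta> t) * cmod (c1_fun f t) \<le> 1 / d * (4 * d * (e / 12))"
          using small[OF t True] \<theta>(4)[OF t] d by (intro mult_mono) auto
        moreover have "cmod (1 - c1_fun \<theta> t) * cmod (c1_deriv f t) \<le> 1 * (e / 12)"
          using small[OF t True] \<theta>(3)[OF t] by (intro mult_mono) auto
        moreover have "1 / d * (4 * d * (e / 12)) = 4 * (e / 12)" using d by simp
        ultimately show ?thesis
          unfolding eq by (intro norm_triangle_le_diff) (simp add: norm_mult)
      next
        case False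
        then show ?thesis using \<theta>(2,5)[OF t] \<open>e > 0\<close> by (simp add: eq)
      qed
    qed
    also have "\<dots> < e" using \<open>e > 0\<close> by simp
    finally show "norm (\<theta> * f - f) < e" .
  qed
qed


section \<open>Membership in a closed ideal is a local question\<close>

lemma
  assumes "I \<in> closed_ideals"
  shows closed_ideal_zero: "0 \<in> I"
    and closed_ideal_add: "f \<in> I \<Longrightarrow> g \<in> I \<Longrightarrow> f + g \<in> I"
    and closed_ideal_mult: "f \<in> I \<Longrightarrow> h * f \<in> I"
    and closed_ideal_closed: "closed I"
  using assms by (auto simp: closed_ideals_def subspace_def)

lemma closed_idealsI:
  fixes I :: "c1 set"
  assumes "0 \<in> I" "\<And>f g. f \<in> I \<Longrightarrow> g \<in> I \<Longrightarrow> f + g \<in> I" "\<And>f h. f \<in> I \<Longrightarrow> h * f \<in> I" "closed I"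
  shows "I \<in> closed_ideals"
proof -
  have "r *\<^sub>R f = c1_const (of_real r) * f" for r and f :: c1
    by (rule c1_eqI) (simp add: c1_pointwise scaleR_conv_of_real[where 'a = complex])
  then have "r *\<^sub>R f \<in> I" if "f \<in> I" for r f
    using assms(3)[OF that] by simp
  moreover have "f * h \<in> I" if "f \<in> I" for f h
    using assms(3)[OF that, of h] by (simp add: mult.commute[of f])
  ultimately show ?thesis
    using assms unfolding closed_ideals_def subspace_def by blast
qed

text \<open>
  By compactness, finitely many elements of the ideal have no common zero; then the sum of their
  squared moduli belongs to the ideal and is invertible.
\<close>
lemma ideal_without_zeros_contains_one:
  fixes J :: "c1 set"
  assumes add: "\<And>f g. f \<in> J \<Longrightarrow> g \<in> J \<Longrightarrow> f + g \<in> J"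
    and mult: "\<And>f h. f \<in> J \<Longrightarrow> h * f \<in> J"
    and nz: "\<And>x. x \<in> {0..1} \<Longrightarrow> \<exists>f\<in>J. c1_fun f x \<noteq> 0"
  shows "1 \<in> J"
proof -
  have "\<exists>T. open T \<and> T \<inter> {0..1} = {t \<in> {0..1}. c1_fun f t \<noteq> 0}" for f
  proof -
    have "openin (top_of_set {0..1}) ({0..1} \<inter> c1_fun f -` (- {0}))"
      by (intro continuous_openin_preimage_gen continuous_on_c1_fun) auto
    then obtain T where "open T" "{0..1} \<inter> c1_fun f -` (- {0}) = {0..1} \<inter> T"
      unfolding openin_open by blast
    then show ?thesis by (intro exI[of _ T]) blast
  qed
  then obtain T where T: "\<And>f. open (T f)" "\<And>f. T f \<inter> {0..1} = {t \<in> {0..1}. c1_fun f t \<noteq> 0}"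
    by metis
  have cover: "{0..1} \<subseteq> (\<Union>f\<in>J. T f)"
    using nz T(2) by fast
  obtain S where S: "S \<subseteq> J" "finite S" "{0..1} \<subseteq> (\<Union>f\<in>S. T f)"
    using compactE_image[OF compact_Icc T(1) cover] by metis
  define F where "F = (\<Sum>f\<in>S. c1_cnj f * f)"
  have zero: "0 \<in> J"
    using nz[of 0] mult[of _ 0] by auto
  have "F \<in> J"
    unfolding F_def using S(2,1) by (induction S rule: finite_induct) (auto intro: zero add mult)
  have "c1_fun F x \<noteq> 0" if x: "x \<in> {0..1}" for x
  proof -
    have "c1_fun F x = of_real (\<Sum>f\<in>S. (cmod (c1_fun f x))\<^sup>2)"
      unfolding F_def c1_fun_sum[OF x] of_real_sum
      by (intro sum.cong refl) (simp only: complex_norm_square c1_pointwise x mult.commute)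
    moreover obtain f where "f \<in> S" "c1_fun f x \<noteq> 0"
      using S(3) T(2) x by blast
    then have "(\<Sum>f\<in>S. (cmod (c1_fun f x))\<^sup>2) > 0"
      by (intro sum_pos2[OF S(2)]) auto
    ultimately show ?thesis by (metis of_real_eq_0_iff less_irrefl)
  qed
  then obtain g where "F * g = 1" using c1_invertible by metis
  then show ?thesis using mult[OF \<open>F \<in> J\<close>, of g] by (simp add: mult.commute[of g])
qed

text \<open>
  This replaces a partition of unity. After multiplication by the cutoff \<open>\<theta>\<close> of
  \<open>truncation_near_flat_zeros\<close>, the ideal of all \<open>h\<close> with \<open>h \<theta> f \<in> I\<close> has no common zero: away
  from the flat zeros of \<open>f\<close> this is the hypothesis, and near such a zero a bump function annihilates
  \<open>\<theta>\<close>. So \<open>\<theta> f \<in> I\<close>, and \<open>I\<close> is closed. The lemma serves twice: for the description of the closed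
  ideals, and for the ideal of functions whose quotient norms tend to zero.
\<close>
lemma local_membership:
  fixes I :: "c1 set"
  assumes I: "I \<in> closed_ideals"
    and loc: "\<And>x. x \<in> {0..1} \<Longrightarrow> c1_fun f x \<noteq> 0 \<or> c1_deriv f x \<noteq> 0 \<Longrightarrow> \<exists>h. c1_fun h x \<noteq> 0 \<and> h * f \<in> I"
  shows "f \<in> I"
proof -
  have "\<exists>g\<in>I. dist g f < e" if "e > 0" for e
  proof -
    obtain \<theta> d where \<theta>: "d > 0" "norm (\<theta> * f - f) < e"
      "\<And>s t. s \<in> {t \<in> {0..1}. c1_fun f t = 0 \<and> c1_deriv f t = 0} \<Longrightarrow> t \<in> {0..1} \<Longrightarrow> \<bar>t - s\<bar> \<le> d
        \<Longrightarrow> c1_fun \<theta> t = 0"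
      by (rule truncation_near_flat_zeros[OF \<open>e > 0\<close>, of f]) (rule that; assumption)
    have "1 \<in> {h. h * (\<theta> * f) \<in> I}"
    proof (rule ideal_without_zeros_contains_one)
      fix x :: real assume x: "x \<in> {0..1}"
      show "\<exists>h\<in>{h. h * (\<theta> * f) \<in> I}. c1_fun h x \<noteq> 0"
      proof (cases "c1_fun f x \<noteq> 0 \<or> c1_deriv f x \<noteq> 0")
        case True
        then obtain h where "c1_fun h x \<noteq> 0" "h * f \<in> I" using loc[OF x] by blast
        then show ?thesis
          using closed_ideal_mult[OF I, of "h * f" \<theta>] by (auto simp: algebra_simps)
      next
        case False
        obtain k where k: "\<And>t. t \<in> {0..1} \<Longrightarrow> \<bar>t - x\<bar> \<le> d / 8 \<Longrightarrow> c1_fun k t = 1"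
          "\<And>t. t \<in> {0..1} \<Longrightarrow> d / 2 \<le> \<bar>t - x\<bar> \<Longrightarrow> c1_fun k t = 0"
          by (rule bump[OF \<theta>(1), of x]) blast
        have "c1_fun k t * c1_fun \<theta> t = 0" if "t \<in> {0..1}" for t
          using k(2)[OF that] \<theta>(3)[of x t] \<theta>(1) that x False
          by (cases "d / 2 \<le> \<bar>t - x\<bar>") auto
        then have "k * (\<theta> * f) = 0"
          by (intro c1_eqI) (auto simp: c1_pointwise)
        then show ?thesis
          using k(1)[OF x] \<theta>(1) closed_ideal_zero[OF I] by (intro bexI[of _ k]) auto
      qed
    next
      fix g h assume "g \<in> {h. h * (\<theta> * f) \<in> I}"
      then show "h * g \<in> {h. h * (\<theta> * f) \<in> I}"
        using closed_ideal_mult[OF I, of "g * (\<theta> * f)" h] by (simp add: mult.assoc)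
    qed (auto simp: distrib_right intro: closed_ideal_add[OF I])
    then show ?thesis using \<theta>(2) by (intro bexI[of _ "\<theta> * f"]) (auto simp: dist_norm)
  qed
  then show ?thesis using closed_approachable[OF closed_ideal_closed[OF I]] by blast
qed


section \<open>Difference quotients\<close>

abbreviation square :: "(real \<times> real) set" where
  "square \<equiv> {0..1} \<times> {0..1}"

lemma c1_slope_diag [simp]: "c1_slope (x, x) f = c1_deriv f x"
  by (simp add: c1_slope_def)

lemma c1_slope_add:
  "p \<in> square \<Longrightarrow> c1_slope p (f + g) = c1_slope p f + c1_slope p g"
  by (auto simp: c1_slope_def c1_pointwise add_divide_distrib diff_divide_distrib)

lemma c1_slope_estimate:
  assumes "x \<in> {0..1}" "y \<in> {0..1}"
    and "\<And>t. t \<in> closed_segment y x \<Longrightarrow> cmod (c1_deriv f t - c) \<le> B"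
  shows "cmod (c1_slope (x, y) f - c) \<le> B"
proof (cases "x = y")
  case False
  have "c1_slope (x, y) f - c = (c1_fun f x - c1_fun f y - of_real (x - y) * c) / of_real (x - y)"
    using False by (simp add: c1_slope_def field_simps)
  then have "cmod (c1_slope (x, y) f - c) \<le> \<bar>x - y\<bar> * B / \<bar>x - y\<bar>"
    using divide_right_mono[OF c1_increment[OF assms(2,1,3)], of "\<bar>x - y\<bar>"]
    by (simp add: norm_divide flip: of_real_diff)
  then show ?thesis using False by simp
qed (use assms(3)[of x] in simp)

lemma c1_slope_le_norm:
  assumes "p \<in> square"
  shows "cmod (c1_slope p f) \<le> norm f"
proof -
  obtain x y where p: "p = (x, y)" "x \<in> {0..1}" "y \<in> {0..1}" using assms by auto
  have "closed_segment y x \<subseteq> {0..1}" using p by (auto simp: closed_segment_eq_real_ivl)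
  then show ?thesis
    using c1_slope_estimate[OF p(2,3), of f 0 "norm f"] c1_deriv_le_norm[of _ f] p(1)
    by (simp add: subset_iff)
qed

lemma continuous_on_c1_slope: "continuous_on square (\<lambda>p. c1_slope p f)"
  unfolding continuous_on_eq_continuous_within
proof
  fix p assume "p \<in> square"
  then obtain x y where p: "p = (x, y)" "x \<in> {0..1}" "y \<in> {0..1}" by auto
  show "continuous (at p within square) (\<lambda>p. c1_slope p f)"
  proof (cases "x = y")
    case True
    show ?thesis
      unfolding continuous_within_eps_delta
    proof (intro allI impI)
      fix e :: real assume "e > 0"
      then have "e / 2 > 0" by simp
      then obtain d where d: "d > 0"
        "\<And>t. t \<in> {0..1} \<Longrightarrow> dist t x < d \<Longrightarrow> dist (c1_deriv f t) (c1_deriv f x) < e / 2"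
        using continuous_on_c1_deriv[of f, unfolded continuous_on_iff] p(2) by blast
      have "dist (c1_slope q f) (c1_slope p f) < e" if q: "q \<in> square" "dist q p < d" for q
      proof -
        obtain s t where st: "q = (s, t)" "s \<in> {0..1}" "t \<in> {0..1}" using q(1) by auto
        have "\<bar>s - x\<bar> < d" "\<bar>t - x\<bar> < d"
          using dist_fst_le[of q p] dist_snd_le[of q p] q(2) by (auto simp: st p True dist_real_def)
        then have "\<bar>u - x\<bar> < d \<and> u \<in> {0..1}" if "u \<in> closed_segment t s" for u
          using that st by (auto simp: closed_segment_eq_real_ivl split: if_splits)
        then have "cmod (c1_deriv f u - c1_deriv f x) \<le> e / 2" if "u \<in> closed_segment t s" for u
          using d(2)[of u] that by (simp add: dist_real_def dist_norm less_imp_le)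
        then have "cmod (c1_slope (s, t) f - c1_deriv f x) \<le> e / 2"
          by (rule c1_slope_estimate[OF st(2,3)])
        then show ?thesis using \<open>e > 0\<close> by (simp add: st p True dist_norm)
      qed
      then show "\<exists>d>0. \<forall>q\<in>square. dist q p < d \<longrightarrow> dist (c1_slope q f) (c1_slope p f) < e"
        using d(1) by blast
    qed
  next
    case False
    let ?Q = "square \<inter> {q. fst q \<noteq> snd q}"
    let ?g = "\<lambda>q. (c1_fun f (fst q) - c1_fun f (snd q)) / complex_of_real (fst q - snd q)"
    have op: "open {q :: real \<times> real. fst q \<noteq> snd q}"
      by (intro open_Collect_neq continuous_intros)
    have "continuous_on ?Q ?g"
      by (intro continuous_intros continuous_on_compose2[OF continuous_on_c1_fun]) auto
    then have "continuous_on ?Q (\<lambda>p. c1_slope p f)"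
      by (rule continuous_on_eq) (auto simp: c1_slope_def split: prod.splits)
    then have "continuous (at p within ?Q) (\<lambda>p. c1_slope p f)"
      using p False by (auto simp: continuous_on_eq_continuous_within)
    moreover have "at p within ?Q = at p within square"
      using p False by (intro at_within_nhd[OF _ op]) auto
    ultimately show ?thesis by simp
  qed
qed


section \<open>The closed ideals of \<open>C\<^sup>1[0,1]\<close>\<close>

lemma KK_iff:
  "(C, D) \<in> KK \<longleftrightarrow> closed C \<and> C \<subseteq> {0..1} \<and> closed D \<and> D \<subseteq> C \<times> C \<and>
     (\<forall>x\<in>C. \<forall>y\<in>C. x \<noteq> y \<longrightarrow> (x, y) \<in> D)"
proof -
  have "closed square" by (intro closed_Times closed_atLeastAtMost)
  then show ?thesis
    unfolding KK_def by (auto simp: closedin_closed_eq)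
qed

text \<open>
  Off the diagonal the condition on the difference quotient already follows from the vanishing of
  \<open>f\<close> on \<open>C\<close>.
\<close>
lemma ideal_of_iff:
  assumes "(C, D) \<in> KK"
  shows "f \<in> ideal_of (C, D) \<longleftrightarrow> (\<forall>x\<in>C. c1_fun f x = 0) \<and> (\<forall>x. (x, x) \<in> D \<longrightarrow> c1_deriv f x = 0)"
proof -
  have "c1_slope p f = 0"
    if "p \<in> D" "\<forall>x\<in>C. c1_fun f x = 0" "\<forall>x. (x, x) \<in> D \<longrightarrow> c1_deriv f x = 0" for p
    using that assms by (cases p) (auto simp: KK_iff c1_slope_def)
  then show ?thesis unfolding ideal_of_def by (auto dest: bspec)
qed

lemma ideal_of_closed_ideal:
  assumes "q \<in> KK"
  shows "ideal_of q \<in> closed_ideals"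
proof -
  obtain C D where q: "q = (C, D)" by (cases q)
  have CD: "(C, D) \<in> KK" using assms q by simp
  have sub: "x \<in> {0..1}" if "x \<in> C \<or> (x, x) \<in> D" for x
    using that CD by (auto simp: KK_iff)
  have diag: "x \<in> C" if "(x, x) \<in> D" for x
    using that CD by (auto simp: KK_iff)
  have "closed {f. c1_fun f x = 0 \<and> (b \<longrightarrow> c1_deriv f x = 0)}" if x: "x \<in> {0..1}" for x b
  proof -
    have lip: "cmod (c1_fun f x - c1_fun g x) \<le> norm (f - g)"
      "cmod (c1_deriv f x - c1_deriv g x) \<le> norm (f - g)" for f g
      using c1_fun_le_norm[OF x, of "f - g"] c1_deriv_le_norm[OF x, of "f - g"] x
      by (simp_all add: c1_pointwise)
    have "continuous_on UNIV (\<lambda>f. c1_fun f x)" "continuous_on UNIV (\<lambda>f. c1_deriv f x)"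
      unfolding continuous_on_iff dist_norm using lip by (meson le_less_trans)+
    then have "closed {f. c1_fun f x = 0}" "closed {f. c1_deriv f x = 0}"
      by (auto intro!: closed_Collect_eq)
    then show ?thesis by (cases b) (auto intro: closed_Collect_conj)
  qed
  moreover have "ideal_of (C, D) = (\<Inter>x\<in>C. {f. c1_fun f x = 0 \<and> ((x, x) \<in> D \<longrightarrow> c1_deriv f x = 0)})"
    using CD unfolding ideal_of_iff[OF CD] set_eq_iff by (auto simp: ideal_of_iff[OF CD] KK_iff)
  ultimately have "closed (ideal_of (C, D))"
    using sub by (auto intro!: closed_INT)
  then show ?thesis
    unfolding q using sub diag by (intro closed_idealsI) (auto simp: ideal_of_iff[OF CD] c1_pointwise)
qed

text \<open>
  Membership of a function supported near \<open>x\<close> only depends on the points of \<open>C\<close> near \<open>x\<close>. It is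
  used when \<open>C\<close> has no point near \<open>x\<close> or a single one that carries no derivative condition.
\<close>
lemma locally_supported_membership:
  fixes x r :: real
  assumes CD: "(C, D) \<in> KK" and "r > 0"
    and supp: "\<And>t. t \<in> {0..1} \<Longrightarrow> r / 2 \<le> \<bar>t - x\<bar> \<Longrightarrow> c1_fun f t = 0"
    and inside: "\<And>c. c \<in> C \<Longrightarrow> \<bar>c - x\<bar> < r \<Longrightarrow> c1_fun f c = 0 \<and> (c, c) \<notin> D"
  shows "f \<in> ideal_of (C, D)"
  unfolding ideal_of_iff[OF CD]
proof (intro conjI ballI allI impI)
  have sub: "C \<subseteq> {0..1}" "D \<subseteq> C \<times> C" using CD by (auto simp: KK_iff)
  fix c assume "c \<in> C"
  then show "c1_fun f c = 0"
    using inside[of c] supp[of c] sub \<open>r > 0\<close> by (cases "\<bar>c - x\<bar> < r") auto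
next
  fix c assume c: "(c, c) \<in> D"
  then have "c \<in> C" "c \<in> {0..1}" using CD by (auto simp: KK_iff)
  then have "r \<le> \<bar>c - x\<bar>" using inside[of c] c by force
  then have "r / 2 \<le> \<bar>t - x\<bar>" if "\<bar>t - c\<bar> < r / 2" for t
    using that by linarith
  then show "c1_deriv f c = 0"
    using \<open>c \<in> {0..1}\<close> \<open>r > 0\<close> by (intro c1_deriv_local_zero[of c "r / 2"] supp) auto
qed

lemma hull_point_separation:
  assumes CD: "(C, D) \<in> KK" and "r > 0" "\<And>c. c \<in> C \<Longrightarrow> r \<le> \<bar>c - x\<bar>"
  obtains f where "f \<in> ideal_of (C, D)"
    "\<And>t. t \<in> {0..1} \<Longrightarrow> \<bar>t - x\<bar> \<le> r / 8 \<Longrightarrow> c1_fun f t = 1"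
    "\<And>t. t \<in> {0..1} \<Longrightarrow> r / 2 \<le> \<bar>t - x\<bar> \<Longrightarrow> c1_fun f t = 0"
proof -
  obtain k where k: "\<And>t. t \<in> {0..1} \<Longrightarrow> \<bar>t - x\<bar> \<le> r / 8 \<Longrightarrow> c1_fun k t = 1"
    "\<And>t. t \<in> {0..1} \<Longrightarrow> r / 2 \<le> \<bar>t - x\<bar> \<Longrightarrow> c1_fun k t = 0"
    by (rule bump[OF \<open>r > 0\<close>, of x]) blast
  have "k \<in> ideal_of (C, D)"
    using assms(3) by (intro locally_supported_membership[OF CD \<open>r > 0\<close> k(2)]) force+
  then show thesis using that k by blast
qed

lemma closed_avoids:
  fixes x :: real
  assumes "closed C" "x \<notin> C"
  obtains r where "r > 0" "\<And>c. c \<in> C \<Longrightarrow> r \<le> \<bar>c - x\<bar>"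
  using separate_point_closed[OF assms] unfolding dist_real_def by (metis abs_minus_commute)

lemma fst_ideal_of:
  assumes CD: "(C, D) \<in> KK" and x: "x \<in> {0..1}"
  shows "x \<in> C \<longleftrightarrow> (\<forall>f\<in>ideal_of (C, D). c1_fun f x = 0)"
proof
  assume R: "\<forall>f\<in>ideal_of (C, D). c1_fun f x = 0"
  show "x \<in> C"
  proof (rule ccontr)
    assume "x \<notin> C"
    then obtain r where r: "r > 0" "\<And>c. c \<in> C \<Longrightarrow> r \<le> \<bar>c - x\<bar>"
      using closed_avoids[of C x] CD by (auto simp: KK_iff)
    obtain f where "f \<in> ideal_of (C, D)" "\<And>t. t \<in> {0..1} \<Longrightarrow> \<bar>t - x\<bar> \<le> r / 8 \<Longrightarrow> c1_fun f t = 1"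
      by (rule hull_point_separation[OF CD r]) blast+
    then show False using R x r by force
  qed
qed (use CD in \<open>auto simp: ideal_of_iff\<close>)

lemma open_box:
  fixes U :: "(real \<times> real) set"
  assumes "open U" "(x, y) \<in> U"
  obtains r where "r > 0" "\<And>s t. \<bar>s - x\<bar> < r \<Longrightarrow> \<bar>t - y\<bar> < r \<Longrightarrow> (s, t) \<in> U"
proof -
  obtain A B where AB: "open A" "open B" "x \<in> A" "y \<in> B" "A \<times> B \<subseteq> U"
    using open_prod_elim[OF assms] by (metis mem_Sigma_iff)
  obtain a b where ab: "a > 0" "ball x a \<subseteq> A" "b > 0" "ball y b \<subseteq> B"
    using AB open_contains_ball by metis
  show thesis
  proof (rule that)
    show "min a b > 0" using ab by simp
    fix s t assume "\<bar>s - x\<bar> < min a b" "\<bar>t - y\<bar> < min a b"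
    then have "s \<in> ball x a" "t \<in> ball y b" by (auto simp: dist_real_def)
    then show "(s, t) \<in> U" using ab AB(5) by blast
  qed
qed

text \<open>
  Since \<open>D\<close> is closed and contains all off-diagonal points of \<open>C \<times> C\<close>, a missing diagonal point
  \<open>(x, x)\<close> prevents \<open>C\<close> from accumulating at \<open>x\<close>.
\<close>
lemma isolated_in_hull:
  assumes CD: "(C, D) \<in> KK" and x: "(x, x) \<notin> D"
  obtains r where "r > 0" "\<And>c. c \<in> C \<Longrightarrow> \<bar>c - x\<bar> < r \<Longrightarrow> c = x \<and> (c, c) \<notin> D"
    "\<And>s t. \<bar>s - x\<bar> < r \<Longrightarrow> \<bar>t - x\<bar> < r \<Longrightarrow> (s, t) \<notin> D"
proof -
  have cl: "closed C" "closed D" and off: "\<And>s t. s \<in> C \<Longrightarrow> t \<in> C \<Longrightarrow> s \<noteq> t \<Longrightarrow> (s, t) \<in> D"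
    using CD by (auto simp: KK_iff)
  obtain a where a: "a > 0" "\<And>s t. \<bar>s - x\<bar> < a \<Longrightarrow> \<bar>t - x\<bar> < a \<Longrightarrow> (s, t) \<in> - D"
    using x by (rule_tac open_box[OF open_Compl[OF cl(2)], of x x]) auto
  show thesis
  proof (cases "x \<in> C")
    case True
    show thesis
    proof (rule that[OF a(1)])
      fix c assume c: "c \<in> C" "\<bar>c - x\<bar> < a"
      then show "c = x \<and> (c, c) \<notin> D" using a(2)[of c x] a(1) off[OF c(1) True] x by auto
    qed (use a(2) in auto)
  next
    case False
    then obtain b where b: "b > 0" "\<And>c. c \<in> C \<Longrightarrow> b \<le> \<bar>c - x\<bar>"
      using closed_avoids[OF cl(1)] by metis
    show thesis
      by (rule that[of "min a b"]) (use a b in \<open>force+\<close>)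
  qed
qed

lemma bump_identity:
  fixes k :: c1
  assumes "x \<in> {0..1}" "r > 0" "\<And>t. t \<in> {0..1} \<Longrightarrow> \<bar>t - x\<bar> \<le> r \<Longrightarrow> c1_fun k t = 1"
  shows "c1_deriv ((c1_id - c1_const (of_real x)) * k) x = 1"
  using assms(3)[of x] assms(1,2) by (simp add: c1_pointwise)

text \<open>
  A point off the diagonal is missing from \<open>D\<close> only if one coordinate is outside \<open>C\<close>, and then a
  bump function at that coordinate has a nonzero difference quotient. For a missing diagonal point
  \<open>(x, x)\<close> the function \<open>(t - x) k(t)\<close>, with a narrow bump \<open>k\<close> at \<open>x\<close>, belongs to the ideal and has
  derivative 1 at \<open>x\<close>.
\<close>
lemma snd_ideal_of:
  assumes CD: "(C, D) \<in> KK" and p: "p \<in> square"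
  shows "p \<in> D \<longleftrightarrow> (\<forall>f\<in>ideal_of (C, D). c1_slope p f = 0)"
proof
  assume "p \<in> D"
  then show "\<forall>f\<in>ideal_of (C, D). c1_slope p f = 0" by (auto simp: ideal_of_def)
next
  assume R: "\<forall>f\<in>ideal_of (C, D). c1_slope p f = 0"
  obtain x y where xy: "p = (x, y)" "x \<in> {0..1}" "y \<in> {0..1}" using p by auto
  have *: "u \<in> C" if uv: "u \<in> {0..1}" "v \<in> {0..1}" "u \<noteq> v"
    and R: "\<And>f. f \<in> ideal_of (C, D) \<Longrightarrow> c1_fun f u = c1_fun f v" for u v
  proof (rule ccontr)
    assume "u \<notin> C"
    then obtain a where a: "a > 0" "\<And>c. c \<in> C \<Longrightarrow> a \<le> \<bar>c - u\<bar>"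
      using closed_avoids[of C u] CD by (auto simp: KK_iff)
    define r where "r = min a \<bar>v - u\<bar>"
    have r: "r > 0" "\<And>c. c \<in> C \<Longrightarrow> r \<le> \<bar>c - u\<bar>" using a uv(3) by (force simp: r_def)+
    obtain f where "f \<in> ideal_of (C, D)"
      "\<And>t. t \<in> {0..1} \<Longrightarrow> \<bar>t - u\<bar> \<le> r / 8 \<Longrightarrow> c1_fun f t = 1"
      "\<And>t. t \<in> {0..1} \<Longrightarrow> r / 2 \<le> \<bar>t - u\<bar> \<Longrightarrow> c1_fun f t = 0"
      by (rule hull_point_separation[OF CD r]) blast+
    moreover have "r / 2 \<le> \<bar>v - u\<bar>"
      using r(1) min.cobounded2[of a "\<bar>v - u\<bar>"] unfolding r_def[symmetric] by linarith
    ultimately show False using R[of f] uv r(1) by auto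
  qed
  show "p \<in> D"
  proof (cases "x = y")
    case False
    then have eq: "c1_fun f x = c1_fun f y" if "f \<in> ideal_of (C, D)" for f
      using R that by (auto simp: xy c1_slope_def)
    have "x \<in> C" by (rule *[OF xy(2,3) False eq])
    moreover have "y \<in> C" by (rule *[OF xy(3,2) False[symmetric] eq[symmetric]])
    ultimately show ?thesis using CD False xy(1) by (auto simp: KK_iff)
  next
    case True
    show ?thesis
    proof (rule ccontr)
      assume "p \<notin> D"
      then have "(x, x) \<notin> D" using xy True by simp
      then obtain r where r: "r > 0" "\<And>c. c \<in> C \<Longrightarrow> \<bar>c - x\<bar> < r \<Longrightarrow> c = x \<and> (c, c) \<notin> D"
        using isolated_in_hull[OF CD] by metis
      obtain k where k: "\<And>t. t \<in> {0..1} \<Longrightarrow> \<bar>t - x\<bar> \<le> r / 8 \<Longrightarrow> c1_fun k t = 1"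
        "\<And>t. t \<in> {0..1} \<Longrightarrow> r / 2 \<le> \<bar>t - x\<bar> \<Longrightarrow> c1_fun k t = 0"
        by (rule bump[OF r(1), of x]) blast
      let ?f = "(c1_id - c1_const (of_real x)) * k"
      have "?f \<in> ideal_of (C, D)"
        using r(2) k(2) xy(2) by (intro locally_supported_membership[OF CD r(1), of x]) (force simp: c1_pointwise)+
      moreover have "c1_slope p ?f = 1"
        using bump_identity[OF xy(2), of "r / 8" k] k(1) r(1) xy True by simp
      ultimately show False using R by force
    qed
  qed
qed

text \<open>
  Let \<open>C\<close> and \<open>D\<close> collect the common zeros of the values and of the difference quotients of \<open>I\<close>.
  For \<open>f \<in> ideal_of (C, D)\<close> the criterion \<open>local_membership\<close> leaves two kinds of points. Outside \<open>C\<close>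
  some element of \<open>I\<close> is nonzero. At \<open>x \<in> C\<close> with \<open>f'(x) \<noteq> 0\<close> the point \<open>x\<close> is isolated in \<open>C\<close> and
  some \<open>u \<in> I\<close> has \<open>u'(x) \<noteq> 0\<close>; a suitable multiple of \<open>u\<close> agrees with \<open>f\<close> to first order at \<open>x\<close>, and
  the localized difference \<open>w\<close> lies in \<open>I\<close> because all its remaining obstructions are outside \<open>C\<close>,
  again by \<open>local_membership\<close>.
\<close>
lemma ideal_of_surj:
  fixes I :: "c1 set"
  assumes I: "I \<in> closed_ideals"
  shows "\<exists>q\<in>KK. ideal_of q = I"
proof -
  define C where "C = {x \<in> {0..1}. \<forall>f\<in>I. c1_fun f x = 0}"
  define D where "D = {p \<in> C \<times> C. \<forall>f\<in>I. c1_slope p f = 0}"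
  have C: "C = {0..1} \<inter> (\<Inter>f\<in>I. {x \<in> {0..1}. c1_fun f x = 0})" by (auto simp: C_def)
  have clC: "closed C"
    unfolding C by (intro closed_Int closed_INT ballI closed_atLeastAtMost
        continuous_closed_preimage_constant continuous_on_c1_fun)
  have C01: "C \<subseteq> {0..1}" by (auto simp: C_def)
  have D: "D = C \<times> C \<inter> (\<Inter>f\<in>I. {p \<in> square. c1_slope p f = 0})"
    using C01 by (auto simp: D_def)
  have clD: "closed D"
    unfolding D by (intro closed_Int closed_INT ballI closed_Times clC closed_atLeastAtMost
        continuous_closed_preimage_constant continuous_on_c1_slope)
  have CD: "(C, D) \<in> KK"
    unfolding KK_iff using clC clD C01 by (auto simp: D_def C_def c1_slope_def)
  have "f \<in> I" if f: "f \<in> ideal_of (C, D)" for f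
  proof (rule local_membership[OF I])
    fix x :: real
    assume x: "x \<in> {0..1}" and nz: "c1_fun f x \<noteq> 0 \<or> c1_deriv f x \<noteq> 0"
    show "\<exists>h. c1_fun h x \<noteq> 0 \<and> h * f \<in> I"
    proof (cases "x \<in> C")
      case False
      then obtain h where "h \<in> I" "c1_fun h x \<noteq> 0" using x by (auto simp: C_def)
      then show ?thesis using closed_ideal_mult[OF I, of h f] by (auto simp: mult.commute)
    next
      case True
      have fx: "c1_fun f x = 0" and "(x, x) \<notin> D"
        using True f nz by (auto simp: ideal_of_iff[OF CD])
      then obtain u where u: "u \<in> I" "c1_deriv u x \<noteq> 0"
        using True by (auto simp: D_def)
      have ux: "c1_fun u x = 0" using u(1) True by (auto simp: C_def)
      obtain r where r: "r > 0" "\<And>c. c \<in> C \<Longrightarrow> \<bar>c - x\<bar> < r \<Longrightarrow> c = x \<and> (c, c) \<notin> D"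
        using isolated_in_hull[OF CD \<open>(x, x) \<notin> D\<close>] by metis
      obtain k where k: "\<And>t. t \<in> {0..1} \<Longrightarrow> \<bar>t - x\<bar> \<le> r / 8 \<Longrightarrow> c1_fun k t = 1"
        "\<And>t. t \<in> {0..1} \<Longrightarrow> r / 2 \<le> \<bar>t - x\<bar> \<Longrightarrow> c1_fun k t = 0"
        by (rule bump[OF r(1), of x]) blast
      \<comment> \<open>The factor \<open>c\<close> is chosen such that \<open>f - c u\<close> has derivative 0 at \<open>x\<close>.\<close>
      define c where "c = c1_const (c1_deriv f x / c1_deriv u x)"
      define w where "w = k * (f - c * u)"
      have "w \<in> I"
      proof (rule local_membership[OF I])
        fix y :: real
        assume y: "y \<in> {0..1}" and nzy: "c1_fun w y \<noteq> 0 \<or> c1_deriv w y \<noteq> 0"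
        have "y \<notin> C"
        proof
          assume yC: "y \<in> C"
          show False
          proof (cases "\<bar>y - x\<bar> < r")
            case True
            then have "y = x" using r(2)[OF yC] by simp
            then show False
              using nzy x fx ux u(2) by (simp add: w_def c_def c1_pointwise)
          next
            case False
            have w0: "c1_fun w t = 0" if "t \<in> {0..1}" "\<bar>t - y\<bar> < r / 2" for t
            proof -
              have "r / 2 \<le> \<bar>t - x\<bar>" using that False by linarith
              then show ?thesis using k(2)[OF that(1)] that(1) by (simp add: w_def c1_pointwise)
            qed
            then have "c1_deriv w y = 0"
              using r(1) by (intro c1_deriv_local_zero[OF y, of "r / 2"]) auto
            then show False using nzy w0[OF y] r(1) by simp
          qed
        qed
        then obtain h where "h \<in> I" "c1_fun h y \<noteq> 0" using y by (auto simp: C_def)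
        then show "\<exists>h. c1_fun h y \<noteq> 0 \<and> h * w \<in> I"
          using closed_ideal_mult[OF I, of h w] by (auto simp: mult.commute)
      qed
      moreover have "k * f = w + k * c * u" by (simp add: w_def algebra_simps)
      ultimately have "k * f \<in> I"
        using closed_ideal_add[OF I] closed_ideal_mult[OF I u(1)] by simp
      then show ?thesis using k(1)[OF x] r(1) by (intro exI[of _ k]) auto
    qed
  qed
  moreover have "f \<in> ideal_of (C, D)" if "f \<in> I" for f
    using that by (auto simp: ideal_of_def C_def D_def)
  ultimately show ?thesis using CD by blast
qed

theorem bij_betw_ideal_of: "bij_betw ideal_of KK closed_ideals"
  unfolding bij_betw_def
proof
  show "inj_on ideal_of KK"
  proof (rule inj_onI)
    fix q q' assume q: "q \<in> KK" "q' \<in> KK" "ideal_of q = ideal_of q'"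
    obtain C D C' D' where eq: "q = (C, D)" "q' = (C', D')" by (cases q, cases q')
    have CD: "(C, D) \<in> KK" "(C', D') \<in> KK" using q eq by simp_all
    then have sub: "C \<subseteq> {0..1}" "C' \<subseteq> {0..1}" "D \<subseteq> square" "D' \<subseteq> square"
      by (auto simp: KK_iff)
    have "x \<in> C \<longleftrightarrow> x \<in> C'" if "x \<in> {0..1}" for x
      using fst_ideal_of[OF CD(1) that] fst_ideal_of[OF CD(2) that] q(3) eq by simp
    moreover have "p \<in> D \<longleftrightarrow> p \<in> D'" if "p \<in> square" for p
      using snd_ideal_of[OF CD(1) that] snd_ideal_of[OF CD(2) that] q(3) eq by simp
    ultimately show "q = q'" using sub unfolding eq by blast
  qed
  show "ideal_of ` KK = closed_ideals"
    using ideal_of_closed_ideal ideal_of_surj by blast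
qed


section \<open>The Fell topology\<close>

lemma openin_generated_minimal:
  assumes "openin (topology_generated_by \<S>) U" "\<And>S. S \<in> \<S> \<Longrightarrow> openin T S"
  shows "openin T U"
proof -
  have "generate_topology_on \<S> U" using assms(1) by (rule openin_topology_generated_by)
  then show ?thesis by induction (auto intro: assms(2))
qed

lemma Alexander_subbase_generated:
  assumes "\<And>\<C>. \<C> \<subseteq> \<S> \<Longrightarrow> \<Union>\<C> = \<Union>\<S> \<Longrightarrow> \<exists>\<C>'. finite \<C>' \<and> \<C>' \<subseteq> \<C> \<and> \<Union>\<C>' = \<Union>\<S>"
  shows "compact_space (topology_generated_by \<S>)"
proof (rule Alexander_subbase)
  let ?T = "topology (arbitrary union_of (finite intersection_of (\<lambda>x. x \<in> \<S>) relative_to \<Union>\<S>))"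
  show "?T = topology_generated_by \<S>"
    unfolding topology_eq
  proof (intro allI iffI)
    fix U assume "openin ?T U"
    then show "openin (topology_generated_by \<S>) U"
      by (rule minimal_topology_subbase[rotated 2])
        (auto intro: topology_generated_by_Basis)
  next
    fix U assume "openin (topology_generated_by \<S>) U"
    then show "openin ?T U"
      by (rule openin_generated_minimal)
        (auto simp: openin_subbase intro!: arbitrary_union_of_inc finite_intersection_of_inc relative_to_subset_inc)
  qed
qed (use assms in simp)

lemma openin_fell_miss:
  "compactin Y Q \<Longrightarrow> openin (fell_topology Y) {F. closedin Y F \<and> F \<inter> Q = {}}"
  unfolding fell_topology_def by (intro topology_generated_by_Basis) blast

lemma openin_fell_hit:
  "openin Y U \<Longrightarrow> openin (fell_topology Y) {F. closedin Y F \<and> F \<inter> U \<noteq> {}}"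
  unfolding fell_topology_def by (intro topology_generated_by_Basis) blast

text \<open>
  Take a cover by subbasic sets and let \<open>F\<close> be the complement of the union of all open sets \<open>U\<close> whose hit
  sets occur in it. As \<open>F\<close> is not hit by any of these \<open>U\<close>, it lies in a miss set of the cover, of a
  compact set \<open>Q\<close>. Then \<open>Q\<close> is covered by finitely many of these \<open>U\<close>, and a closed set that meets none of them
  misses \<open>Q\<close>.
\<close>
lemma compact_space_fell: "compact_space (fell_topology Y)"
proof -
  let ?miss = "\<lambda>Q. {F. closedin Y F \<and> F \<inter> Q = {}}"
  let ?hit = "\<lambda>U. {F. closedin Y F \<and> F \<inter> U \<noteq> {}}"
  let ?S = "{?miss Q | Q. compactin Y Q} \<union> {?hit U | U. openin Y U}"
  have top: "\<Union>?S = {F. closedin Y F}"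
    using topspace_fell_topology[of Y] unfolding fell_topology_def topology_generated_by_topspace .
  show ?thesis
    unfolding fell_topology_def
  proof (rule Alexander_subbase_generated)
    fix \<C> assume \<C>: "\<C> \<subseteq> ?S" "\<Union>\<C> = \<Union>?S"
    define \<U> where "\<U> = {U. openin Y U \<and> ?hit U \<in> \<C>}"
    define F where "F = topspace Y - \<Union>\<U>"
    have "openin Y (\<Union>\<U>)" by (auto simp: \<U>_def)
    then have "closedin Y F" by (simp add: F_def closedin_def openin_subset double_diff)
    then have "F \<in> \<Union>\<C>" unfolding \<C>(2) top by simp
    then obtain A where A: "A \<in> \<C>" "F \<in> A" by blast
    have "A \<in> ?S" using A(1) \<C>(1) by (rule subsetD[rotated])
    moreover have "A \<noteq> ?hit U" if "openin Y U" for U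
    proof
      assume "A = ?hit U"
      then have "U \<in> \<U>" "F \<inter> U \<noteq> {}" using A that by (auto simp: \<U>_def)
      then show False by (auto simp: F_def)
    qed
    ultimately obtain Q where Q: "compactin Y Q" "A = ?miss Q" by blast
    have "Q \<subseteq> \<Union>\<U>"
      using A(2) Q compactin_subset_topspace[OF Q(1)] by (auto simp: F_def)
    then obtain \<V> where \<V>: "finite \<V>" "\<V> \<subseteq> \<U>" "Q \<subseteq> \<Union>\<V>"
      using compactinD[OF Q(1), of \<U>] by (auto simp: \<U>_def)
    let ?C' = "insert A (?hit ` \<V>)"
    have sub: "?C' \<subseteq> \<C>" using A(1) \<V>(2) by (auto simp: \<U>_def)
    have "G \<in> \<Union>?C'" if "closedin Y G" for G
    proof (cases "G \<inter> Q = {}")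
      case True
      then show ?thesis using that Q(2) by simp
    next
      case False
      then obtain U where "U \<in> \<V>" "G \<inter> U \<noteq> {}" using \<V>(3) by blast
      then show ?thesis using that by blast
    qed
    then have "{F. closedin Y F} \<subseteq> \<Union>?C'" by blast
    moreover have "\<Union>?C' \<subseteq> \<Union>?S" using sub \<C>(2) by blast
    ultimately have "\<Union>?C' = \<Union>?S" unfolding top by (intro equalityI)
    then show "\<exists>\<C>'. finite \<C>' \<and> \<C>' \<subseteq> \<C> \<and> \<Union>\<C>' = \<Union>?S"
      using sub \<V>(1) by (intro exI[of _ ?C']) simp
  qed
qed

text \<open>
  If \<open>x \<in> F - G\<close>, regularity gives disjoint open sets \<open>U\<close> around \<open>x\<close> and \<open>V\<close> around \<open>G\<close>. Hitting \<open>U\<close>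
  and missing the compact complement of \<open>V\<close> are incompatible conditions.
\<close>
lemma Hausdorff_space_fell:
  assumes "compact_space Y" "Hausdorff_space Y"
  shows "Hausdorff_space (fell_topology Y)"
proof -
  have sep: "\<exists>\<U> \<V>. openin (fell_topology Y) \<U> \<and> openin (fell_topology Y) \<V> \<and> F \<in> \<U> \<and> G \<in> \<V> \<and> disjnt \<U> \<V>"
    if FG: "closedin Y F" "closedin Y G" "x \<in> F" "x \<notin> G" for F G x
  proof -
    have "x \<in> topspace Y - G" using FG closedin_subset by blast
    then obtain U V where UV: "openin Y U" "openin Y V" "x \<in> U" "G \<subseteq> V" "disjnt U V"
      using compact_Hausdorff_imp_regular_space[OF assms] FG(2) unfolding regular_space_def by metis
    have "compactin Y (topspace Y - V)"
      using UV(2) assms(1) by (intro closedin_compact_space) auto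
    then have "openin (fell_topology Y) {H. closedin Y H \<and> H \<inter> (topspace Y - V) = {}}"
      by (rule openin_fell_miss)
    moreover have "openin (fell_topology Y) {H. closedin Y H \<and> H \<inter> U \<noteq> {}}"
      using UV(1) by (rule openin_fell_hit)
    moreover have "disjnt {H. closedin Y H \<and> H \<inter> U \<noteq> {}} {H. closedin Y H \<and> H \<inter> (topspace Y - V) = {}}"
      using UV(5) openin_subset[OF UV(1)] unfolding disjnt_iff by blast
    ultimately show ?thesis using FG UV by blast
  qed
  show ?thesis
    unfolding Hausdorff_space_def topspace_fell_topology
  proof (intro allI impI)
    fix F G assume FG: "F \<in> {F. closedin Y F} \<and> G \<in> {F. closedin Y F} \<and> F \<noteq> G"
    then consider x where "x \<in> F" "x \<notin> G" | x where "x \<in> G" "x \<notin> F" by blast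
    then show "\<exists>\<U> \<V>. openin (fell_topology Y) \<U> \<and> openin (fell_topology Y) \<V> \<and> F \<in> \<U> \<and> G \<in> \<V> \<and> disjnt \<U> \<V>"
    proof cases
      case 1
      then show ?thesis using sep FG by blast
    next
      case 2
      then obtain \<U> \<V> where "openin (fell_topology Y) \<U>" "openin (fell_topology Y) \<V>" "G \<in> \<U>" "F \<in> \<V>" "disjnt \<U> \<V>"
        using sep[of G F] FG by blast
      then show ?thesis by (intro exI[of _ \<V>] exI[of _ \<U>]) (simp add: disjnt_sym)
    qed
  qed
qed


section \<open>The parameter space of the closed ideals\<close>

abbreviation hyper_product :: "(real set \<times> (real \<times> real) set) topology" where
  "hyper_product \<equiv> prod_topology (fell_topology (top_of_set {0..1})) (fell_topology (top_of_set square))"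

lemma compact_square: "compact square"
  by (intro compact_Times compact_Icc)

lemma openin_fell_top_of_set:
  fixes S :: "'b::metric_space set"
  assumes "compact S"
  shows "closed Q \<Longrightarrow> openin (fell_topology (top_of_set S)) {F. closedin (top_of_set S) F \<and> F \<inter> Q = {}}"
    and "open U \<Longrightarrow> openin (fell_topology (top_of_set S)) {F. closedin (top_of_set S) F \<and> F \<inter> U \<noteq> {}}"
proof -
  have sub: "F \<subseteq> S" if "closedin (top_of_set S) F" for F
    using closedin_subset[OF that] by simp
  show "openin (fell_topology (top_of_set S)) {F. closedin (top_of_set S) F \<and> F \<inter> Q = {}}" if "closed Q"
  proof -
    have "compactin (top_of_set S) (S \<inter> Q)"
      using assms that by (simp add: compactin_subtopology compact_Int_closed)
    moreover have "{F. closedin (top_of_set S) F \<and> F \<inter> (S \<inter> Q) = {}} = {F. closedin (top_of_set S) F \<and> F \<inter> Q = {}}"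
      using sub by blast
    ultimately show ?thesis using openin_fell_miss[of "top_of_set S" "S \<inter> Q"] by simp
  qed
  show "openin (fell_topology (top_of_set S)) {F. closedin (top_of_set S) F \<and> F \<inter> U \<noteq> {}}" if "open U"
  proof -
    have "openin (top_of_set S) (S \<inter> U)"
      using that by (simp add: openin_open_Int)
    moreover have "{F. closedin (top_of_set S) F \<and> F \<inter> (S \<inter> U) \<noteq> {}} = {F. closedin (top_of_set S) F \<and> F \<inter> U \<noteq> {}}"
      using sub by blast
    ultimately show ?thesis using openin_fell_hit[of "top_of_set S" "S \<inter> U"] by simp
  qed
qed

lemma openin_hyper_product:
  shows "closed Q \<Longrightarrow> openin hyper_product {q \<in> topspace hyper_product. fst q \<inter> Q = {}}"
    and "open U \<Longrightarrow> openin hyper_product {q \<in> topspace hyper_product. fst q \<inter> U \<noteq> {}}"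
    and "closed R \<Longrightarrow> openin hyper_product {q \<in> topspace hyper_product. snd q \<inter> R = {}}"
    and "open W \<Longrightarrow> openin hyper_product {q \<in> topspace hyper_product. snd q \<inter> W \<noteq> {}}"
proof -
  have 1: "openin hyper_product {q \<in> topspace hyper_product. P (fst q)}"
    if "openin (fell_topology (top_of_set {0..1})) {F. closedin (top_of_set {0..1}) F \<and> P F}" for P
    using openin_continuous_map_preimage[OF continuous_map_fst that]
    by (rule back_subst[of "openin hyper_product"]) auto
  have 2: "openin hyper_product {q \<in> topspace hyper_product. P (snd q)}"
    if "openin (fell_topology (top_of_set square)) {F. closedin (top_of_set square) F \<and> P F}" for P
    using openin_continuous_map_preimage[OF continuous_map_snd that]
    by (rule back_subst[of "openin hyper_product"]) auto
  show "closed Q \<Longrightarrow> openin hyper_product {q \<in> topspace hyper_product. fst q \<inter> Q = {}}"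
    and "open U \<Longrightarrow> openin hyper_product {q \<in> topspace hyper_product. fst q \<inter> U \<noteq> {}}"
    and "closed R \<Longrightarrow> openin hyper_product {q \<in> topspace hyper_product. snd q \<inter> R = {}}"
    and "open W \<Longrightarrow> openin hyper_product {q \<in> topspace hyper_product. snd q \<inter> W \<noteq> {}}"
    by (intro 1 2 openin_fell_top_of_set compact_square compact_Icc; assumption)+
qed

lemma KK_subset: "KK \<subseteq> topspace hyper_product"
  by (auto simp only: KK_def topspace_prod_topology topspace_fell_topology)

lemma openin_KK_topology:
  shows "closed Q \<Longrightarrow> openin KK_topology {q \<in> KK. fst q \<inter> Q = {}}"
    and "open U \<Longrightarrow> openin KK_topology {q \<in> KK. fst q \<inter> U \<noteq> {}}"
    and "closed R \<Longrightarrow> openin KK_topology {q \<in> KK. snd q \<inter> R = {}}"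
    and "open W \<Longrightarrow> openin KK_topology {q \<in> KK. snd q \<inter> W \<noteq> {}}"
proof -
  have *: "openin KK_topology {q \<in> KK. P q}" if "openin hyper_product {q \<in> topspace hyper_product. P q}" for P
  proof -
    have "{q \<in> KK. P q} = {q \<in> topspace hyper_product. P q} \<inter> KK"
      using KK_subset by (auto simp del: topspace_prod_topology)
    then show ?thesis
      unfolding KK_topology_def openin_subtopology using that by blast
  qed
  show "closed Q \<Longrightarrow> openin KK_topology {q \<in> KK. fst q \<inter> Q = {}}"
    and "open U \<Longrightarrow> openin KK_topology {q \<in> KK. fst q \<inter> U \<noteq> {}}"
    and "closed R \<Longrightarrow> openin KK_topology {q \<in> KK. snd q \<inter> R = {}}"
    and "open W \<Longrightarrow> openin KK_topology {q \<in> KK. snd q \<inter> W \<noteq> {}}"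
    by (intro * openin_hyper_product; assumption)+
qed

text \<open>
  Both ways of violating the conditions on \<open>(C, D)\<close> persist under small perturbations: a point of
  \<open>D\<close> with a coordinate outside \<open>C\<close>, or two different points of \<open>C\<close> whose pair is missing from \<open>D\<close>.
\<close>
lemma closedin_KK: "closedin hyper_product KK"
proof -
  let ?P = "topspace hyper_product"
  have "\<exists>T. openin hyper_product T \<and> (C, D) \<in> T \<and> T \<subseteq> ?P - KK" if q: "(C, D) \<in> ?P - KK" for C D
  proof -
    have "closedin (top_of_set {0..1}) C" "closedin (top_of_set square) D" using q by auto
    moreover have "closed square" using compact_square by (rule compact_imp_closed)
    ultimately have CD: "closed C" "closed D" "C \<subseteq> {0..1}" "D \<subseteq> square"
      by (auto simp: closedin_closed_eq)
    then consider x y where "(x, y) \<in> D" "x \<notin> C" | x y where "(x, y) \<in> D" "y \<notin> C"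
      | x y where "x \<in> C" "y \<in> C" "x \<noteq> y" "(x, y) \<notin> D"
      using q by (auto simp: KK_iff)
    then show ?thesis
    proof cases
      case 1
      then obtain r where r: "r > 0" "\<And>c. c \<in> C \<Longrightarrow> r \<le> \<bar>c - x\<bar>"
        using closed_avoids[OF CD(1)] by metis
      \<comment> \<open>The closed ball of radius \<open>r / 2\<close> misses \<open>C\<close>, while \<open>D\<close> hits the strip over the open one.\<close>
      let ?T = "{q \<in> ?P. fst q \<inter> cball x (r / 2) = {}} \<inter> {q \<in> ?P. snd q \<inter> (ball x (r / 2) \<times> UNIV) \<noteq> {}}"
      have "openin hyper_product ?T"
        by (intro openin_Int openin_hyper_product closed_cball open_Times open_ball open_UNIV)
      moreover have "(C, D) \<in> ?T"
      proof -
        have "c \<notin> cball x (r / 2)" if "c \<in> C" for c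
          using r(2)[OF that] r(1) by (simp add: dist_real_def abs_minus_commute)
        then have "C \<inter> cball x (r / 2) = {}" by blast
        moreover have "(x, y) \<in> D \<inter> (ball x (r / 2) \<times> UNIV)" using 1 r(1) by simp
        ultimately show ?thesis using q by (auto simp del: topspace_prod_topology)
      qed
      moreover have "?T \<inter> KK = {}"
        by (auto simp: KK_iff simp del: topspace_prod_topology) force
      ultimately show ?thesis by blast
    next
      case 2
      then obtain r where r: "r > 0" "\<And>c. c \<in> C \<Longrightarrow> r \<le> \<bar>c - y\<bar>"
        using closed_avoids[OF CD(1)] by metis
      let ?T = "{q \<in> ?P. fst q \<inter> cball y (r / 2) = {}} \<inter> {q \<in> ?P. snd q \<inter> (UNIV \<times> ball y (r / 2)) \<noteq> {}}"
      have "openin hyper_product ?T"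
        by (intro openin_Int openin_hyper_product closed_cball open_Times open_ball open_UNIV)
      moreover have "(C, D) \<in> ?T"
      proof -
        have "c \<notin> cball y (r / 2)" if "c \<in> C" for c
          using r(2)[OF that] r(1) by (simp add: dist_real_def abs_minus_commute)
        then have "C \<inter> cball y (r / 2) = {}" by blast
        moreover have "(x, y) \<in> D \<inter> (UNIV \<times> ball y (r / 2))" using 2 r(1) by simp
        ultimately show ?thesis using q by (auto simp del: topspace_prod_topology)
      qed
      moreover have "?T \<inter> KK = {}"
        by (auto simp: KK_iff simp del: topspace_prod_topology) force
      ultimately show ?thesis by blast
    next
      case 3
      obtain a where a: "a > 0" "\<And>s t. \<bar>s - x\<bar> < a \<Longrightarrow> \<bar>t - y\<bar> < a \<Longrightarrow> (s, t) \<in> - D"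
        using 3(4) by (rule_tac open_box[OF open_Compl[OF CD(2)], of x y]) auto
      \<comment> \<open>The second bound makes the two balls disjoint, so that points chosen in them are different.\<close>
      define r where "r = min (a / 2) (\<bar>x - y\<bar> / 2)"
      have "r \<le> \<bar>x - y\<bar> / 2" unfolding r_def by (rule min.cobounded2)
      then have r: "r > 0" "r < a" "2 * r \<le> \<bar>x - y\<bar>" using a(1) 3(3) by (auto simp: r_def)
      let ?T = "{q \<in> ?P. fst q \<inter> ball x r \<noteq> {}} \<inter> {q \<in> ?P. fst q \<inter> ball y r \<noteq> {}}
        \<inter> {q \<in> ?P. snd q \<inter> (cball x r \<times> cball y r) = {}}"
      have "openin hyper_product ?T"
        by (intro openin_Int openin_hyper_product closed_Times closed_cball open_ball)
      moreover have "(C, D) \<in> ?T"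
      proof -
        have "D \<inter> (cball x r \<times> cball y r) = {}" using a(2) r(2) by (force simp: dist_real_def)
        moreover have "x \<in> C \<inter> ball x r" "y \<in> C \<inter> ball y r" using 3 r(1) by auto
        ultimately show ?thesis using q by (auto simp del: topspace_prod_topology)
      qed
      moreover have "q' \<notin> KK" if "q' \<in> ?T" for q'
      proof -
        obtain C' D' where q': "q' = (C', D')" by (cases q')
        have "C' \<inter> ball x r \<noteq> {}" "C' \<inter> ball y r \<noteq> {}"
          using that unfolding q' by simp_all
        then obtain s t where st: "s \<in> C'" "s \<in> ball x r" "t \<in> C'" "t \<in> ball y r"
          by blast
        then have "s \<noteq> t" using r(3) by (auto simp: dist_real_def)
        moreover have "(s, t) \<notin> D'" using that q' st by (auto simp: less_imp_le simp del: topspace_prod_topology)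
        ultimately show ?thesis using st by (auto simp: q' KK_iff)
      qed
      ultimately show ?thesis by (intro exI[of _ ?T]) blast
    qed
  qed
  then have "openin hyper_product (?P - KK)"
    by (subst openin_subopen) (metis surj_pair)
  then show ?thesis using KK_subset by (simp only: closedin_def)
qed

lemma compact_space_KK: "compact_space KK_topology"
proof -
  have "compact_space hyper_product"
    by (simp add: compact_space_prod_topology compact_space_fell)
  then have "compactin hyper_product KK"
    using closedin_KK by (rule closedin_compact_space)
  then show ?thesis unfolding KK_topology_def by (rule compact_space_subtopology)
qed

lemma Hausdorff_space_KK: "Hausdorff_space KK_topology"
proof -
  have "Hausdorff_space (fell_topology (top_of_set {0..1::real}))"
    "Hausdorff_space (fell_topology (top_of_set square))"
    by (intro Hausdorff_space_fell Hausdorff_space_subtopology Hausdorff_space_euclidean;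
        simp add: compact_space_subtopology compact_square)+
  then show ?thesis
    unfolding KK_topology_def by (intro Hausdorff_space_subtopology) (simp add: Hausdorff_space_prod_topology)
qed


section \<open>Quotient norms\<close>

lemma quotient_norm_upper:
  assumes "g \<in> I"
  shows "quotient_norm a I \<le> norm (a + g)"
  unfolding quotient_norm_def using assms by (intro cINF_lower) (auto intro!: bdd_belowI[of _ 0])

lemma quotient_norm_greatest:
  fixes I :: "c1 set"
  assumes "I \<in> closed_ideals" "\<And>g. g \<in> I \<Longrightarrow> m \<le> norm (a + g)"
  shows "m \<le> quotient_norm a I"
  unfolding quotient_norm_def using assms closed_ideal_zero by (intro cINF_greatest) auto

lemma quotient_norm_approx:
  fixes I :: "c1 set"
  assumes "I \<in> closed_ideals" "quotient_norm a I < r"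
  obtains g where "g \<in> I" "norm (a + g) < r"
proof -
  have "\<not> (\<forall>g\<in>I. r \<le> norm (a + g))"
    using quotient_norm_greatest[OF assms(1), of r a] assms(2) by force
  then show thesis using that by force
qed

lemma closed_ideal_uminus: "I \<in> closed_ideals \<Longrightarrow> f \<in> I \<Longrightarrow> - f \<in> (I :: c1 set)"
  using closed_ideal_mult[of I f "- 1"] by simp

lemma quotient_norm_member:
  fixes I :: "c1 set"
  assumes "I \<in> closed_ideals" "f \<in> I"
  shows "quotient_norm f I \<le> 0"
  using quotient_norm_upper[OF closed_ideal_uminus[OF assms], of f] by simp

lemma quotient_norm_add:
  fixes I :: "c1 set"
  assumes I: "I \<in> closed_ideals"
  shows "quotient_norm (f + g) I \<le> quotient_norm f I + quotient_norm g I"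
proof (rule field_le_epsilon)
  fix e :: real assume "e > 0"
  obtain u where u: "u \<in> I" "norm (f + u) < quotient_norm f I + e / 2"
    by (rule quotient_norm_approx[OF I, of f "quotient_norm f I + e / 2"]) (use \<open>e > 0\<close> in auto)
  obtain v where v: "v \<in> I" "norm (g + v) < quotient_norm g I + e / 2"
    by (rule quotient_norm_approx[OF I, of g "quotient_norm g I + e / 2"]) (use \<open>e > 0\<close> in auto)
  have "quotient_norm (f + g) I \<le> norm ((f + g) + (u + v))"
    by (intro quotient_norm_upper closed_ideal_add[OF I] u v)
  also have "\<dots> \<le> norm (f + u) + norm (g + v)"
    using norm_triangle_ineq[of "f + u" "g + v"] by (simp add: algebra_simps)
  finally show "quotient_norm (f + g) I \<le> quotient_norm f I + quotient_norm g I + e"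
    using u v by simp
qed

lemma quotient_norm_mult:
  fixes I :: "c1 set"
  assumes I: "I \<in> closed_ideals" and "quotient_norm f I < r"
  shows "quotient_norm (h * f) I \<le> norm h * r"
proof -
  obtain u where u: "u \<in> I" "norm (f + u) < r"
    using quotient_norm_approx[OF assms] by blast
  have "quotient_norm (h * f) I \<le> norm (h * f + h * u)"
    by (intro quotient_norm_upper closed_ideal_mult[OF I] u)
  also have "\<dots> = norm (h * (f + u))" by (simp add: distrib_left)
  also have "\<dots> \<le> norm h * norm (f + u)" by (rule norm_mult_ineq)
  also have "\<dots> \<le> norm h * r" using u by (intro mult_left_mono) auto
  finally show ?thesis .
qed

lemma functional_le_quotient_norm:
  fixes I :: "c1 set"
  assumes "I \<in> closed_ideals" "\<And>f g. ev (f + g) = ev f + ev g" "\<And>f. cmod (ev f) \<le> norm f"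
    "\<And>g. g \<in> I \<Longrightarrow> ev g = 0"
  shows "cmod (ev a) \<le> quotient_norm a I"
proof (rule quotient_norm_greatest[OF assms(1)])
  fix g assume "g \<in> I"
  then have "ev (a + g) = ev a" by (simp add: assms(2,4))
  then show "cmod (ev a) \<le> norm (a + g)" using assms(3)[of "a + g"] by simp
qed

text \<open>
  The functions whose quotient norms tend to zero along a filter of closed ideals form a closed ideal. So the proof
  that they include a given function can be localized by \<open>local_membership\<close>.
\<close>
lemma asymptotic_ideal:
  fixes F :: "c1 set filter"
  assumes F: "eventually (\<lambda>J. J \<in> closed_ideals) F"
  shows "{g. \<forall>e>0. eventually (\<lambda>J. quotient_norm g J < e) F} \<in> closed_ideals"
    (is "?L \<in> _")
proof (rule closed_idealsI)
  have "eventually (\<lambda>J. quotient_norm 0 J < e) F" if "e > 0" for e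
    using F
  proof eventually_elim
    case (elim J)
    then show ?case using quotient_norm_member[OF elim closed_ideal_zero[OF elim]] that by simp
  qed
  then show "0 \<in> ?L" by simp
next
  fix f g assume fg: "f \<in> ?L" "g \<in> ?L"
  have "eventually (\<lambda>J. quotient_norm (f + g) J < e) F" if "e > 0" for e
  proof -
    have "eventually (\<lambda>J. quotient_norm f J < e / 2) F" "eventually (\<lambda>J. quotient_norm g J < e / 2) F"
      using fg half_gt_zero[OF that] unfolding mem_Collect_eq by blast+
    with F show ?thesis
    proof eventually_elim
      case (elim J)
      then show ?case using quotient_norm_add[OF elim(1), of f g] by simp
    qed
  qed
  then show "f + g \<in> ?L" by simp
next
  fix f h assume f: "f \<in> ?L"
  have "eventually (\<lambda>J. quotient_norm (h * f) J < e) F" if "e > 0" for e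
  proof -
    have pos: "norm h + 1 > 0" by (simp add: add_nonneg_pos)
    then have "e / (norm h + 1) > 0" using that by simp
    then have "eventually (\<lambda>J. quotient_norm f J < e / (norm h + 1)) F"
      using f unfolding mem_Collect_eq by blast
    with F show ?thesis
    proof eventually_elim
      case (elim J)
      have "quotient_norm (h * f) J \<le> norm h * (e / (norm h + 1))"
        by (rule quotient_norm_mult[OF elim])
      also have "\<dots> < e" using pos that by (simp add: field_simps)
      finally show ?case .
    qed
  qed
  then show "h * f \<in> ?L" by simp
next
  have "g \<in> ?L" if g: "g \<in> closure ?L" for g
  proof -
    have "eventually (\<lambda>J. quotient_norm g J < e) F" if "e > 0" for e
    proof -
      obtain f where f: "f \<in> ?L" "dist f g < e / 2"
        using g half_gt_zero[OF \<open>e > 0\<close>] unfolding closure_approachable by blast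
      then have "eventually (\<lambda>J. quotient_norm f J < e / 2) F"
        using half_gt_zero[OF \<open>e > 0\<close>] unfolding mem_Collect_eq by blast
      with F show ?thesis
      proof eventually_elim
        case (elim J)
        have "quotient_norm (f + (g - f)) J \<le> quotient_norm f J + quotient_norm (g - f) J"
          by (rule quotient_norm_add[OF elim(1)])
        moreover have "quotient_norm (g - f) J \<le> dist f g"
          using quotient_norm_le[OF elim(1), of "g - f"] by (simp add: dist_norm norm_minus_commute)
        ultimately show ?case using elim f by simp
      qed
    qed
    then show ?thesis by simp
  qed
  then show "closed ?L" unfolding closure_subset_eq[symmetric] by (rule subsetI)
qed

lemma hull_value_le_quotient_norm:
  assumes CD: "(C, D) \<in> KK" and x: "x \<in> C"
  shows "cmod (c1_fun a x) \<le> quotient_norm a (ideal_of (C, D))"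
proof (rule functional_le_quotient_norm)
  have x01: "x \<in> {0..1}" using CD x by (auto simp: KK_iff)
  show "ideal_of (C, D) \<in> closed_ideals" by (rule ideal_of_closed_ideal[OF CD])
  show "c1_fun (f + g) x = c1_fun f x + c1_fun g x" for f g using x01 by (rule c1_fun_add)
  show "cmod (c1_fun f x) \<le> norm f" for f using x01 by (rule c1_fun_le_norm)
  show "c1_fun g x = 0" if "g \<in> ideal_of (C, D)" for g
    using that x by (simp add: ideal_of_iff[OF CD])
qed

lemma hull_slope_le_quotient_norm:
  assumes CD: "(C, D) \<in> KK" and p: "p \<in> D"
  shows "cmod (c1_slope p a) \<le> quotient_norm a (ideal_of (C, D))"
proof (rule functional_le_quotient_norm)
  have sq: "p \<in> square" using CD p by (auto simp: KK_iff)
  show "ideal_of (C, D) \<in> closed_ideals" by (rule ideal_of_closed_ideal[OF CD])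
  show "c1_slope p (f + g) = c1_slope p f + c1_slope p g" for f g using sq by (rule c1_slope_add)
  show "cmod (c1_slope p f) \<le> norm f" for f using sq by (rule c1_slope_le_norm)
  show "c1_slope p g = 0" if "g \<in> ideal_of (C, D)" for g
    using that p by (auto simp: ideal_of_def)
qed

lemma norm_c1_const_le: "norm (c1_const c) \<le> cmod c"
  using c1_norm_leI[of "c1_const c" "cmod c" 0] by (simp add: c1_pointwise)

text \<open>
  If \<open>C\<close> has just one point \<open>z\<close> near \<open>x\<close>, without derivative condition, then \<open>f - f(z) k\<close> lies in
  the ideal. So the distance from \<open>f\<close> to the ideal is small as soon as \<open>f(z)\<close> is, while the bump \<open>k\<close>
  stays the same when \<open>z\<close> moves.
\<close>
lemma quotient_norm_near_simple_zero:
  fixes x r s m :: real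
  assumes CD: "(C, D) \<in> KK" and "r > 0" "m \<ge> 0"
    and f: "\<And>t. t \<in> {0..1} \<Longrightarrow> r / 2 \<le> \<bar>t - x\<bar> \<Longrightarrow> c1_fun f t = 0"
    and k: "\<And>t. t \<in> {0..1} \<Longrightarrow> \<bar>t - x\<bar> \<le> r / 8 \<Longrightarrow> c1_fun k t = 1"
      "\<And>t. t \<in> {0..1} \<Longrightarrow> r / 2 \<le> \<bar>t - x\<bar> \<Longrightarrow> c1_fun k t = 0"
    and D: "\<And>s t. \<bar>s - x\<bar> < r \<Longrightarrow> \<bar>t - x\<bar> < r \<Longrightarrow> (s, t) \<notin> D"
    and C: "\<And>c. c \<in> C \<Longrightarrow> \<bar>c - x\<bar> < r \<Longrightarrow> \<bar>c - x\<bar> \<le> r / 8 \<and> cmod (c1_fun f c) \<le> m"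
  shows "quotient_norm f (ideal_of (C, D)) \<le> m * norm k"
proof -
  have I: "ideal_of (C, D) \<in> closed_ideals" by (rule ideal_of_closed_ideal[OF CD])
  have C01: "C \<subseteq> {0..1}" and off: "\<And>s t. s \<in> C \<Longrightarrow> t \<in> C \<Longrightarrow> s \<noteq> t \<Longrightarrow> (s, t) \<in> D"
    using CD by (auto simp: KK_iff)
  show ?thesis
  proof (cases "\<exists>c\<in>C. \<bar>c - x\<bar> < r")
    case False
    then have "f \<in> ideal_of (C, D)"
      by (intro locally_supported_membership[OF CD \<open>r > 0\<close> f]) auto
    then have "quotient_norm f (ideal_of (C, D)) \<le> 0" by (rule quotient_norm_member[OF I])
    then show ?thesis using \<open>m \<ge> 0\<close> by (meson mult_nonneg_nonneg norm_ge_zero order_trans)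
  next
    case True
    then obtain z where z: "z \<in> C" "\<bar>z - x\<bar> < r" by blast
    define g where "g = c1_const (c1_fun f z) * k"
    have "f - g \<in> ideal_of (C, D)"
    proof (rule locally_supported_membership[OF CD \<open>r > 0\<close>])
      show "c1_fun (f - g) t = 0" if "t \<in> {0..1}" "r / 2 \<le> \<bar>t - x\<bar>" for t
        using that f k by (simp add: g_def c1_pointwise)
      fix c assume c: "c \<in> C" "\<bar>c - x\<bar> < r"
      have "c = z" using off[OF c(1) z(1)] D[OF c(2) z(2)] by blast
      moreover have "c1_fun k z = 1" using k(1) C[OF z] z(1) C01 by auto
      ultimately show "c1_fun (f - g) c = 0 \<and> (c, c) \<notin> D"
        using z C01 D[OF z(2) z(2)] by (auto simp: g_def c1_pointwise)
    qed
    then have "quotient_norm f (ideal_of (C, D)) \<le> norm (f + - (f - g))"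
      by (intro quotient_norm_upper closed_ideal_uminus[OF I])
    also have "\<dots> = norm g" by simp
    also have "\<dots> \<le> norm (c1_const (c1_fun f z)) * norm k" unfolding g_def by (rule norm_mult_ineq)
    also have "\<dots> \<le> m * norm k"
      using norm_c1_const_le[of "c1_fun f z"] C[OF z] by (intro mult_right_mono) auto
    finally show ?thesis .
  qed
qed


section \<open>Every \<open>\<tau>\<^sub>r\<close>-open set is \<open>\<tau>\<close>-open\<close>

lemma eventually_nhdsin_KK:
  assumes "q \<in> KK" "openin KK_topology {q \<in> KK. P q}" "P q"
  shows "eventually P (nhdsin KK_topology q)"
  unfolding eventually_nhdsin using assms by (intro disjI2 exI[of _ "{q \<in> KK. P q}"]) auto

lemma eventually_in_KK: "q \<in> KK \<Longrightarrow> eventually (\<lambda>q'. q' \<in> KK) (nhdsin KK_topology q)"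
  using openin_topspace[of KK_topology] by (intro eventually_nhdsin_KK) auto

lemma open_superlevel:
  fixes g :: "'b::metric_space \<Rightarrow> complex"
  assumes "continuous_on S g"
  obtains U where "open U" "\<And>t. t \<in> S \<Longrightarrow> t \<in> U \<longleftrightarrow> e < cmod (g t)"
proof -
  have "continuous_on S (\<lambda>t. cmod (g t))" using assms by (rule continuous_on_norm)
  then obtain U where "open U" "U \<inter> S = (\<lambda>t. cmod (g t)) -` {e<..} \<inter> S"
    using continuous_on_open_invariant[THEN iffD1, rule_format, of S "\<lambda>t. cmod (g t)" "{e<..}"] by auto
  then show thesis by (intro that[of U]) auto
qed

text \<open>
  If \<open>a\<close> is outside the limit ideal, then some value or difference quotient of \<open>a\<close> is nonzero at a point of \<open>C\<close>
  or \<open>D\<close>. Being continuous, it stays away from zero on an open set that is hit by all nearby parameters, and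
  it bounds the quotient norm from below.
\<close>
lemma normality_at_limit:
  assumes q: "q \<in> KK" and a: "a \<notin> ideal_of q"
  shows "\<exists>e>0. eventually (\<lambda>q'. e < quotient_norm a (ideal_of q')) (nhdsin KK_topology q)"
proof -
  obtain C D where CD: "q = (C, D)" by (cases q)
  have sub: "fst q' \<subseteq> {0..1}" "snd q' \<subseteq> square" if "q' \<in> KK" for q'
    using that KK_iff[of "fst q'" "snd q'"] by auto
  consider x where "x \<in> C" "c1_fun a x \<noteq> 0" | p where "p \<in> D" "c1_slope p a \<noteq> 0"
    using a by (auto simp: CD ideal_of_def)
  then show ?thesis
  proof cases
    case 1
    define e where "e = cmod (c1_fun a x) / 2"
    have e: "e > 0" "e < cmod (c1_fun a x)" using 1 by (simp_all add: e_def)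
    obtain U where U: "open U" "\<And>t. t \<in> {0..1} \<Longrightarrow> t \<in> U \<longleftrightarrow> e < cmod (c1_fun a t)"
      using open_superlevel[OF continuous_on_c1_fun] by metis
    have "x \<in> fst q \<inter> U" using 1 e U(2) sub(1)[OF q] by (auto simp: CD subset_iff)
    then have "eventually (\<lambda>q'. fst q' \<inter> U \<noteq> {}) (nhdsin KK_topology q)"
      using U(1) by (intro eventually_nhdsin_KK q openin_KK_topology) auto
    with eventually_in_KK[OF q]
    have "eventually (\<lambda>q'. e < quotient_norm a (ideal_of q')) (nhdsin KK_topology q)"
    proof eventually_elim
      case (elim q')
      then obtain t where t: "t \<in> fst q'" "t \<in> U" by blast
      have "t \<in> {0..1}" using t(1) sub(1)[OF elim(1)] by (rule subsetD[rotated])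
      then have "e < cmod (c1_fun a t)" using t(2) U(2) by blast
      also have "\<dots> \<le> quotient_norm a (ideal_of q')"
        using hull_value_le_quotient_norm[of "fst q'" "snd q'" t a] elim t by simp
      finally show ?case .
    qed
    then show ?thesis using e by blast
  next
    case 2
    define e where "e = cmod (c1_slope p a) / 2"
    have e: "e > 0" "e < cmod (c1_slope p a)" using 2 by (simp_all add: e_def)
    obtain U where U: "open U" "\<And>t. t \<in> square \<Longrightarrow> t \<in> U \<longleftrightarrow> e < cmod (c1_slope t a)"
      using open_superlevel[OF continuous_on_c1_slope] by metis
    have "p \<in> snd q \<inter> U" using 2 e U(2)[of p] sub(2)[OF q] unfolding CD by auto
    then have "eventually (\<lambda>q'. snd q' \<inter> U \<noteq> {}) (nhdsin KK_topology q)"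
      using U(1) by (intro eventually_nhdsin_KK q openin_KK_topology) auto
    with eventually_in_KK[OF q]
    have "eventually (\<lambda>q'. e < quotient_norm a (ideal_of q')) (nhdsin KK_topology q)"
    proof eventually_elim
      case (elim q')
      then obtain t where t: "t \<in> snd q'" "t \<in> U" by blast
      have "t \<in> square" using t(1) sub(2)[OF elim(1)] by (rule subsetD[rotated])
      then have "e < cmod (c1_slope t a)" using t(2) U(2) by blast
      also have "\<dots> \<le> quotient_norm a (ideal_of q')"
        using hull_slope_le_quotient_norm[of "fst q'" "snd q'" t a] elim t by simp
      finally show ?case .
    qed
    then show ?thesis using e by blast
  qed
qed

text \<open>
  The heart of the upper semicontinuity of the quotient norms. The functions \<open>g\<close> whose norms modulo
  nearby ideals tend to zero form a closed ideal \<open>L\<close>, so only the points \<open>x\<close> where \<open>b\<close> or \<open>b'\<close> is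
  nonzero matter. If \<open>x \<notin> C\<close>, then nearby sets miss a ball around \<open>x\<close> and a localization of \<open>b\<close>
  belongs to the nearby ideals. If \<open>x \<in> C\<close>, then \<open>(x, x) \<notin> D\<close>, and nearby sets have at most one
  point close to \<open>x\<close>, which tends to \<open>x\<close> and carries no derivative condition; then
  \<open>quotient_norm_near_simple_zero\<close> applies, as \<open>b(x) = 0\<close>.
\<close>
lemma quotient_norm_vanishes_at_limit:
  assumes q: "q \<in> KK" and b: "b \<in> ideal_of q" and "e > 0"
  shows "eventually (\<lambda>q'. quotient_norm b (ideal_of q') < e) (nhdsin KK_topology q)"
proof -
  obtain C D where CD: "q = (C, D)" by (cases q)
  have KK: "(C, D) \<in> KK" using q CD by simp
  define F where "F = nhdsin KK_topology q"
  define L where "L = {g. \<forall>e>0. eventually (\<lambda>q'. quotient_norm g (ideal_of q') < e) F}"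
  have inKK: "eventually (\<lambda>q'. q' \<in> KK) F" unfolding F_def by (rule eventually_in_KK[OF q])
  then have "eventually (\<lambda>J. J \<in> closed_ideals) (filtermap ideal_of F)"
    unfolding eventually_filtermap by eventually_elim (rule ideal_of_closed_ideal)
  then have L: "L \<in> closed_ideals"
    using asymptotic_ideal[of "filtermap ideal_of F"] by (simp add: L_def eventually_filtermap)
  have "b \<in> L"
  proof (rule local_membership[OF L])
    fix x :: real
    assume x: "x \<in> {0..1}" and nz: "c1_fun b x \<noteq> 0 \<or> c1_deriv b x \<noteq> 0"
    show "\<exists>h. c1_fun h x \<noteq> 0 \<and> h * b \<in> L"
    proof (cases "x \<in> C")
      case False
      then obtain r where r: "r > 0" "\<And>c. c \<in> C \<Longrightarrow> r \<le> \<bar>c - x\<bar>"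
        using closed_avoids[of C x] KK by (auto simp: KK_iff)
      define R where "R = r / 2"
      have R: "R > 0" "R < r" using r(1) by (simp_all add: R_def)
      obtain h where h: "\<And>t. t \<in> {0..1} \<Longrightarrow> \<bar>t - x\<bar> \<le> R / 8 \<Longrightarrow> c1_fun h t = 1"
        "\<And>t. t \<in> {0..1} \<Longrightarrow> R / 2 \<le> \<bar>t - x\<bar> \<Longrightarrow> c1_fun h t = 0"
        by (rule bump[OF R(1), of x]) blast
      have "c \<notin> cball x R" if "c \<in> C" for c
        using r(2)[OF that] R by (simp add: dist_real_def abs_minus_commute)
      then have "eventually (\<lambda>q'. fst q' \<inter> cball x R = {}) F"
        unfolding F_def by (intro eventually_nhdsin_KK q openin_KK_topology) (auto simp: CD)
      with inKK have *: "eventually (\<lambda>q'. quotient_norm (h * b) (ideal_of q') \<le> 0) F"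
      proof eventually_elim
        case (elim q')
        have "h * b \<in> ideal_of (fst q', snd q')"
        proof (rule locally_supported_membership[OF _ R(1)])
          show "(fst q', snd q') \<in> KK" using elim by simp
          show "c1_fun (h * b) t = 0" if "t \<in> {0..1}" "R / 2 \<le> \<bar>t - x\<bar>" for t
            using that h(2) by (simp add: c1_pointwise)
          fix c assume "c \<in> fst q'" "\<bar>c - x\<bar> < R"
          then have "c \<in> fst q' \<inter> cball x R" by (simp add: dist_real_def)
          then show "c1_fun (h * b) c = 0 \<and> (c, c) \<notin> snd q'" using elim by simp
        qed
        then show ?case using quotient_norm_member ideal_of_closed_ideal[OF elim(1)] by simp
      qed
      have "h * b \<in> L"
        unfolding L_def using eventually_mono[OF *] by (auto intro: le_less_trans)
      then show ?thesis using h(1)[OF x] R by (intro exI[of _ h]) auto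
    next
      case True
      have bx: "c1_fun b x = 0" and notD: "(x, x) \<notin> D"
        using True b nz unfolding CD by (auto simp: ideal_of_iff[OF KK])
      obtain r where r: "r > 0" "\<And>c. c \<in> C \<Longrightarrow> \<bar>c - x\<bar> < r \<Longrightarrow> c = x \<and> (c, c) \<notin> D"
        "\<And>s t. \<bar>s - x\<bar> < r \<Longrightarrow> \<bar>t - x\<bar> < r \<Longrightarrow> (s, t) \<notin> D"
        using isolated_in_hull[OF KK notD] by metis
      define R where "R = r / 2"
      have R: "R > 0" "R < r" using r(1) by (simp_all add: R_def)
      obtain h where h: "\<And>t. t \<in> {0..1} \<Longrightarrow> \<bar>t - x\<bar> \<le> R / 8 \<Longrightarrow> c1_fun h t = 1"
        "\<And>t. t \<in> {0..1} \<Longrightarrow> R / 2 \<le> \<bar>t - x\<bar> \<Longrightarrow> c1_fun h t = 0"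
        by (rule bump[OF R(1), of x]) blast
      have "eventually (\<lambda>q'. quotient_norm (h * b) (ideal_of q') < e) F" if "e > 0" for e
      proof -
        have pos: "norm h + 1 > 0" by (simp add: add_nonneg_pos)
        \<comment> \<open>The bump \<open>h\<close> also serves as the correcting function, which costs the factor \<open>norm h\<close>.\<close>
        define m where "m = e / (norm h + 1)"
        have m: "m > 0" "m * norm h < e" using pos that by (simp_all add: m_def field_simps)
        have hbx: "c1_fun (h * b) x = 0" using bx x by (simp add: c1_pointwise)
        obtain d where d: "d > 0"
          "\<And>t. t \<in> {0..1} \<Longrightarrow> dist t x < d \<Longrightarrow> dist (c1_fun (h * b) t) (c1_fun (h * b) x) < m"
          using continuous_on_c1_fun[of "h * b", unfolded continuous_on_iff] x m(1) by blast
        define s where "s = min d (R / 8)"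
        have s: "s > 0" "s \<le> d" "s \<le> R / 8" using d(1) R by (simp_all add: s_def)
        \<comment> \<open>Missing this closed annulus forces all points of nearby sets in the ball into \<open>ball x s\<close>.\<close>
        have "c \<notin> cball x R - ball x s" if "c \<in> C" for c
          using r(2)[OF that] R s by (auto simp: dist_real_def abs_minus_commute)
        moreover have "closed (cball x R - ball x s)" by (intro closed_Diff closed_cball open_ball)
        ultimately have "eventually (\<lambda>q'. fst q' \<inter> (cball x R - ball x s) = {}) F"
          unfolding F_def by (intro eventually_nhdsin_KK q openin_KK_topology) (auto simp: CD)
        moreover have "(s, t) \<notin> D" if "s \<in> cball x R" "t \<in> cball x R" for s t
          using that R by (intro r(3)) (auto simp: dist_real_def)
        then have "D \<inter> (cball x R \<times> cball x R) = {}" by blast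
        then have "eventually (\<lambda>q'. snd q' \<inter> (cball x R \<times> cball x R) = {}) F"
          unfolding F_def by (intro eventually_nhdsin_KK q openin_KK_topology closed_Times closed_cball) (simp add: CD)
        ultimately show ?thesis using inKK
        proof eventually_elim
          case (elim q')
          have "quotient_norm (h * b) (ideal_of (fst q', snd q')) \<le> m * norm h"
          proof (rule quotient_norm_near_simple_zero[OF _ R(1) _ _ h])
            show q': "(fst q', snd q') \<in> KK" using elim by simp
            show "c1_fun (h * b) t = 0" if "t \<in> {0..1}" "R / 2 \<le> \<bar>t - x\<bar>" for t
              using that h(2) by (simp add: c1_pointwise)
            show "(s, t) \<notin> snd q'" if "\<bar>s - x\<bar> < R" "\<bar>t - x\<bar> < R" for s t
            proof -
              have "(s, t) \<in> cball x R \<times> cball x R" using that by (auto simp: dist_real_def)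
              then show ?thesis using elim(2) by blast
            qed
            fix c assume c: "c \<in> fst q'" "\<bar>c - x\<bar> < R"
            have "c \<in> cball x R" using c by (simp add: dist_real_def)
            then have "c \<in> ball x s" using c elim(1) by blast
            then have cx: "dist c x < s" by (simp add: dist_commute)
            moreover have "c \<in> {0..1}" using q' c(1) unfolding KK_iff by blast
            ultimately show "\<bar>c - x\<bar> \<le> R / 8 \<and> cmod (c1_fun (h * b) c) \<le> m"
              using s d(2)[of c] hbx by (simp add: dist_real_def dist_norm)
          qed (use m in auto)
          then show ?case using m(2) by simp
        qed
      qed
      then have "h * b \<in> L" by (simp add: L_def)
      then show ?thesis using h(1)[OF x] R by (intro exI[of _ h]) auto
    qed
  qed
  then show ?thesis using \<open>e > 0\<close> by (simp add: L_def F_def)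
qed

lemma quotient_norm_upper_semicontinuous:
  assumes q: "q \<in> KK" and "quotient_norm a (ideal_of q) < r"
  shows "eventually (\<lambda>q'. quotient_norm a (ideal_of q') < r) (nhdsin KK_topology q)"
proof -
  have I: "ideal_of q \<in> closed_ideals" by (rule ideal_of_closed_ideal[OF q])
  obtain b where b: "b \<in> ideal_of q" "norm (a + b) < r"
    using quotient_norm_approx[OF I assms(2)] by blast
  have "eventually (\<lambda>q'. quotient_norm (- b) (ideal_of q') < r - norm (a + b)) (nhdsin KK_topology q)"
    using b by (intro quotient_norm_vanishes_at_limit[OF q] closed_ideal_uminus[OF I]) auto
  with eventually_in_KK[OF q] show ?thesis
  proof eventually_elim
    case (elim q')
    have J: "ideal_of q' \<in> closed_ideals" by (rule ideal_of_closed_ideal[OF elim(1)])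
    have "quotient_norm ((a + b) + - b) (ideal_of q') \<le>
        quotient_norm (a + b) (ideal_of q') + quotient_norm (- b) (ideal_of q')"
      by (rule quotient_norm_add[OF J])
    then show ?case using quotient_norm_le[OF J, of "a + b"] elim(2) by simp
  qed
qed

lemma openin_KK_local:
  assumes "V \<subseteq> KK" "\<And>q. q \<in> V \<Longrightarrow> eventually (\<lambda>q'. q' \<in> V) (nhdsin KK_topology q)"
  shows "openin KK_topology V"
proof (subst openin_subopen, intro ballI)
  fix q assume "q \<in> V"
  then show "\<exists>T. openin KK_topology T \<and> q \<in> T \<and> T \<subseteq> V"
    using assms(2)[of q] assms(1) unfolding eventually_nhdsin by auto
qed

lemma tau_u_preimage:
  assumes "openin tau_u U"
  shows "openin KK_topology {q \<in> KK. ideal_of q \<in> U}"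
proof -
  have "continuous_map KK_topology tau_u ideal_of"
    unfolding tau_u_def
  proof (rule continuous_on_generated_topo)
    fix U :: "c1 set set" assume "U \<in> {{I \<in> closed_ideals. quotient_norm a I < r} | a r. True}"
    then obtain a r where U: "U = {I \<in> closed_ideals. quotient_norm a I < r}" by blast
    have "openin KK_topology {q \<in> KK. quotient_norm a (ideal_of q) < r}"
    proof (rule openin_KK_local)
      fix q assume "q \<in> {q \<in> KK. quotient_norm a (ideal_of q) < r}"
      then have q: "q \<in> KK" "quotient_norm a (ideal_of q) < r" by auto
      show "eventually (\<lambda>q'. q' \<in> {q \<in> KK. quotient_norm a (ideal_of q) < r}) (nhdsin KK_topology q)"
        using eventually_in_KK[OF q(1)] quotient_norm_upper_semicontinuous[OF q]
        by eventually_elim simp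
    qed auto
    moreover have "ideal_of -` U \<inter> topspace KK_topology = {q \<in> KK. quotient_norm a (ideal_of q) < r}"
      using ideal_of_closed_ideal by (auto simp: U)
    ultimately show "openin KK_topology (ideal_of -` U \<inter> topspace KK_topology)" by simp
  next
    have "ideal_of ` KK \<subseteq> topspace tau_u" using ideal_of_closed_ideal by auto
    then show "ideal_of ` topspace KK_topology \<subseteq> \<Union>{{I \<in> closed_ideals. quotient_norm a I < r} |a r. True}"
      unfolding tau_u_def topology_generated_by_topspace by simp
  qed
  from openin_continuous_map_preimage[OF this assms] show ?thesis by simp
qed

text \<open>
  Otherwise the trace of the neighbourhood filter of \<open>q\<close> on the parameters with ideal outside \<open>U\<close> would be
  proper and would have the normality property, so that the limit ideal would be outside \<open>U\<close> as well.
\<close>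
lemma tau_n_preimage:
  assumes "openin tau_n U"
  shows "openin KK_topology {q \<in> KK. ideal_of q \<in> U}"
proof (rule openin_KK_local)
  fix q assume "q \<in> {q \<in> KK. ideal_of q \<in> U}"
  then have q: "q \<in> KK" "ideal_of q \<in> U" by auto
  let ?N = "closed_ideals - U"
  have N: "tau_n_closed ?N" using assms by (simp add: openin_tau_n)
  let ?F = "inf (nhdsin KK_topology q) (principal {q'. ideal_of q' \<in> ?N})"
  have "?F = bot"
  proof (rule ccontr)
    assume ne: "?F \<noteq> bot"
    have "ideal_of q \<in> ?N"
    proof (rule tau_n_closed_filter[OF N])
      show "ideal_of q \<in> closed_ideals" by (rule ideal_of_closed_ideal[OF q(1)])
      show "filtermap ideal_of ?F \<noteq> bot" using ne by (simp add: filtermap_bot_iff)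
      show "eventually (\<lambda>J. J \<in> ?N) (filtermap ideal_of ?F)"
        by (simp add: eventually_filtermap eventually_inf_principal)
      show "\<exists>e>0. eventually (\<lambda>J. e < quotient_norm a J) (filtermap ideal_of ?F)"
        if "a \<notin> ideal_of q" for a
        using normality_at_limit[OF q(1) that] filter_leD[OF inf_le1]
        unfolding eventually_filtermap by blast
    qed
    then show False using q(2) by simp
  qed
  then have "eventually (\<lambda>q'. ideal_of q' \<notin> ?N) (nhdsin KK_topology q)"
    by (simp add: trivial_limit_def eventually_inf_principal)
  with eventually_in_KK[OF q(1)]
  show "eventually (\<lambda>q'. q' \<in> {q \<in> KK. ideal_of q \<in> U}) (nhdsin KK_topology q)"
    by eventually_elim (use ideal_of_closed_ideal in auto)
qed auto

lemma continuous_map_ideal_of: "continuous_map KK_topology tau_r ideal_of"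
  unfolding tau_r_def
proof (rule continuous_on_generated_topo)
  fix U :: "c1 set set" assume "U \<in> {U. openin tau_u U} \<union> {U. openin tau_n U}"
  then have "openin KK_topology {q \<in> KK. ideal_of q \<in> U}"
    using tau_u_preimage tau_n_preimage by blast
  then show "openin KK_topology (ideal_of -` U \<inter> topspace KK_topology)"
    by (simp add: vimage_def Int_def conj_commute)
next
  have "ideal_of ` KK \<subseteq> topspace tau_r" using ideal_of_closed_ideal by auto
  then show "ideal_of ` topspace KK_topology \<subseteq> \<Union>({U. openin tau_u U} \<union> {U. openin tau_n U})"
    unfolding tau_r_def topology_generated_by_topspace by simp
qed


section \<open>Every \<open>\<tau>\<close>-open set is \<open>\<tau>\<^sub>r\<close>-open\<close>

text \<open>
  Stated for an abstract family of functionals because it is needed both for point evaluations and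
  for difference quotients. An element of \<open>I\<close> with a value larger than \<open>c\<close> around \<open>p\<close> forces every
  ideal in which its quotient norm is below \<open>c\<close> to have no common zero there. Compactness of \<open>Q\<close> reduces the
  condition to finitely many such elements.
\<close>
lemma openin_tau_u_no_common_zero:
  fixes ev :: "'p::metric_space \<Rightarrow> c1 \<Rightarrow> complex"
  assumes cont: "\<And>f. continuous_on Y (\<lambda>p. ev p f)"
    and add: "\<And>p f g. p \<in> Y \<Longrightarrow> ev p (f + g) = ev p f + ev p g"
    and bd: "\<And>p f. p \<in> Y \<Longrightarrow> cmod (ev p f) \<le> norm f"
    and Q: "compact Q" "Q \<subseteq> Y"
  shows "openin tau_u {I \<in> closed_ideals. \<forall>p\<in>Q. \<exists>f\<in>I. ev p f \<noteq> 0}"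
proof (subst openin_subopen, intro ballI)
  fix I assume "I \<in> {I \<in> closed_ideals. \<forall>p\<in>Q. \<exists>f\<in>I. ev p f \<noteq> 0}"
  then have I: "I \<in> closed_ideals" and nz: "\<And>p. p \<in> Q \<Longrightarrow> \<exists>f\<in>I. ev p f \<noteq> 0" by auto
  have "\<forall>f c. \<exists>U. open U \<and> (\<forall>p\<in>Y. p \<in> U \<longleftrightarrow> c < cmod (ev p f))"
    using open_superlevel[OF cont] by metis
  then obtain W where "\<forall>f c. open (W f c) \<and> (\<forall>p\<in>Y. p \<in> W f c \<longleftrightarrow> c < cmod (ev p f))"
    by metis
  then have W: "\<And>f c. open (W f c)" "\<And>f c p. p \<in> Y \<Longrightarrow> p \<in> W f c \<longleftrightarrow> c < cmod (ev p f)"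
    by blast+
  have "Q \<subseteq> (\<Union>(f, c)\<in>I \<times> {0<..}. W f c)"
  proof
    fix p assume p: "p \<in> Q"
    then obtain f where f: "f \<in> I" "ev p f \<noteq> 0" using nz by blast
    then have "p \<in> W f (cmod (ev p f) / 2)" using W(2) p Q(2) by auto
    then show "p \<in> (\<Union>(f, c)\<in>I \<times> {0<..}. W f c)"
      using f by (intro UN_I[of "(f, cmod (ev p f) / 2)"]) auto
  qed
  then obtain S where S: "S \<subseteq> I \<times> {0<..}" "finite S" "Q \<subseteq> (\<Union>(f, c)\<in>S. W f c)"
    by (rule compactE_image[OF Q(1), rotated]) (use W(1) in auto)
  define T where "T = (\<Inter>(f, c)\<in>S. {J \<in> closed_ideals. quotient_norm f J < c}) \<inter> closed_ideals"
  show "\<exists>T. openin tau_u T \<and> I \<in> T \<and> T \<subseteq> {I \<in> closed_ideals. \<forall>p\<in>Q. \<exists>f\<in>I. ev p f \<noteq> 0}"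
  proof (intro exI[of _ T] conjI subsetI)
    have "openin tau_u {J \<in> closed_ideals. quotient_norm f J < c}" for f :: c1 and c
      using usc_map_tau_u[of f] by (simp add: usc_map_def)
    then show "openin tau_u T"
      using openin_INT[OF S(2), of tau_u "\<lambda>(f, c). {J \<in> closed_ideals. quotient_norm f J < c}"]
      by (simp add: T_def split_beta)
    have "quotient_norm f I < c" if "(f, c) \<in> S" for f c
    proof -
      have "f \<in> I" "c > 0" using S(1) that by auto
      then show ?thesis using quotient_norm_member[OF I] by force
    qed
    then show "I \<in> T" using I by (auto simp: T_def)
    fix J assume J: "J \<in> T"
    then have Jc: "J \<in> closed_ideals" by (simp add: T_def)
    have "\<exists>g\<in>J. ev p g \<noteq> 0" if p: "p \<in> Q" for p
    proof (rule ccontr)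
      assume "\<not> (\<exists>g\<in>J. ev p g \<noteq> 0)"
      then have zero: "\<And>g. g \<in> J \<Longrightarrow> ev p g = 0" by blast
      have pY: "p \<in> Y" using p Q(2) by blast
      obtain f c where fc: "(f, c) \<in> S" "p \<in> W f c" using S(3) p by blast
      have "c < cmod (ev p f)" using W(2)[OF pY] fc(2) by blast
      also have "\<dots> \<le> quotient_norm f J"
        by (rule functional_le_quotient_norm[OF Jc add[OF pY] bd[OF pY] zero])
      also have "\<dots> < c" using J fc(1) by (auto simp: T_def)
      finally show False .
    qed
    with Jc show "J \<in> {I \<in> closed_ideals. \<forall>p\<in>Q. \<exists>f\<in>I. ev p f \<noteq> 0}" by blast
  qed
qed

text \<open>
  The normality property of the ideals \<open>ideal_of q'\<close> along \<open>G\<close>, transported to the parameters.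
\<close>
definition normal_limit :: "(real set \<times> (real \<times> real) set) filter \<Rightarrow> real set \<times> (real \<times> real) set \<Rightarrow> bool" where
  "normal_limit G q \<longleftrightarrow> eventually (\<lambda>q'. q' \<in> KK) G \<and>
     (\<forall>a. a \<notin> ideal_of q \<longrightarrow> (\<exists>e>0. eventually (\<lambda>q'. e < quotient_norm a (ideal_of q')) G))"

text \<open>
  A bump function at \<open>x\<close> is outside the limit ideal, but it belongs to every ideal whose zero set
  misses the ball.
\<close>
lemma normal_limit_hits_ball:
  assumes G: "normal_limit G (C, D)" and CD: "(C, D) \<in> KK" and x: "x \<in> C" and "r > 0"
  shows "eventually (\<lambda>q'. fst q' \<inter> ball x r \<noteq> {}) G"
proof -
  have x01: "x \<in> {0..1}" using CD x by (auto simp: KK_iff)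
  obtain k where k: "\<And>t. t \<in> {0..1} \<Longrightarrow> \<bar>t - x\<bar> \<le> r / 8 \<Longrightarrow> c1_fun k t = 1"
    "\<And>t. t \<in> {0..1} \<Longrightarrow> r / 2 \<le> \<bar>t - x\<bar> \<Longrightarrow> c1_fun k t = 0"
    by (rule bump[OF \<open>r > 0\<close>, of x]) blast
  have "c1_fun k x \<noteq> 0" using k(1)[OF x01] \<open>r > 0\<close> by simp
  then have "k \<notin> ideal_of (C, D)" using x by (auto simp: ideal_of_iff[OF CD])
  then obtain e where e: "e > 0" "eventually (\<lambda>q'. e < quotient_norm k (ideal_of q')) G"
    and KK: "eventually (\<lambda>q'. q' \<in> KK) G"
    using G by (auto simp: normal_limit_def)
  from KK e(2) show ?thesis
  proof eventually_elim
    case (elim q')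
    show ?case
    proof
      assume miss: "fst q' \<inter> ball x r = {}"
      have q': "(fst q', snd q') \<in> KK" using elim(1) by simp
      have "c1_fun k c = 0 \<and> (c, c) \<notin> snd q'" if "c \<in> fst q'" "\<bar>c - x\<bar> < r" for c
      proof -
        have "c \<in> fst q' \<inter> ball x r" using that by (simp add: dist_real_def abs_minus_commute)
        then show ?thesis using miss by simp
      qed
      then have "k \<in> ideal_of (fst q', snd q')"
        by (intro locally_supported_membership[OF q' \<open>r > 0\<close>, of x] k(2)) auto
      then have "quotient_norm k (ideal_of q') \<le> 0"
        using quotient_norm_member[OF ideal_of_closed_ideal[OF elim(1)], of k] by simp
      then show False using elim(2) e(1) by simp
    qed
  qed
qed

lemma normal_limit_hits_offdiagonal:
  assumes G: "normal_limit G (C, D)" and CD: "(C, D) \<in> KK" and p: "(x, y) \<in> D" "x \<noteq> y"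
    and U: "open U" "(x, y) \<in> U"
  shows "eventually (\<lambda>q'. snd q' \<inter> U \<noteq> {}) G"
proof -
  have xy: "x \<in> C" "y \<in> C" using CD p by (auto simp: KK_iff)
  obtain s where s: "s > 0" "\<And>u v. \<bar>u - x\<bar> < s \<Longrightarrow> \<bar>v - y\<bar> < s \<Longrightarrow> (u, v) \<in> U"
    using open_box[OF U] by metis
  define r where "r = min s (\<bar>x - y\<bar> / 2)"
  have "r \<le> \<bar>x - y\<bar> / 2" unfolding r_def by (rule min.cobounded2)
  then have r: "r > 0" "r \<le> s" "2 * r \<le> \<bar>x - y\<bar>" using s(1) p(2) by (auto simp: r_def)
  have "eventually (\<lambda>q'. q' \<in> KK) G" using G by (simp add: normal_limit_def)
  with normal_limit_hits_ball[OF G CD xy(1) r(1)] normal_limit_hits_ball[OF G CD xy(2) r(1)]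
  show ?thesis
  proof eventually_elim
    case (elim q')
    then obtain u v where uv: "u \<in> fst q'" "u \<in> ball x r" "v \<in> fst q'" "v \<in> ball y r" by blast
    then have d: "\<bar>u - x\<bar> < r" "\<bar>v - y\<bar> < r" by (simp_all add: dist_real_def abs_minus_commute)
    then have "u \<noteq> v" using r(3) by linarith
    then have "(u, v) \<in> snd q'"
      using KK_iff[of "fst q'" "snd q'"] elim(3) uv by simp
    moreover have "(u, v) \<in> U" using s(2) d r(2) by simp
    ultimately show ?case by blast
  qed
qed

text \<open>
  The delicate case. The function \<open>a(t) = (t - x) k(t)\<close> has derivative 1 at \<open>x\<close>, so its quotient norms
  stay above some \<open>e\<close>. Suppose that \<open>D'\<close> misses the square around \<open>(x, x)\<close>. Then \<open>C'\<close> has just one point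
  \<open>z\<close> near \<open>x\<close>, arbitrarily close to \<open>x\<close> by \<open>normal_limit_hits_ball\<close>, and carrying no derivative
  condition. By \<open>quotient_norm_near_simple_zero\<close> the quotient norm of \<open>a\<close> is then at most
  \<open>\<bar>z - x\<bar> \<parallel>k\<parallel>\<close>, which is less than \<open>e\<close>.
\<close>
lemma normal_limit_hits_diagonal:
  assumes G: "normal_limit G (C, D)" and CD: "(C, D) \<in> KK" and p: "(x, x) \<in> D"
    and U: "open U" "(x, x) \<in> U"
  shows "eventually (\<lambda>q'. snd q' \<inter> U \<noteq> {}) G"
proof -
  have xC: "x \<in> C" and x01: "x \<in> {0..1}" using CD p by (auto simp: KK_iff)
  obtain r where r: "r > 0" "\<And>u v. \<bar>u - x\<bar> < r \<Longrightarrow> \<bar>v - x\<bar> < r \<Longrightarrow> (u, v) \<in> U"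
    using open_box[OF U] by metis
  obtain k where k: "\<And>t. t \<in> {0..1} \<Longrightarrow> \<bar>t - x\<bar> \<le> r / 8 \<Longrightarrow> c1_fun k t = 1"
    "\<And>t. t \<in> {0..1} \<Longrightarrow> r / 2 \<le> \<bar>t - x\<bar> \<Longrightarrow> c1_fun k t = 0"
    by (rule bump[OF r(1), of x]) blast
  define a where "a = (c1_id - c1_const (of_real x)) * k"
  have a: "c1_fun a t = of_real (t - x) * c1_fun k t" if "t \<in> {0..1}" for t
    using that by (simp add: a_def c1_pointwise)
  have "c1_deriv a x = 1"
    unfolding a_def by (rule bump_identity[OF x01, of "r / 8"]) (use k r(1) in auto)
  then have "a \<notin> ideal_of (C, D)" using p by (auto simp: ideal_of_iff[OF CD])
  then obtain e where e: "e > 0" "eventually (\<lambda>q'. e < quotient_norm a (ideal_of q')) G"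
    and KK: "eventually (\<lambda>q'. q' \<in> KK) G"
    using G by (auto simp: normal_limit_def)
  have pos: "norm k + 1 > 0" by (simp add: add_nonneg_pos)
  \<comment> \<open>Within \<open>r / 8\<close> of \<open>x\<close> the bump \<open>k\<close> is 1; the other bound makes \<open>d * norm k < e\<close>.\<close>
  define d where "d = min (r / 8) (e / (norm k + 1))"
  have d: "d \<le> r / 8" "d \<le> e / (norm k + 1)"
    unfolding d_def by (rule min.cobounded1 min.cobounded2)+
  have d_pos: "d > 0" using r(1) e(1) pos by (simp add: d_def)
  have "d * norm k \<le> e / (norm k + 1) * norm k" using d(2) by (rule mult_right_mono) simp
  also have "\<dots> < e" using e(1) pos by (simp add: field_simps)
  finally have small: "d * norm k < e" .
  from KK e(2) normal_limit_hits_ball[OF G CD xC d_pos] show ?thesis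
  proof eventually_elim
    case (elim q')
    show ?case
    proof
      assume miss: "snd q' \<inter> U = {}"
      have q': "(fst q', snd q') \<in> KK" using elim(1) by simp
      have sub: "fst q' \<subseteq> {0..1}"
        and off: "\<And>u v. u \<in> fst q' \<Longrightarrow> v \<in> fst q' \<Longrightarrow> u \<noteq> v \<Longrightarrow> (u, v) \<in> snd q'"
        using q' unfolding KK_iff by blast+
      obtain z where z: "z \<in> fst q'" "\<bar>z - x\<bar> < d"
        using elim(3) by (auto simp: dist_real_def abs_minus_commute)
      have missD: "(u, v) \<notin> snd q'" if "\<bar>u - x\<bar> < r" "\<bar>v - x\<bar> < r" for u v
        using r(2)[OF that] miss by blast
      have "quotient_norm a (ideal_of (fst q', snd q')) \<le> d * norm k"
      proof (rule quotient_norm_near_simple_zero[OF q' r(1) _ _ k missD])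
        show "c1_fun a t = 0" if "t \<in> {0..1}" "r / 2 \<le> \<bar>t - x\<bar>" for t
          using that k(2) by (simp add: a)
        fix c assume c: "c \<in> fst q'" "\<bar>c - x\<bar> < r"
        have "\<bar>z - x\<bar> < r" using z(2) d(1) r(1) by linarith
        then have "c = z" using off[OF c(1) z(1)] missD[OF c(2)] by blast
        moreover have "c1_fun k z = 1" using k(1)[of z] z sub d(1) by auto
        moreover have "cmod (of_real (z - x)) < d" using z(2) by (simp only: norm_of_real)
        ultimately show "\<bar>c - x\<bar> \<le> r / 8 \<and> cmod (c1_fun a c) \<le> d"
          using a[of z] z sub d(1) by auto
      qed (use d_pos in auto)
      then show False using elim(2) small by simp
    qed
  qed
qed

abbreviation hull_of :: "c1 set \<Rightarrow> real set \<times> (real \<times> real) set" where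
  "hull_of \<equiv> inv_into KK ideal_of"

lemma
  assumes "I \<in> closed_ideals"
  shows hull_of_in_KK: "hull_of I \<in> KK" and ideal_of_hull_of: "ideal_of (hull_of I) = I"
  using assms bij_betw_ideal_of by (auto simp: bij_betw_def inv_into_into f_inv_into_f)

lemma openin_tau_n_of_normal_limit:
  assumes "\<And>G q. q \<in> KK \<Longrightarrow> normal_limit G q \<Longrightarrow> P q \<Longrightarrow> eventually P G"
  shows "openin tau_n {I \<in> closed_ideals. P (hull_of I)}"
  unfolding openin_tau_n
proof
  let ?N = "closed_ideals - {I \<in> closed_ideals. P (hull_of I)}"
  show "tau_n_closed ?N"
    unfolding tau_n_closed_iff_filter
  proof (intro conjI allI ballI impI)
    fix F I
    assume I: "I \<in> closed_ideals" and F: "F \<noteq> bot" "eventually (\<lambda>J. J \<in> ?N) F"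
      and nor: "\<forall>a. a \<notin> I \<longrightarrow> (\<exists>e>0. eventually (\<lambda>J. e < quotient_norm a J) F)"
    have cl: "eventually (\<lambda>J. J \<in> closed_ideals) F" using F(2) by eventually_elim simp
    have "normal_limit (filtermap hull_of F) (hull_of I)"
      unfolding normal_limit_def eventually_filtermap
    proof (intro conjI allI impI)
      show "eventually (\<lambda>J. hull_of J \<in> KK) F"
        using cl by eventually_elim (rule hull_of_in_KK)
      fix a assume "a \<notin> ideal_of (hull_of I)"
      then obtain e where "e > 0" "eventually (\<lambda>J. e < quotient_norm a J) F"
        using nor ideal_of_hull_of[OF I] by auto
      moreover from this(2) cl have "eventually (\<lambda>J. e < quotient_norm a (ideal_of (hull_of J))) F"
        by eventually_elim (simp add: ideal_of_hull_of)
      ultimately show "\<exists>e>0. eventually (\<lambda>J. e < quotient_norm a (ideal_of (hull_of J))) F" by blast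
    qed
    note lim = assms[OF hull_of_in_KK[OF I] this]
    show "I \<in> ?N"
    proof (rule ccontr)
      assume "I \<notin> ?N"
      then have "P (hull_of I)" using I by simp
      from lim[OF this] have "eventually (\<lambda>J. P (hull_of J)) F" by (simp add: eventually_filtermap)
      with F(2) have "eventually (\<lambda>J. False) F" by eventually_elim simp
      with F(1) show False by (simp add: trivial_limit_def)
    qed
  qed auto
qed auto

lemma openin_tau_rI: "openin tau_u U \<or> openin tau_n U \<Longrightarrow> openin tau_r U"
  unfolding tau_r_def by (rule topology_generated_by_Basis) blast

lemma hull_of_misses:
  shows "compact Q \<Longrightarrow> Q \<subseteq> {0..1} \<Longrightarrow> openin tau_r {I \<in> closed_ideals. fst (hull_of I) \<inter> Q = {}}"
    and "compact R \<Longrightarrow> R \<subseteq> square \<Longrightarrow> openin tau_r {I \<in> closed_ideals. snd (hull_of I) \<inter> R = {}}"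
proof -
  have CD: "(fst (hull_of I), snd (hull_of I)) \<in> KK" "ideal_of (fst (hull_of I), snd (hull_of I)) = I"
    if "I \<in> closed_ideals" for I
    using that by (simp_all add: hull_of_in_KK ideal_of_hull_of)
  show "openin tau_r {I \<in> closed_ideals. fst (hull_of I) \<inter> Q = {}}" if Q: "compact Q" "Q \<subseteq> {0..1}"
  proof -
    have "fst (hull_of I) \<inter> Q = {} \<longleftrightarrow> (\<forall>p\<in>Q. \<exists>f\<in>I. c1_fun f p \<noteq> 0)" if I: "I \<in> closed_ideals" for I
    proof -
      have "p \<in> fst (hull_of I) \<longleftrightarrow> (\<forall>f\<in>I. c1_fun f p = 0)" if "p \<in> Q" for p
        using fst_ideal_of[OF CD(1)[OF I] subsetD[OF Q(2) that]] CD(2)[OF I] by simp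
      then show ?thesis by blast
    qed
    then have "{I \<in> closed_ideals. fst (hull_of I) \<inter> Q = {}} =
        {I \<in> closed_ideals. \<forall>p\<in>Q. \<exists>f\<in>I. c1_fun f p \<noteq> 0}" by blast
    moreover have "openin tau_u {I \<in> closed_ideals. \<forall>p\<in>Q. \<exists>f\<in>I. c1_fun f p \<noteq> 0}"
      by (rule openin_tau_u_no_common_zero[where ev = "\<lambda>p f. c1_fun f p" and Y = "{0..1}"])
        (use Q in \<open>auto simp: continuous_on_c1_fun c1_fun_add c1_fun_le_norm\<close>)
    ultimately show ?thesis by (simp add: openin_tau_rI)
  qed
  show "openin tau_r {I \<in> closed_ideals. snd (hull_of I) \<inter> R = {}}" if R: "compact R" "R \<subseteq> square"
  proof -
    have "snd (hull_of I) \<inter> R = {} \<longleftrightarrow> (\<forall>p\<in>R. \<exists>f\<in>I. c1_slope p f \<noteq> 0)" if I: "I \<in> closed_ideals" for I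
    proof -
      have "p \<in> snd (hull_of I) \<longleftrightarrow> (\<forall>f\<in>I. c1_slope p f = 0)" if "p \<in> R" for p
        using snd_ideal_of[OF CD(1)[OF I] subsetD[OF R(2) that]] CD(2)[OF I] by simp
      then show ?thesis by blast
    qed
    then have "{I \<in> closed_ideals. snd (hull_of I) \<inter> R = {}} =
        {I \<in> closed_ideals. \<forall>p\<in>R. \<exists>f\<in>I. c1_slope p f \<noteq> 0}" by blast
    moreover have "openin tau_u {I \<in> closed_ideals. \<forall>p\<in>R. \<exists>f\<in>I. c1_slope p f \<noteq> 0}"
      by (rule openin_tau_u_no_common_zero[where ev = c1_slope and Y = square])
        (rule continuous_on_c1_slope c1_slope_add c1_slope_le_norm R; assumption?)+
    ultimately show ?thesis by (simp add: openin_tau_rI)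
  qed
qed

lemma hull_of_hits:
  shows "open U \<Longrightarrow> openin tau_r {I \<in> closed_ideals. fst (hull_of I) \<inter> U \<noteq> {}}"
    and "open W \<Longrightarrow> openin tau_r {I \<in> closed_ideals. snd (hull_of I) \<inter> W \<noteq> {}}"
proof -
  show "openin tau_r {I \<in> closed_ideals. fst (hull_of I) \<inter> U \<noteq> {}}" if U: "open U"
  proof (rule openin_tau_rI, rule disjI2,
      rule openin_tau_n_of_normal_limit[where P = "\<lambda>q. fst q \<inter> U \<noteq> {}"])
    fix G q assume q: "q \<in> KK" "normal_limit G q" "fst q \<inter> U \<noteq> {}"
    then obtain x where x: "x \<in> fst q" "x \<in> U" by blast
    obtain r where r: "r > 0" "ball x r \<subseteq> U" using openE[OF U x(2)] by blast
    have "eventually (\<lambda>q'. fst q' \<inter> ball x r \<noteq> {}) G"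
      using q x r(1) by (intro normal_limit_hits_ball[of G "fst q" "snd q"]) auto
    then show "eventually (\<lambda>q'. fst q' \<inter> U \<noteq> {}) G"
      by eventually_elim (use r(2) in blast)
  qed
  show "openin tau_r {I \<in> closed_ideals. snd (hull_of I) \<inter> W \<noteq> {}}" if W: "open W"
  proof (rule openin_tau_rI, rule disjI2,
      rule openin_tau_n_of_normal_limit[where P = "\<lambda>q. snd q \<inter> W \<noteq> {}"])
    fix G q assume q: "q \<in> KK" "normal_limit G q" "snd q \<inter> W \<noteq> {}"
    then obtain x y where xy: "(x, y) \<in> snd q" "(x, y) \<in> W" by auto
    have q': "(fst q, snd q) \<in> KK" "normal_limit G (fst q, snd q)" using q by simp_all
    show "eventually (\<lambda>q'. snd q' \<inter> W \<noteq> {}) G"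
    proof (cases "x = y")
      case True
      then show ?thesis using normal_limit_hits_diagonal[OF q'(2,1) _ W] xy by simp
    next
      case False
      then show ?thesis using normal_limit_hits_offdiagonal[OF q'(2,1) xy(1) False W xy(2)] by simp
    qed
  qed
qed

lemma continuous_map_fell_topology:
  fixes S :: "'b::metric_space set"
  assumes "compact S"
    and "\<And>x. x \<in> topspace T \<Longrightarrow> closedin (top_of_set S) (f x)"
    and "\<And>Q. compact Q \<Longrightarrow> Q \<subseteq> S \<Longrightarrow> openin T {x \<in> topspace T. f x \<inter> Q = {}}"
    and "\<And>U. open U \<Longrightarrow> openin T {x \<in> topspace T. f x \<inter> U \<noteq> {}}"
  shows "continuous_map T (fell_topology (top_of_set S)) f"
  unfolding fell_topology_def
proof (rule continuous_on_generated_topo)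
  let ?Y = "top_of_set S"
  fix A assume "A \<in> {{F. closedin ?Y F \<and> F \<inter> C = {}} | C. compactin ?Y C} \<union>
      {{F. closedin ?Y F \<and> F \<inter> U \<noteq> {}} | U. openin ?Y U}"
  then consider C where "compactin ?Y C" "A = {F. closedin ?Y F \<and> F \<inter> C = {}}"
    | U where "openin ?Y U" "A = {F. closedin ?Y F \<and> F \<inter> U \<noteq> {}}" by blast
  then show "openin T (f -` A \<inter> topspace T)"
  proof cases
    case 1
    then have "compact C" "C \<subseteq> S" by (auto simp: compactin_subtopology)
    moreover have "f -` A \<inter> topspace T = {x \<in> topspace T. f x \<inter> C = {}}" using 1 assms(2) by auto
    ultimately show ?thesis using assms(3) by simp
  next
    case 2
    then obtain V where V: "open V" "U = S \<inter> V" by (auto simp: openin_open)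
    have "f x \<subseteq> S" if "x \<in> topspace T" for x using closedin_subset[OF assms(2)[OF that]] by simp
    then have "f -` A \<inter> topspace T = {x \<in> topspace T. f x \<inter> V \<noteq> {}}" using 2 V assms(2) by blast
    then show ?thesis using assms(4)[OF V(1)] by simp
  qed
next
  have "f ` topspace T \<subseteq> topspace (fell_topology (top_of_set S))" using assms(2) by auto
  then show "f ` topspace T \<subseteq> \<Union> ({{F. closedin (top_of_set S) F \<and> F \<inter> C = {}} | C. compactin (top_of_set S) C} \<union>
      {{F. closedin (top_of_set S) F \<and> F \<inter> U \<noteq> {}} | U. openin (top_of_set S) U})"
    unfolding fell_topology_def topology_generated_by_topspace .
qed

lemma continuous_map_hull_of: "continuous_map tau_r KK_topology hull_of"
  unfolding KK_topology_def continuous_map_in_subtopology continuous_map_pairwise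
proof (intro conjI)
  have KK: "hull_of I \<in> topspace hyper_product" if "I \<in> closed_ideals" for I
    using hull_of_in_KK[OF that] KK_subset by blast
  then have cl: "closedin (top_of_set {0..1}) (fst (hull_of I))" "closedin (top_of_set square) (snd (hull_of I))"
    if "I \<in> closed_ideals" for I
    using KK[OF that] by (auto simp: mem_Times_iff)
  show "continuous_map tau_r (fell_topology (top_of_set {0..1})) (fst \<circ> hull_of)"
    using cl hull_of_misses(1) hull_of_hits(1) by (intro continuous_map_fell_topology) auto
  show "continuous_map tau_r (fell_topology (top_of_set square)) (snd \<circ> hull_of)"
    using cl hull_of_misses(2) hull_of_hits(2)
    by (intro continuous_map_fell_topology compact_square) (auto simp del: mem_Times_iff)
  show "hull_of \<in> topspace tau_r \<rightarrow> KK" using hull_of_in_KK by auto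
qed


section \<open>Coincidence of the two topologies\<close>

theorem theorem2p3:
  shows "tau = (tau_r :: c1 set topology)
    \<and> topspace (tau_r :: c1 set topology) = closed_ideals
    \<and> compact_space (tau_r :: c1 set topology)
    \<and> Hausdorff_space (tau_r :: c1 set topology)"
proof -
  have "openin tau U \<longleftrightarrow> openin tau_r U" for U
  proof
    assume "openin tau U"
    then obtain V where V: "openin KK_topology V" "U = hull_of -` V \<inter> closed_ideals"
      unfolding tau_def openin_pullback_topology by blast
    have "{I \<in> topspace tau_r. hull_of I \<in> V} = U" using V(2) by auto
    then show "openin tau_r U"
      using openin_continuous_map_preimage[OF continuous_map_hull_of V(1)] by simp
  next
    assume U: "openin tau_r U"
    let ?V = "{q \<in> topspace KK_topology. ideal_of q \<in> U}"
    have "openin KK_topology ?V"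
      by (rule openin_continuous_map_preimage[OF continuous_map_ideal_of U])
    moreover have "U = hull_of -` ?V \<inter> closed_ideals"
      using openin_subset[OF U] hull_of_in_KK ideal_of_hull_of by auto
    ultimately show "openin tau U"
      unfolding tau_def openin_pullback_topology by blast
  qed
  then have eq: "tau = (tau_r :: c1 set topology)" by (simp add: topology_eq)
  have "KK_topology homeomorphic_space tau"
    using homeomorphic_map_ideal_of[OF bij_betw_ideal_of] by (rule homeomorphic_map_imp_homeomorphic_space)
  then have "compact_space tau" "Hausdorff_space tau"
    using compact_space_KK Hausdorff_space_KK homeomorphic_compact_space homeomorphic_Hausdorff_space by blast+
  then show ?thesis by (simp add: eq)
qed

end
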